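(* Let $\mathcal X$ be the context space, $\mathcal Z$ the covariate space, $\mathcal A$ the finite action space and $\mathcal F$ a reward model class that is $1$-uniformly bounded, and let $\mathcal D=\{(x_i,b_i,\tilde z_i,a_i,r_i)\}_{i=1}^N$ be an i.i.d. dataset generated as described in the context. Let $\hat f\in\arg\min_{f\in\mathcal F}\frac1N\sum_{i=1}^N (f(x_i,\tilde z_i,a_i)-r_i)^2$. Then there is a universal constant $c>0$ such that for any $\delta\in(0,1)$, with probability at least $1-4\delta$, $$\|\hat f-f^*\|_2\le c\Big((\max\{4,\lambda\}+1)r_N+\sqrt{\mathcal E^{\mathcal F}_{\mathbb P}(\tilde g)}+4\max\{4,\lambda\}\sqrt{\frac{2\log(\varphi_\lambda(r_N)/\delta)}{N}}+\frac{\log(\varphi_\lambda(r_N)/\delta)}{r_N N}+\frac{4}{\upsilon(f^*,\mathbb P,\tilde g)^{1/2}}\sqrt{\frac{\log(2/\delta)}{N}}\Big).$$ Consequently, there is a constant $C(\lambda,\upsilon(f^*,\mathbb P,\tilde g))$ depending only on $\lambda$ and $\upsilon(f^*,\mathbb P,\tilde g)$ such that for any $\delta\in(0,1)$, with probability at least $1-\delta$, $$\|\hat f-f^*\|_2^2\le C(\lambda,\upsilon(f^*,\mathbb P,\tilde g))\Big(r_N^2+\mathcal E^{\mathcal F}_{\mathbb P}(\tilde g)+\frac{2\log(\varphi_\lambda(r_N)/\delta)}{N}+\frac{\log^2(\varphi_\lambda(r_N)/\delta)}{(r_NN)^2}+\frac{\log(2/\delta)}{N}\Big).$$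
   Context: Setting. $\mathcal X\subset\mathbb R^{k}$, $\mathcal Z\subset\mathbb R$, $\mathcal A$ is a finite set of $K$ actions. Triples $(x,z^*,b)$, with $x\in\mathcal X$ the context, $z^*\in\mathcal Z$ the true covariate and $b\in\{0,1\}$ the missingness indicator ($b=1$: $z^*$ is observed; $b=0$: $z^*$ is missing), are drawn i.i.d. from an unknown joint law $\mathbb P$; $b$ may depend on both $x$ and $z^*$. $\tilde g:\mathcal X\to\mathcal Z$ is a fixed (pre-trained) function. $\mathcal F$ is a known convex class of functions $\mathcal X\times\mathcal Z\times\mathcal A\to[0,1]$ containing the true reward function $f^*$. Data. For each $i$, $\tilde z_i=b_iz_i^*+(1-b_i)\tilde g(x_i)$; the action $a_i$ is drawn from a fixed stochastic policy (a map from $\mathcal X\times\mathcal Z$ to probability distributions on $\mathcal A$) evaluated at $(x_i,\tilde z_i)$; the reward is $r_i=f^*(x_i,z_i^*,a_i)+\xi_i$, where $\xi_i$ is zero-mean random noise bounded in $[-\lambda,\lambda]$. The tuples $(x_i,b_i,\tilde z_i,a_i,r_i)$ are i.i.d. Notation. $\|h\|_2=(\mathbb E[h(x,\tilde z,a)^2])^{1/2}$ under the law of $(x_i,\tilde z_i,a_i)$. With $\varepsilon_1,\dots,\varepsilon_N$ i.i.d. Rademacher signs independent of the data, the local Rademacher complexity is $$\mathcal R_N(t;\mathcal F)=\mathbb E\Big[\sup_{f\in\mathcal F,\ \|f-f^*\|_2\le t}\frac1N\sum_{i=1}^N\varepsilon_i\big(f(x_i,\tilde z_i,a_i)-f^*(x_i,\tilde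 z_i,a_i)\big)\Big],$$ and the critical radius $r_N$ is the smallest $t>0$ with $\frac{t}{16}\ge\frac{\mathcal R_N(t;\mathcal F)}{t}$. Further, $\varphi_a(s)=\log_2(4a/s)$. Model elasticity: $\mathcal E^{\mathcal F}_{\mathbb P}(\tilde g)=\sup_{f\in\mathcal F,\,a\in\mathcal A}\mathbb E_{x,z^*}\big[(f(x,z^*,a)-f(x,\tilde g(x),a))^2\big]$, where $(x,z^* )$ follows its law under $\mathbb P$. Nondegeneracy: it is assumed that $\mathbb E_{x,z^*}[(f(x,z^*,a)-f(x,\tilde g(x),a))^2]>0$ for all $f\in\mathcal F$, $a\in\mathcal A$, and $\upsilon(f,\mathbb P,\tilde g)$ denotes the minimum over $a\in\mathcal A$ of this quantity.
   Formalization: In the first bound c may depend on the number K of actions (no c uniform in K exists), and that bound is stated only for δ ≤ φ_λ(r_N), where its square root is defined; the suprema in R_N are assumed measurable. *)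

theory Defs
  imports "HOL-Probability.Probability"
begin

text \<open>
  Points of \<open>\<real>^k\<close> are extensional functions on \<open>{..<k}\<close> and actions are labelled by natural
  numbers.  The dimension and the number of actions are thereby values rather than types, so that
  the dependence of a constant on them is determined by the order of quantifiers.
\<close>

type_synonym ctx = "nat \<Rightarrow> real"
type_synonym reward = "ctx \<times> real \<times> nat \<Rightarrow> real"

text \<open>A sample is \<open>(x, z\<^sup>*, b, a, \<xi>)\<close>; the learner only sees \<open>(x, b, z\<^sup>~, a, r)\<close>.\<close>

type_synonym sample = "ctx \<times> real \<times> bool \<times> nat \<times> real"

record setting =
  dim :: nat
  contexts :: "ctx set"
  covariates :: "real set"
  actions :: "nat set"
  law :: "(ctx \<times> real \<times> bool) measure"
  impute :: "ctx \<Rightarrow> real"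
  policy :: "ctx \<times> real \<Rightarrow> nat measure"
  noise :: "ctx \<times> real \<times> bool \<times> nat \<Rightarrow> real measure"
  noise_bound :: real
  reward_class :: "reward set"
  true_reward :: reward

definition ctx_space :: "setting \<Rightarrow> ctx measure" where
  "ctx_space S = restrict_space (\<Pi>\<^sub>M i\<in>{..<dim S}. borel) (contexts S)"

definition cov_space :: "setting \<Rightarrow> real measure" where
  "cov_space S = restrict_space borel (covariates S)"

definition act_space :: "setting \<Rightarrow> nat measure" where
  "act_space S = count_space (actions S)"

definition sample_space :: "setting \<Rightarrow> sample measure" where
  "sample_space S = ctx_space S \<Otimes>\<^sub>M cov_space S \<Otimes>\<^sub>M count_space UNIV \<Otimes>\<^sub>M act_space S \<Otimes>\<^sub>M borel"

definition imputed :: "setting \<Rightarrow> ctx \<Rightarrow> real \<Rightarrow> bool \<Rightarrow> real" where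
  "imputed S x z b = (if b then z else impute S x)"

text \<open>
  Given \<open>(x, z\<^sup>*, b)\<close>, the action depends on \<open>x\<close> and the imputed covariate only, whereas the
  distribution of the noise may vary with \<open>(x, z\<^sup>*, b, a)\<close>.
\<close>

definition sample_law :: "setting \<Rightarrow> sample measure" where
  "sample_law S =
     law S \<bind> (\<lambda>(x, z, b). policy S (x, imputed S x z b) \<bind> (\<lambda>a.
       noise S (x, z, b, a) \<bind> (\<lambda>\<xi>. return (sample_space S) (x, z, b, a, \<xi>))))"

definition data_law :: "setting \<Rightarrow> nat \<Rightarrow> (nat \<Rightarrow> sample) measure" where
  "data_law S N = (\<Pi>\<^sub>M i\<in>{..<N}. sample_law S)"

definition observed :: "setting \<Rightarrow> sample \<Rightarrow> ctx \<times> real \<times> nat" where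
  "observed S = (\<lambda>(x, z, b, a, \<xi>). (x, imputed S x z b, a))"

definition reward_obs :: "setting \<Rightarrow> sample \<Rightarrow> real" where
  "reward_obs S = (\<lambda>(x, z, b, a, \<xi>). true_reward S (x, z, a) + \<xi>)"

definition mismatch :: "setting \<Rightarrow> reward \<Rightarrow> nat \<Rightarrow> real" where
  "mismatch S f a = (\<integral>(x, z, b). (f (x, z, a) - f (x, impute S x, a))\<^sup>2 \<partial>law S)"

definition elasticity :: "setting \<Rightarrow> real" where
  "elasticity S = (SUP (f, a)\<in>reward_class S \<times> actions S. mismatch S f a)"

definition upsilon :: "setting \<Rightarrow> reward \<Rightarrow> real" where
  "upsilon S f = (MIN a\<in>actions S. mismatch S f a)"

text \<open>
  \<open>contexts S\<close> and \<open>covariates S\<close> carry their trace \<open>\<sigma>\<close>-algebras.  Values of reward functions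
  outside \<open>contexts S \<times> covariates S \<times> actions S\<close> play no role, except that the class is convex
  as a set of total functions; a class given on the product can be extended by \<open>0\<close>.
\<close>

definition valid_setting :: "setting \<Rightarrow> bool" where
  "valid_setting S \<longleftrightarrow>
     contexts S \<subseteq> space (\<Pi>\<^sub>M i\<in>{..<dim S}. borel :: real measure) \<and>
     finite (actions S) \<and>
     law S \<in> space (prob_algebra (ctx_space S \<Otimes>\<^sub>M cov_space S \<Otimes>\<^sub>M count_space UNIV)) \<and>
     impute S \<in> ctx_space S \<rightarrow>\<^sub>M cov_space S \<and>
     policy S \<in> ctx_space S \<Otimes>\<^sub>M cov_space S \<rightarrow>\<^sub>M prob_algebra (act_space S) \<and>
     noise S \<in> ctx_space S \<Otimes>\<^sub>M cov_space S \<Otimes>\<^sub>M count_space UNIV \<Otimes>\<^sub>M act_space S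
       \<rightarrow>\<^sub>M prob_algebra borel \<and>
     0 < noise_bound S \<and>
     (\<forall>x\<in>contexts S. \<forall>z\<in>covariates S. \<forall>b. \<forall>a\<in>actions S.
        (AE \<xi> in noise S (x, z, b, a). \<xi> \<in> {- noise_bound S..noise_bound S}) \<and>
        (\<integral>\<xi>. \<xi> \<partial>noise S (x, z, b, a)) = 0) \<and>
     (\<forall>f\<in>reward_class S. f \<in> borel_measurable (ctx_space S \<Otimes>\<^sub>M cov_space S \<Otimes>\<^sub>M act_space S)) \<and>
     (\<forall>f\<in>reward_class S. \<forall>p\<in>contexts S \<times> covariates S \<times> actions S. f p \<in> {0..1}) \<and>
     (\<forall>f\<in>reward_class S. \<forall>g\<in>reward_class S. \<forall>u\<in>{0..1}.
        (\<lambda>p. (1 - u) * f p + u * g p) \<in> reward_class S) \<and>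
     true_reward S \<in> reward_class S \<and>
     (\<forall>f\<in>reward_class S. \<forall>a\<in>actions S. 0 < mismatch S f a)"

definition l2norm :: "setting \<Rightarrow> reward \<Rightarrow> real" where
  "l2norm S h = sqrt (\<integral>w. (h (observed S w))\<^sup>2 \<partial>sample_law S)"

definition l2dist :: "setting \<Rightarrow> reward \<Rightarrow> reward \<Rightarrow> real" where
  "l2dist S f g = l2norm S (\<lambda>p. f p - g p)"

definition empirical_loss :: "setting \<Rightarrow> nat \<Rightarrow> (nat \<Rightarrow> sample) \<Rightarrow> reward \<Rightarrow> real" where
  "empirical_loss S N D f = (1 / real N) * (\<Sum>i<N. (f (observed S (D i)) - reward_obs S (D i))\<^sup>2)"

definition erm :: "setting \<Rightarrow> nat \<Rightarrow> (nat \<Rightarrow> sample) \<Rightarrow> reward set" where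
  "erm S N D = {f. is_arg_min (empirical_loss S N D) (\<lambda>f. f \<in> reward_class S) f}"

definition sign_law :: "nat \<Rightarrow> (nat \<Rightarrow> real) measure" where
  "sign_law N = (\<Pi>\<^sub>M i\<in>{..<N}. uniform_count_measure {-1, 1})"

definition local_sup :: "setting \<Rightarrow> nat \<Rightarrow> real \<Rightarrow> (nat \<Rightarrow> real) \<times> (nat \<Rightarrow> sample) \<Rightarrow> real" where
  "local_sup S N t = (\<lambda>(\<epsilon>, D).
     SUP f\<in>{f \<in> reward_class S. l2dist S f (true_reward S) \<le> t}.
       (1 / real N) * (\<Sum>i<N. \<epsilon> i * (f (observed S (D i)) - true_reward S (observed S (D i)))))"

definition rademacher :: "setting \<Rightarrow> nat \<Rightarrow> real \<Rightarrow> real" where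
  "rademacher S N t = (\<integral>\<omega>. local_sup S N t \<omega> \<partial>(sign_law N \<Otimes>\<^sub>M data_law S N))"

text \<open>
  The class may be uncountable, and the Bochner integral of a non-measurable function is \<open>0\<close>,
  so \<^const>\<open>rademacher\<close> is the intended expectation only if the suprema are random variables.
\<close>

definition rademacher_defined :: "setting \<Rightarrow> nat \<Rightarrow> bool" where
  "rademacher_defined S N \<longleftrightarrow>
     (\<forall>t>0. local_sup S N t \<in> borel_measurable (sign_law N \<Otimes>\<^sub>M data_law S N))"

definition is_critical_radius :: "setting \<Rightarrow> nat \<Rightarrow> real \<Rightarrow> bool" where
  "is_critical_radius S N r \<longleftrightarrow>
     0 < r \<and> rademacher S N r / r \<le> r / 16 \<and>
     (\<forall>t>0. rademacher S N t / t \<le> t / 16 \<longrightarrow> r \<le> t)"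

text \<open>
  For \<open>\<delta> > 0\<close>, the logarithm of \<open>phi a s / \<delta>\<close> exists and is nonnegative (so that its square root
  makes sense) iff \<open>\<delta> \<le> phi a s\<close>.
\<close>

definition phi :: "real \<Rightarrow> real \<Rightarrow> real" where
  "phi a s = log 2 (4 * a / s)"

text \<open>
  For a property that defines an event this says that the event has probability at least \<open>p\<close>;
  otherwise the bound is on the inner probability.
\<close>

definition with_prob_at_least :: "'w measure \<Rightarrow> real \<Rightarrow> ('w \<Rightarrow> bool) \<Rightarrow> bool" where
  "with_prob_at_least M p Q \<longleftrightarrow> (\<exists>E\<in>sets M. p \<le> measure M E \<and> (\<forall>w\<in>E. Q w))"

end

theory Submission
  imports Defs
begin

text \<open>
  The elasticity is at least \<open>\<upsilon> = upsilon S f\<^sup>*\<close>.  Hence \<open>C = 1 / \<upsilon>\<close> makes the second bound trivial, and by the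
  arithmetic-geometric mean inequality the first bound exceeds a multiple of \<open>(ln (2 / \<delta>) / N) powr (1 / 4)\<close>.
  So for the squares of the class a slow rate of concentration suffices, whereas the noise has to
  be treated with a variance-sensitive inequality because \<open>\<lambda>\<close> is arbitrary.

  Let \<open>t\<close> be the claimed bound. If the empirical minimiser were further away from \<open>f\<^sup>*\<close> than \<open>t\<close>, then
  rescaling it towards \<open>f\<^sup>*\<close> by convexity would give some \<open>h\<close> of norm exactly \<open>t\<close>, whose
  empirical second moment is at most \<open>4\<close> times the empirical second moment of the imputation error plus
  \<open>4\<close> times the empirical mean of \<open>\<xi> h\<close>. So only one radius is needed, and no peeling.

  Nothing but the linear suprema \<open>W(\<epsilon>, D)\<close>, for sign vectors \<open>\<epsilon>\<close>, is known to be measurable. Their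
  exponential moments are controlled by exchanging coordinates of two independent samples together
  with Maurey's inequality on the cube. The suprema of \<open>\<xi> h\<close> and of \<open>h\<^sup>2\<close> are bounded by
  measurable functions of the \<open>W(\<epsilon>, D)\<close>: the former by averaging over signs with mean \<open>\<xi> / \<lambda>\<close>, the latter by
  passing to the polytope that the inequalities \<open>\<epsilon> \<bullet> u / N \<le> W(\<epsilon>, D)\<close> define.
\<close>

section \<open>Suprema over random signs\<close>

text \<open>The usual variance-sensitive inequality for one sample needs the supremum of the squares
  as a random variable, which is not at hand. For two frozen samples, exchanging coordinates
  according to a sign vector \<tau> turns a difference of two values of \<open>W\<close> into
  Z(\<tau>) - Z(-\<tau>), with Z a supremum of affine functions on a finite cube. Expectations over
  \<tau> are finite sums, so that nothing has to be measurable, and convexity makes the variance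
  proxy the largest empirical second moment instead of the constant of a bounded-difference
  argument. That proxy is random as well; it is subtracted in the exponent before integrating, and
  its measurable majorant is \<open>t\<^sup>2 + q + 4 / N\<close>. The number of actions enters the
  constant only through \<open>err_mean\<close>: the elasticity fixes the action before averaging
  over contexts, while the policy picks it after seeing the context.\<close>

definition signs :: "'i set \<Rightarrow> ('i \<Rightarrow> real) set" where
  "signs I = (\<Pi>\<^sub>E i\<in>I. {-1, 1})"

lemma finite_signs [simp]: "finite I \<Longrightarrow> finite (signs I)"
  unfolding signs_def by (intro finite_PiE) auto

lemma card_signs: "finite I \<Longrightarrow> card (signs I) = 2 ^ card I"
  unfolding signs_def by (simp add: card_PiE numeral_2_eq_2)

lemma signs_cases: "\<epsilon> \<in> signs I \<Longrightarrow> i \<in> I \<Longrightarrow> \<epsilon> i = 1 \<or> \<epsilon> i = -1"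
  unfolding signs_def by auto

lemma sum_signs_insert:
  assumes "finite I" "i \<notin> I"
  shows "(\<Sum>\<epsilon>\<in>signs (insert i I). f \<epsilon>) = (\<Sum>\<epsilon>\<in>signs I. f (\<epsilon>(i := 1)) + f (\<epsilon>(i := -1)) :: real)"
proof -
  have "(\<Sum>\<epsilon>\<in>signs (insert i I). f \<epsilon>)
      = (\<Sum>(y, g)\<in>{-1, 1} \<times> signs I. f (g(i := y)))"
    unfolding signs_def PiE_insert_eq
    by (subst sum.reindex) (auto intro!: inj_combinator assms simp: case_prod_beta)
  also have "\<dots> = (\<Sum>y\<in>{-1,1}. \<Sum>g\<in>signs I. f (g(i := y)))"
    by (simp add: sum.cartesian_product)
  finally show ?thesis by (simp add: sum.distrib)
qed

lemma sum_fun_upd: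
  assumes "finite I" "i \<notin> I"
  shows "(\<Sum>j\<in>insert i I. (\<epsilon>(i := y)) j * x j) = y * x i + (\<Sum>j\<in>I. \<epsilon> j * x j :: real)"
proof -
  have "(\<Sum>j\<in>I. (\<epsilon>(i := y)) j * x j) = (\<Sum>j\<in>I. \<epsilon> j * x j)"
    using assms by (intro sum.cong) auto
  then show ?thesis using assms by simp
qed

text \<open>Weak majorization for an increasing convex function. Once both pairs are ordered,
  tangent estimates chain up: exp B - exp D \<le> exp B (B - D) \<le> exp B (C - A) \<le> exp A (C -
  A) \<le> exp C - exp A.\<close>

lemma exp_weak_majorization:
  fixes A B C D :: real
  assumes "A + B \<le> C + D" "max A B \<le> max C D"
  shows "exp A + exp B \<le> exp C + exp D"
proof -
  have *: "exp A + exp B \<le> exp C + exp D"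
    if "A + B \<le> C + D" "A \<le> C" "B \<le> A" "D \<le> C" for A B C D :: real
  proof -
    have "exp B - exp D \<le> exp B * (B - D)"
      using exp_ge_add_one_self[of "D - B"] by (simp add: exp_diff field_simps)
    also have "\<dots> \<le> exp B * (C - A)"
      using that by (intro mult_left_mono) auto
    also have "\<dots> \<le> exp A * (C - A)"
      using that by (intro mult_right_mono) auto
    also have "\<dots> \<le> exp C - exp A"
      using exp_ge_add_one_self[of "C - A"] by (simp add: exp_diff field_simps)
    finally show ?thesis by simp
  qed
  show ?thesis
    using *[of A B C D] *[of A B D C] *[of B A C D] *[of B A D C] assms
    by (auto simp: max_def split: if_splits)
qed

text \<open>The Ledoux-Talagrand contraction principle in exponential form, proved one sign at a
  time. The arbitrary offset \<open>a\<close> makes the induction close, because it stores the terms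
  of the signs that are already fixed.\<close>

theorem rademacher_contraction_exp:
  fixes \<alpha> \<beta> :: "'p \<Rightarrow> 'i \<Rightarrow> real"
  assumes "finite I" and T: "finite T" "T \<noteq> {}"
    and "\<And>p q i. p \<in> T \<Longrightarrow> q \<in> T \<Longrightarrow> i \<in> I \<Longrightarrow> \<bar>\<alpha> p i - \<alpha> q i\<bar> \<le> \<bar>\<beta> p i - \<beta> q i\<bar>"
    and "\<And>p i. p \<in> T \<Longrightarrow> i \<in> I \<Longrightarrow> \<bar>\<alpha> p i\<bar> \<le> \<bar>\<beta> p i\<bar>"
  shows "(\<Sum>\<epsilon>\<in>signs I. exp (Max ((\<lambda>p. a p + (\<Sum>i\<in>I. \<epsilon> i * \<alpha> p i)) ` T)))
    \<le> (\<Sum>\<epsilon>\<in>signs I. exp (Max ((\<lambda>p. a p + (\<Sum>i\<in>I. \<epsilon> i * \<beta> p i)) ` T)))"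
  using assms(1,4,5)
proof (induction I arbitrary: a rule: finite_induct)
  case (insert j I)
  have IH: "(\<Sum>\<epsilon>\<in>signs I. exp (Max ((\<lambda>p. a p + (\<Sum>i\<in>I. \<epsilon> i * \<alpha> p i)) ` T)))
    \<le> (\<Sum>\<epsilon>\<in>signs I. exp (Max ((\<lambda>p. a p + (\<Sum>i\<in>I. \<epsilon> i * \<beta> p i)) ` T)))" for a
    by (rule insert.IH) (use insert.prems in auto)
  have step: "exp (Max ((\<lambda>p. c p + \<alpha> p j) ` T)) + exp (Max ((\<lambda>p. c p - \<alpha> p j) ` T))
      \<le> exp (Max ((\<lambda>p. c p + \<beta> p j) ` T)) + exp (Max ((\<lambda>p. c p - \<beta> p j) ` T))" for c
  proof -
    let ?S = "Max ((\<lambda>p. c p + \<beta> p j) ` T)" and ?D = "Max ((\<lambda>p. c p - \<beta> p j) ` T)"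
    have S: "c p + \<beta> p j \<le> ?S" "c p - \<beta> p j \<le> ?D" if "p \<in> T" for p
      using T that by auto
    have "Max ((\<lambda>p. c p + \<alpha> p j) ` T) \<in> (\<lambda>p. c p + \<alpha> p j) ` T"
      using T by (intro Max_in) auto
    then obtain u where u: "u \<in> T" "Max ((\<lambda>p. c p + \<alpha> p j) ` T) = c u + \<alpha> u j" by auto
    have "Max ((\<lambda>p. c p - \<alpha> p j) ` T) \<in> (\<lambda>p. c p - \<alpha> p j) ` T"
      using T by (intro Max_in) auto
    then obtain w where w: "w \<in> T" "Max ((\<lambda>p. c p - \<alpha> p j) ` T) = c w - \<alpha> w j" by auto
    \<comment> \<open>The two exponents on the left add up to at most c u + c w + |\<beta> u j -
      \<beta> w j|, which is at most \<open>?S + ?D\<close> after giving u and w the right signs.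
      Each of them alone is at most c + |\<beta>| at its maximiser, hence at most the larger of
      \<open>?S\<close> and \<open>?D\<close>.\<close>
    have "\<bar>\<alpha> u j - \<alpha> w j\<bar> \<le> \<bar>\<beta> u j - \<beta> w j\<bar>" "\<bar>\<alpha> u j\<bar> \<le> \<bar>\<beta> u j\<bar>" "\<bar>\<alpha> w j\<bar> \<le> \<bar>\<beta> w j\<bar>"
      using insert.prems u w by auto
    then show ?thesis
      unfolding u w using S[OF u(1)] S[OF w(1)]
      by (intro exp_weak_majorization) linarith+
  qed
  have "(\<Sum>\<epsilon>\<in>signs (insert j I). exp (Max ((\<lambda>p. a p + (\<Sum>i\<in>insert j I. \<epsilon> i * \<alpha> p i)) ` T)))
    = (\<Sum>\<epsilon>\<in>signs I. exp (Max ((\<lambda>p. (a p + \<alpha> p j) + (\<Sum>i\<in>I. \<epsilon> i * \<alpha> p i)) ` T)))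
    + (\<Sum>\<epsilon>\<in>signs I. exp (Max ((\<lambda>p. (a p - \<alpha> p j) + (\<Sum>i\<in>I. \<epsilon> i * \<alpha> p i)) ` T)))"
    using insert.hyps
    by (simp add: sum_signs_insert sum_fun_upd sum.distrib add.assoc[symmetric] diff_add_eq
        add_diff_eq del: sum.insert fun_upd_apply)
  also have "\<dots> \<le> (\<Sum>\<epsilon>\<in>signs I. exp (Max ((\<lambda>p. (a p + \<alpha> p j) + (\<Sum>i\<in>I. \<epsilon> i * \<beta> p i)) ` T)))
    + (\<Sum>\<epsilon>\<in>signs I. exp (Max ((\<lambda>p. (a p - \<alpha> p j) + (\<Sum>i\<in>I. \<epsilon> i * \<beta> p i)) ` T)))"
    by (intro add_mono IH)
  also have "\<dots> = (\<Sum>\<epsilon>\<in>signs I.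
       exp (Max ((\<lambda>p. (a p + (\<Sum>i\<in>I. \<epsilon> i * \<beta> p i)) + \<alpha> p j) ` T))
     + exp (Max ((\<lambda>p. (a p + (\<Sum>i\<in>I. \<epsilon> i * \<beta> p i)) - \<alpha> p j) ` T)))"
    by (simp add: sum.distrib add_ac diff_add_eq)
  also have "\<dots> \<le> (\<Sum>\<epsilon>\<in>signs I.
       exp (Max ((\<lambda>p. (a p + (\<Sum>i\<in>I. \<epsilon> i * \<beta> p i)) + \<beta> p j) ` T))
     + exp (Max ((\<lambda>p. (a p + (\<Sum>i\<in>I. \<epsilon> i * \<beta> p i)) - \<beta> p j) ` T)))"
    by (intro sum_mono step)
  also have "\<dots> = (\<Sum>\<epsilon>\<in>signs (insert j I). exp (Max ((\<lambda>p. a p + (\<Sum>i\<in>insert j I. \<epsilon> i * \<beta> p i)) ` T)))"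
    using insert.hyps
    by (simp add: sum_signs_insert sum_fun_upd sum.distrib add_ac diff_add_eq
        add_diff_eq del: sum.insert fun_upd_apply)
  finally show ?case .
qed (simp add: signs_def)

text \<open>The scalar inequality to which the induction on the dimension of the cube reduces: d is
  the logarithmic ratio of two half-cube sums, u the fraction of the way towards the opposite sign,
  and u^2 / 8 the cost of that move. The exponent is minimal at u = 4 d, which leaves the unit
  interval for d > 1/4; hence the case distinction.\<close>

lemma two_point_exp_bound:
  assumes d: "0 \<le> (d::real)"
  shows "\<exists>u\<in>{0..1}. (1 + exp ((1 - u) * d + u\<^sup>2 / 8)) * (1 + exp (- d)) \<le> 4"
proof (cases "d \<ge> 1 / 4")
  case True
  have e1: "exp (1 / 8 :: real) \<le> 1 + 1/8 + (1/8)\<^sup>2"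
    by (rule exp_bound) auto
  have "1 + 1 / 4 + (1/4)\<^sup>2 / 2 \<le> exp (1 / 4 :: real)"
    using exp_lower_Taylor_quadratic[of "1/4::real"] by simp
  moreover have "exp (1 / 4) \<le> exp d" using True by simp
  ultimately have "1 + 1 / 4 + (1/4)\<^sup>2 / 2 \<le> exp d" by linarith
  then have "exp (- d) \<le> inverse (1 + 1 / 4 + (1/4)\<^sup>2 / 2)"
    unfolding exp_minus by (intro le_imp_inverse_le) (auto simp: power2_eq_square)
  then have e2: "1 + exp (- d) \<le> 1 + 32 / 41" by (simp add: power2_eq_square)
  have "(1 + exp (1 / 8)) * (1 + exp (- d)) \<le> (2 + 1/8 + (1/8)\<^sup>2) * (1 + 32/41)"
    using e1 e2 by (intro mult_mono) auto
  also have "\<dots> \<le> 4" by (simp add: power2_eq_square)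
  finally show ?thesis by (intro bexI[of _ 1]) auto
next
  case False
  \<comment> \<open>The value of the exponent at its minimiser u = 4 d.\<close>
  define x where "x = d - 2 * d\<^sup>2"
  have x: "0 \<le> x" "x \<le> d"
  proof -
    have "d * d \<le> d * (1/4)" using False d by (intro mult_left_mono) auto
    then show "0 \<le> x" "x \<le> d" using d by (auto simp: x_def power2_eq_square)
  qed
  have "exp x \<le> 1 + x + x\<^sup>2" using x False by (intro exp_bound) auto
  also have "x\<^sup>2 \<le> d\<^sup>2" using x by (intro power_mono) auto
  finally have e1: "1 + exp x \<le> 2 + d - d\<^sup>2" by (simp add: x_def)
  have "exp (- d) * (1 + d + d\<^sup>2 / 2) \<le> exp (- d) * exp d"
    using exp_lower_Taylor_quadratic[OF d] by (intro mult_left_mono) auto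
  then have "exp (- d) * (1 + d + d\<^sup>2 / 2) \<le> 1" by (simp add: exp_minus)
  \<comment> \<open>The product is 1 + d^4 / 4. It converts the Taylor lower bound for exp d into an
    upper bound for exp (-d).\<close>
  moreover have "1 \<le> (1 - d + d\<^sup>2 / 2) * (1 + d + d\<^sup>2 / 2)"
    using zero_le_power[OF d, of 4] by (simp add: power4_eq_xxxx algebra_simps power2_eq_square)
  ultimately have "exp (- d) * (1 + d + d\<^sup>2 / 2) \<le> (1 - d + d\<^sup>2 / 2) * (1 + d + d\<^sup>2 / 2)" by linarith
  then have e2: "1 + exp (- d) \<le> 2 - d + d\<^sup>2 / 2"
    using d by (simp add: mult_le_cancel_right add_pos_nonneg)
  have "(1 + exp x) * (1 + exp (- d)) \<le> (2 + d - d\<^sup>2) * (2 - d + d\<^sup>2 / 2)"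
    using e1 e2 by (intro mult_mono order_trans[OF _ e1]) (auto simp: add_nonneg_nonneg)
  also have "\<dots> \<le> 4"
  proof -
    have "d^3 \<le> d^2 * (1/4)" using False d
      unfolding power3_eq_cube power2_eq_square by (intro mult_left_mono) auto
    moreover have "0 \<le> d^2" "0 \<le> d^4"
      by (rule zero_le_power, rule d)+
    moreover have "(2 + d - d\<^sup>2) * (2 - d + d\<^sup>2 / 2) = 4 - 2 * d^2 + 3/2 * d^3 - d^4/2"
      by (simp add: field_simps power2_eq_square power3_eq_cube power4_eq_xxxx)
    ultimately show ?thesis by linarith
  qed
  finally have "(1 + exp x) * (1 + exp (- d)) \<le> 4" .
  moreover have "(1 - 4 * d) * d + (4 * d)\<^sup>2 / 8 = x"
    by (simp add: x_def algebra_simps power2_eq_square)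
  ultimately show ?thesis using False d by (intro bexI[of _ "4 * d"]) auto
qed

text \<open>Hoelder's inequality, read as convexity of log-sum-exp. Normalising both families to
  total mass 1 reduces it to pointwise convexity of exp.\<close>

lemma sum_exp_convex_comb:
  fixes f g :: "'a \<Rightarrow> real"
  assumes "finite A" "A \<noteq> {}" "0 \<le> u" "u \<le> 1"
  shows "(\<Sum>x\<in>A. exp ((1 - u) * f x + u * g x))
    \<le> exp ((1 - u) * ln (\<Sum>x\<in>A. exp (f x)) + u * ln (\<Sum>x\<in>A. exp (g x)))"
proof -
  define p q where "p = ln (\<Sum>x\<in>A. exp (f x))" and "q = ln (\<Sum>x\<in>A. exp (g x))"
  have pq: "exp p = (\<Sum>x\<in>A. exp (f x))" "exp q = (\<Sum>x\<in>A. exp (g x))"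
    unfolding p_def q_def using assms by (auto intro!: exp_ln sum_pos)
  have "exp ((1 - u) * f x + u * g x)
      \<le> exp ((1 - u) * p + u * q) * ((1 - u) * (exp (f x) / exp p) + u * (exp (g x) / exp q))" for x
  proof -
    have "exp ((1 - u) *\<^sub>R (f x - p) + u *\<^sub>R (g x - q)) \<le> (1 - u) * exp (f x - p) + u * exp (g x - q)"
      using assms by (intro convex_onD[OF exp_convex]) auto
    then have "exp ((1 - u) * p + u * q) * exp ((1 - u) * (f x - p) + u * (g x - q))
       \<le> exp ((1 - u) * p + u * q) * ((1 - u) * exp (f x - p) + u * exp (g x - q))"
      by (intro mult_left_mono) auto
    moreover have "(1 - u) * p + u * q + ((1 - u) * (f x - p) + u * (g x - q)) = (1 - u) * f x + u * g x"
      by (simp add: algebra_simps)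
    ultimately show ?thesis
      by (simp add: exp_add[symmetric] exp_diff)
  qed
  then have "(\<Sum>x\<in>A. exp ((1 - u) * f x + u * g x))
      \<le> (\<Sum>x\<in>A. exp ((1 - u) * p + u * q) * ((1 - u) * (exp (f x) / exp p) + u * (exp (g x) / exp q)))"
    by (rule sum_mono)
  also have "\<dots> = exp ((1 - u) * p + u * q) * ((1 - u) * (exp p / exp p) + u * (exp q / exp q))"
    by (simp add: pq sum_distrib_left[symmetric] sum.distrib sum_divide_distrib[symmetric])
  finally show ?thesis by (simp add: p_def q_def)
qed

text \<open>The arithmetic of the induction step in Maurey's inequality. Here exp p and exp q are
  the half-cube sums of the penalised supremum, P' and Q' those of the exponential of minus the
  supremum, and the bounds on P' and Q' are the induction hypothesis. The half with the smaller
  penalised sum stays in place (u = 0); only the other one is moved towards it, by the u of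
  \<open>two_point_exp_bound\<close>.\<close>

lemma two_point_transport:
  fixes p q :: real
  assumes n: "0 \<le> n"
    and "0 \<le> P'" "P' \<le> n / exp p" "0 \<le> Q'" "Q' \<le> n / exp q"
    and A: "\<And>u. u \<in> {0..1} \<Longrightarrow> A \<le> exp ((1 - u) * p + u * q + u\<^sup>2 / 8)"
    and B: "\<And>u. u \<in> {0..1} \<Longrightarrow> B \<le> exp ((1 - u) * q + u * p + u\<^sup>2 / 8)"
    and "0 \<le> A" "0 \<le> B"
  shows "(A + B) * (P' + Q') \<le> 4 * n"
proof -
  have *: "(A + B) * (n / exp p + n / exp q) \<le> 4 * n"
    if "q \<le> p" and A: "\<And>u. u \<in> {0..1} \<Longrightarrow> A \<le> exp ((1 - u) * p + u * q + u\<^sup>2 / 8)"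
      and B: "B \<le> exp q" for A B p q :: real
  proof -
    obtain u where u: "u \<in> {0..1}" "(1 + exp ((1 - u) * (p - q) + u\<^sup>2 / 8)) * (1 + exp (- (p - q))) \<le> 4"
      using two_point_exp_bound[of "p - q"] \<open>q \<le> p\<close> by auto
    have "A + B \<le> exp q * (1 + exp ((1 - u) * (p - q) + u\<^sup>2 / 8))"
    proof -
      have "q + ((1 - u) * (p - q) + u\<^sup>2 / 8) = (1 - u) * p + u * q + u\<^sup>2 / 8"
        by (simp add: algebra_simps)
      then have "exp q * exp ((1 - u) * (p - q) + u\<^sup>2 / 8) = exp ((1 - u) * p + u * q + u\<^sup>2 / 8)"
        by (simp only: exp_add[symmetric])
      then show ?thesis using A[OF u(1)] B by (simp add: distrib_left)
    qed
    then have "(A + B) * (n / exp q * (1 + exp (- (p - q))))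
      \<le> (exp q * (1 + exp ((1 - u) * (p - q) + u\<^sup>2 / 8))) * (n / exp q * (1 + exp (- (p - q))))"
      using n by (rule_tac mult_right_mono) (auto simp: add_nonneg_nonneg)
    also have "\<dots> = n * ((1 + exp ((1 - u) * (p - q) + u\<^sup>2 / 8)) * (1 + exp (- (p - q))))" by simp
    also have "\<dots> \<le> n * 4" using u n by (intro mult_left_mono) auto
    also have "n / exp q * (1 + exp (- (p - q))) = n / exp p + n / exp q"
      by (simp add: exp_diff exp_minus field_simps)
    finally show ?thesis by simp
  qed
  have "(A + B) * (P' + Q') \<le> (A + B) * (n / exp p + n / exp q)"
    using assms by (intro mult_left_mono) auto
  also have "\<dots> \<le> 4 * n"
  proof (cases "q \<le> p")
    case True
    then show ?thesis using *[of q p A B] A B[of 0] by simp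
  next
    case False
    then show ?thesis using *[of p q B A] A[of 0] B by (simp add: add.commute)
  qed
  finally show ?thesis .
qed

lemma bounded_linear_form:
  fixes b :: "'p \<Rightarrow> 'i \<Rightarrow> real"
  assumes "finite I" "bounded (a ` T)" "\<And>i. i \<in> I \<Longrightarrow> bounded ((\<lambda>p. b p i) ` T)"
  shows "bounded ((\<lambda>p. a p + (\<Sum>i\<in>I. x i * b p i)) ` T)"
  using assms
proof (induction I rule: finite_induct)
  case (insert j I)
  have "bounded ((\<lambda>p. x j * b p j) ` T)"
    using bounded_scaling[of "(\<lambda>p. b p j) ` T" "x j"] insert.prems by (simp add: image_image)
  moreover have "bounded ((\<lambda>p. a p + (\<Sum>i\<in>I. x i * b p i)) ` T)" using insert by auto
  ultimately have "bounded ((\<lambda>p. x j * b p j + (a p + (\<Sum>i\<in>I. x i * b p i))) ` T)"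
    by (rule bounded_plus_comp)
  then show ?case using insert.hyps by (simp add: add_ac)
qed simp

text \<open>
  This is Maurey's infimum-convolution inequality for convex functions on the discrete cube,
  specialised to suprema of affine functions.
\<close>

theorem rademacher_sup_infconv:
  fixes b :: "'p \<Rightarrow> 'i \<Rightarrow> real"
  assumes "finite I" and T: "T \<noteq> {}"
    and "bounded (a ` T)" "\<And>i. i \<in> I \<Longrightarrow> bounded ((\<lambda>p. b p i) ` T)"
  shows "(\<Sum>\<epsilon>\<in>signs I. exp (SUP p\<in>T. a p - 8 * (\<Sum>i\<in>I. (b p i)\<^sup>2) + (\<Sum>i\<in>I. \<epsilon> i * b p i)))
    * (\<Sum>\<epsilon>\<in>signs I. exp (- (SUP p\<in>T. a p + (\<Sum>i\<in>I. \<epsilon> i * b p i)))) \<le> (2 ^ card I)\<^sup>2"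
  using assms(1,3,4)
proof (induction I arbitrary: a rule: finite_induct)
  case empty
  then show ?case by (simp add: signs_def exp_minus)
next
  case (insert j I)
  define L where "L a \<epsilon> = (SUP p\<in>T. a p + (\<Sum>i\<in>I. \<epsilon> i * b p i))" for a \<epsilon>
  define V where "V p = 8 * (\<Sum>i\<in>I. (b p i)\<^sup>2)" for p
  let ?ap = "\<lambda>p. a p + b p j" and ?am = "\<lambda>p. a p - b p j"
  let ?P = "\<Sum>\<epsilon>\<in>signs I. exp (L (\<lambda>p. ?ap p - V p) \<epsilon>)" and ?Q = "\<Sum>\<epsilon>\<in>signs I. exp (L (\<lambda>p. ?am p - V p) \<epsilon>)"
  let ?P' = "\<Sum>\<epsilon>\<in>signs I. exp (- L ?ap \<epsilon>)" and ?Q' = "\<Sum>\<epsilon>\<in>signs I. exp (- L ?am \<epsilon>)"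
  let ?A = "\<Sum>\<epsilon>\<in>signs I. exp (L (\<lambda>p. ?ap p - V p - 8 * (b p j)\<^sup>2) \<epsilon>)"
    and ?B = "\<Sum>\<epsilon>\<in>signs I. exp (L (\<lambda>p. ?am p - V p - 8 * (b p j)\<^sup>2) \<epsilon>)"
  let ?n = "(2 ^ card I)\<^sup>2 :: real"
  have ne: "signs I \<noteq> {}" by (auto simp: signs_def PiE_eq_empty_iff)
  have bd_sq: "bounded ((\<lambda>p. (b p i)\<^sup>2) ` T)" if i: "i \<in> insert j I" for i
  proof -
    obtain B where "\<forall>p\<in>T. \<bar>b p i\<bar> \<le> B" using insert.prems(2)[OF i] by (auto simp: bounded_iff)
    then have "\<forall>p\<in>T. \<bar>(b p i)\<^sup>2\<bar> \<le> B\<^sup>2"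
      using abs_le_square_iff by (metis abs_ge_zero abs_le_iff abs_of_nonneg order_trans power2_abs power_mono zero_le_power2)
    then show ?thesis by (auto simp: bounded_iff)
  qed
  have bd: "bounded (?ap ` T)" "bounded (?am ` T)"
    using insert.prems by (auto intro!: bounded_plus_comp bounded_minus_comp)
  have zero: "bounded ((\<lambda>_. 0 :: real) ` T)" by (auto simp: bounded_iff)
  have bV: "bounded (V ` T)"
    using bounded_linear_form[of I "\<lambda>_. 0" T "\<lambda>p i. (b p i)\<^sup>2" "\<lambda>_. 8", OF insert.hyps(1) zero] bd_sq
    by (simp add: V_def[abs_def] sum_distrib_left)
  have bdd: "bdd_above ((\<lambda>p. c p + (\<Sum>i\<in>I. \<epsilon> i * b p i)) ` T)" if "bounded (c ` T)" for c \<epsilon>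
    using bounded_linear_form[of I c T b \<epsilon>] insert that by (auto intro: bounded_imp_bdd_above)
  have bdV: "bounded ((\<lambda>p. ?ap p - V p) ` T)" "bounded ((\<lambda>p. ?am p - V p) ` T)"
    using bd bV by (auto intro!: bounded_minus_comp)
  have IH: "?P * ?P' \<le> ?n" "?Q * ?Q' \<le> ?n"
    using insert.IH[of ?ap] insert.IH[of ?am] bd insert.prems(2)
    by (simp_all add: L_def V_def)
  have pos: "0 < ?P" "0 < ?Q" using ne insert.hyps by (auto intro!: sum_pos)
  \<comment> \<open>Completing the square. It matches the penalty with the cost: the convex
    conjugate of 8 x^2, taken at 2 u, is u^2 / 8, and 2 u is the distance that a sign travels when
    moved by the fraction u.\<close>
  have quad: "2 * u * x - 8 * x\<^sup>2 \<le> u\<^sup>2 / 8" for u x :: real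
    using sum_squares_ge_zero[of "u / 4 - 4 * x" 0] zero_le_power2[of "u - 8 * x"]
    by (simp add: power2_eq_square algebra_simps)
  \<comment> \<open>Moving sign j by the fraction u replaces the offset c by (1 - u) c + u d. This
    changes each affine function by u (c - d) = 2 u s b_j, which the penalty of coordinate j pays
    for up to u^2 / 8, uniformly in p.\<close>
  have L_le: "L (\<lambda>p. c p - V p - 8 * (b p j)\<^sup>2) \<epsilon>
      \<le> (1 - u) * L (\<lambda>p. c p - V p) \<epsilon> + u * L (\<lambda>p. d p - V p) \<epsilon> + u\<^sup>2 / 8"
    if cd: "bounded ((\<lambda>p. c p - V p) ` T)" "bounded ((\<lambda>p. d p - V p) ` T)"
      and u: "u \<in> {0..1}" and s: "\<bar>s\<bar> = 1" "\<And>p. c p - d p = 2 * (s * b p j)" for c d u \<epsilon> s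
    unfolding L_def
  proof (rule cSUP_least[OF T])
    fix p assume p: "p \<in> T"
    let ?S = "\<Sum>i\<in>I. \<epsilon> i * b p i"
    have 1: "(1 - u) * (c p - V p + ?S) \<le> (1 - u) * (SUP p\<in>T. c p - V p + (\<Sum>i\<in>I. \<epsilon> i * b p i))"
      using u by (intro mult_left_mono cSUP_upper[OF p] bdd cd) auto
    have 2: "u * (d p - V p + ?S) \<le> u * (SUP p\<in>T. d p - V p + (\<Sum>i\<in>I. \<epsilon> i * b p i))"
      using u by (intro mult_left_mono cSUP_upper[OF p] bdd cd) auto
    have "(s * b p j)\<^sup>2 = (b p j)\<^sup>2" using s(1) by (metis power2_abs mult_1 power_mult_distrib power_one)
    moreover have "c p - V p - 8 * (b p j)\<^sup>2 + ?S
      = (1 - u) * (c p - V p + ?S) + u * (d p - V p + ?S) + (u * (c p - d p) - 8 * (b p j)\<^sup>2)"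
      by (simp add: algebra_simps)
    moreover have "u * (c p - d p) - 8 * (s * b p j)\<^sup>2 \<le> u\<^sup>2 / 8"
      using quad[of u "s * b p j"] s(2)[of p] by (simp add: mult_ac)
    ultimately show "c p - V p - 8 * (b p j)\<^sup>2 + ?S
       \<le> (1 - u) * (SUP p\<in>T. c p - V p + (\<Sum>i\<in>I. \<epsilon> i * b p i))
         + u * (SUP p\<in>T. d p - V p + (\<Sum>i\<in>I. \<epsilon> i * b p i)) + u\<^sup>2 / 8"
      using 1 2 by linarith
  qed
  have comb: "(\<Sum>\<epsilon>\<in>signs I. exp (L (\<lambda>p. c p - V p - 8 * (b p j)\<^sup>2) \<epsilon>))
      \<le> exp ((1 - u) * ln (\<Sum>\<epsilon>\<in>signs I. exp (L (\<lambda>p. c p - V p) \<epsilon>))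
           + u * ln (\<Sum>\<epsilon>\<in>signs I. exp (L (\<lambda>p. d p - V p) \<epsilon>)) + u\<^sup>2 / 8)"
    if cd: "bounded ((\<lambda>p. c p - V p) ` T)" "bounded ((\<lambda>p. d p - V p) ` T)"
      and u: "u \<in> {0..1}" and s: "\<bar>s\<bar> = 1" "\<And>p. c p - d p = 2 * (s * b p j)" for c d u s
  proof -
    have "(\<Sum>\<epsilon>\<in>signs I. exp (L (\<lambda>p. c p - V p - 8 * (b p j)\<^sup>2) \<epsilon>))
      \<le> (\<Sum>\<epsilon>\<in>signs I. exp ((1 - u) * L (\<lambda>p. c p - V p) \<epsilon> + u * L (\<lambda>p. d p - V p) \<epsilon>) * exp (u\<^sup>2 / 8))"
      using L_le[OF that] by (intro sum_mono) (simp add: exp_add[symmetric])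
    also have "\<dots> = (\<Sum>\<epsilon>\<in>signs I. exp ((1 - u) * L (\<lambda>p. c p - V p) \<epsilon> + u * L (\<lambda>p. d p - V p) \<epsilon>)) * exp (u\<^sup>2 / 8)"
      by (simp add: sum_distrib_right)
    also have "\<dots> \<le> exp ((1 - u) * ln (\<Sum>\<epsilon>\<in>signs I. exp (L (\<lambda>p. c p - V p) \<epsilon>))
           + u * ln (\<Sum>\<epsilon>\<in>signs I. exp (L (\<lambda>p. d p - V p) \<epsilon>))) * exp (u\<^sup>2 / 8)"
      using u insert.hyps ne by (intro mult_right_mono sum_exp_convex_comb) auto
    finally show ?thesis by (simp add: exp_add)
  qed
  have "(?A + ?B) * (?P' + ?Q') \<le> 4 * ?n"
  proof (rule two_point_transport[where p = "ln ?P" and q = "ln ?Q"])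
    show "?A \<le> exp ((1 - u) * ln ?P + u * ln ?Q + u\<^sup>2 / 8)" if "u \<in> {0..1}" for u
      by (rule comb[where s = 1]) (use bdV that in auto)
    show "?B \<le> exp ((1 - u) * ln ?Q + u * ln ?P + u\<^sup>2 / 8)" if "u \<in> {0..1}" for u
      by (rule comb[where s = "-1"]) (use bdV that in auto)
    show "?P' \<le> ?n / exp (ln ?P)" "?Q' \<le> ?n / exp (ln ?Q)"
      using IH pos by (simp_all add: field_simps)
  qed (auto intro!: sum_nonneg)
  also have "4 * ?n = (2 ^ card (insert j I))\<^sup>2"
    using insert.hyps by (simp add: power2_eq_square)
  also have "?A + ?B = (\<Sum>\<epsilon>\<in>signs (insert j I).
      exp (SUP p\<in>T. a p - 8 * (\<Sum>i\<in>insert j I. (b p i)\<^sup>2) + (\<Sum>i\<in>insert j I. \<epsilon> i * b p i)))"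
    unfolding sum_signs_insert[OF insert.hyps] sum_fun_upd[OF insert.hyps] sum.distrib L_def V_def
    using insert.hyps by (simp add: algebra_simps)
  also have "?P' + ?Q' = (\<Sum>\<epsilon>\<in>signs (insert j I).
      exp (- (SUP p\<in>T. a p + (\<Sum>i\<in>insert j I. \<epsilon> i * b p i))))"
    unfolding sum_signs_insert[OF insert.hyps] sum_fun_upd[OF insert.hyps] sum.distrib L_def
    by (simp add: algebra_simps)
  finally show ?case .
qed

section \<open>Exchanging coordinates of two samples\<close>

text \<open>Exchanges are indexed by sign vectors rather than by sets of coordinates: they compose
  by multiplication, and \<tau> itself becomes the vector of Rademacher signs of the symmetrised
  process.\<close>

definition swap_by :: "'i set \<Rightarrow> ('i \<Rightarrow> real) \<Rightarrow> ('i \<Rightarrow> 'a) \<Rightarrow> ('i \<Rightarrow> 'a) \<Rightarrow> 'i \<Rightarrow> 'a" where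
  "swap_by I \<tau> X Y = (\<lambda>i\<in>I. if \<tau> i = 1 then X i else Y i)"

lemma swap_by_simps [simp]: "i \<in> I \<Longrightarrow> swap_by I \<tau> X Y i = (if \<tau> i = 1 then X i else Y i)"
  by (simp add: swap_by_def)

lemma swap_by_measurable [measurable]:
  "(\<lambda>(X, Y). swap_by I \<tau> X Y) \<in> PiM I (\<lambda>_. M) \<Otimes>\<^sub>M PiM I (\<lambda>_. M) \<rightarrow>\<^sub>M PiM I (\<lambda>_. M)"
  unfolding swap_by_def case_prod_beta by measurable

lemma swap_by_measurable2 [measurable]:
  "(\<lambda>(X, Y). swap_by I \<tau> Y X) \<in> PiM I (\<lambda>_. M) \<Otimes>\<^sub>M PiM I (\<lambda>_. M) \<rightarrow>\<^sub>M PiM I (\<lambda>_. M)"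
  unfolding swap_by_def case_prod_beta by measurable

lemma (in prob_space) distr_PiM_split:
  fixes n :: nat
  defines "P \<equiv> \<Pi>\<^sub>M i\<in>{..<n}. M"
  shows "distr (\<Pi>\<^sub>M i\<in>{..<2 * n}. M) (P \<Otimes>\<^sub>M P) (\<lambda>D. (\<lambda>i\<in>{..<n}. D i, \<lambda>i\<in>{..<n}. D (n + i))) = P \<Otimes>\<^sub>M P"
proof -
  interpret product_sigma_finite "\<lambda>_. M" by unfold_locales
  interpret P: prob_space P unfolding P_def by (intro prob_space_PiM prob_space_axioms)
  let ?J = "{n..<2 * n}"
  let ?PJ = "\<Pi>\<^sub>M i\<in>?J. M"
  let ?sh = "\<lambda>D. \<lambda>i\<in>{..<n}. D (n + i)"
  let ?F = "\<lambda>D. (\<lambda>i\<in>{..<n}. D i, ?sh D)"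
  have U: "{..<n} \<union> ?J = {..<2 * n}" by auto
  have sh: "distr ?PJ P ?sh = P"
    unfolding P_def using distr_PiM_reindex[of ?J "\<lambda>_. M" "\<lambda>i. n + i" "{..<n}"] prob_space_axioms
    by (auto simp: inj_on_def)
  have shm: "?sh \<in> ?PJ \<rightarrow>\<^sub>M P"
    unfolding P_def by (rule measurable_restrict) (auto intro!: measurable_component_singleton)
  have Fm: "?F \<in> (\<Pi>\<^sub>M i\<in>{..<2 * n}. M) \<rightarrow>\<^sub>M P \<Otimes>\<^sub>M P"
    unfolding P_def
    by (intro measurable_Pair measurable_restrict measurable_component_singleton) auto
  have mm: "merge {..<n} ?J \<in> P \<Otimes>\<^sub>M ?PJ \<rightarrow>\<^sub>M (\<Pi>\<^sub>M i\<in>{..<2 * n}. M)"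
    unfolding P_def using measurable_merge[of "{..<n}" ?J "\<lambda>_. M"] by (simp only: U)
  have "distr (\<Pi>\<^sub>M i\<in>{..<2 * n}. M) (P \<Otimes>\<^sub>M P) ?F
      = distr (distr (P \<Otimes>\<^sub>M ?PJ) (\<Pi>\<^sub>M i\<in>{..<2 * n}. M) (merge {..<n} ?J)) (P \<Otimes>\<^sub>M P) ?F"
    using distr_merge[of "{..<n}" ?J] by (simp add: U P_def ivl_disj_int)
  also have "\<dots> = distr (P \<Otimes>\<^sub>M ?PJ) (P \<Otimes>\<^sub>M P) (?F \<circ> merge {..<n} ?J)"
    by (rule distr_distr[OF Fm mm])
  also have "\<dots> = distr (P \<Otimes>\<^sub>M ?PJ) (P \<Otimes>\<^sub>M P) (\<lambda>(x, y). (x, ?sh y))"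
    by (rule distr_cong)
       (auto simp: merge_def space_pair_measure P_def space_PiM fun_eq_iff PiE_iff extensional_def)
  also have "\<dots> = distr P P (\<lambda>x. x) \<Otimes>\<^sub>M distr ?PJ P ?sh"
    using shm sh by (intro pair_measure_distr[symmetric]) (auto simp: P.sigma_finite_measure_axioms)
  finally show ?thesis by (simp add: sh)
qed

text \<open>On the concatenated sample of size 2 n the exchange is the permutation
  \<open>\<pi>\<close>, and the law of an i.i.d. sample is invariant under permutations of the
  indices.\<close>

lemma (in prob_space) distr_pair_PiM_swap:
  fixes n :: nat and \<tau> :: "nat \<Rightarrow> real"
  defines "P \<equiv> \<Pi>\<^sub>M i\<in>{..<n}. M"
  shows "distr (P \<Otimes>\<^sub>M P) (P \<Otimes>\<^sub>M P) (\<lambda>(X, Y). (swap_by {..<n} \<tau> X Y, swap_by {..<n} \<tau> Y X)) = P \<Otimes>\<^sub>M P"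
proof -
  let ?Q = "\<Pi>\<^sub>M i\<in>{..<2 * n}. M"
  let ?F = "\<lambda>D. (\<lambda>i\<in>{..<n}. D i, \<lambda>i\<in>{..<n}. D (n + i))"
  let ?sw = "\<lambda>(X, Y). (swap_by {..<n} \<tau> X Y, swap_by {..<n} \<tau> Y X)"
  define \<pi> where "\<pi> i = (if i < n then (if \<tau> i = 1 then i else n + i)
    else (if \<tau> (i - n) = 1 then i else i - n))" for i
  have split: "distr ?Q (P \<Otimes>\<^sub>M P) ?F = P \<Otimes>\<^sub>M P"
    unfolding P_def by (rule distr_PiM_split)
  have Fm: "?F \<in> ?Q \<rightarrow>\<^sub>M P \<Otimes>\<^sub>M P"
    unfolding P_def
    by (intro measurable_Pair measurable_restrict measurable_component_singleton) auto
  have swm: "?sw \<in> P \<Otimes>\<^sub>M P \<rightarrow>\<^sub>M P \<Otimes>\<^sub>M P"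
    unfolding P_def case_prod_beta
    by (intro measurable_Pair swap_by_measurable[unfolded case_prod_beta] swap_by_measurable2[unfolded case_prod_beta])
  have inj: "inj_on \<pi> {..<2 * n}"
    by (auto simp: inj_on_def \<pi>_def split: if_splits)
  have \<pi>: "\<pi> \<in> {..<2 * n} \<rightarrow> {..<2 * n}" by (auto simp: \<pi>_def)
  have pi: "distr ?Q ?Q (\<lambda>D. \<lambda>i\<in>{..<2 * n}. D (\<pi> i)) = ?Q"
    using distr_PiM_reindex[OF _ inj \<pi>, of "\<lambda>_. M"] prob_space_axioms by simp
  have pim: "(\<lambda>D. \<lambda>i\<in>{..<2 * n}. D (\<pi> i)) \<in> ?Q \<rightarrow>\<^sub>M ?Q"
    using \<pi> by (intro measurable_restrict measurable_component_singleton) auto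
  have "distr (P \<Otimes>\<^sub>M P) (P \<Otimes>\<^sub>M P) ?sw = distr (distr ?Q (P \<Otimes>\<^sub>M P) ?F) (P \<Otimes>\<^sub>M P) ?sw"
    by (simp only: split)
  also have "\<dots> = distr ?Q (P \<Otimes>\<^sub>M P) (?sw \<circ> ?F)"
    by (rule distr_distr[OF swm Fm])
  also have "?sw \<circ> ?F = ?F \<circ> (\<lambda>D. \<lambda>i\<in>{..<2 * n}. D (\<pi> i))"
    by (auto simp: fun_eq_iff swap_by_def \<pi>_def)
  also have "distr ?Q (P \<Otimes>\<^sub>M P) \<dots> = distr (distr ?Q ?Q (\<lambda>D. \<lambda>i\<in>{..<2 * n}. D (\<pi> i))) (P \<Otimes>\<^sub>M P) ?F"
    by (rule distr_distr[OF Fm pim, symmetric])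
  also have "\<dots> = P \<Otimes>\<^sub>M P"
    by (simp only: pi split)
  finally show ?thesis .
qed

section \<open>Bounded processes with measurable linear suprema\<close>

lemma cSUP_mult_left:
  fixes f :: "'p \<Rightarrow> real"
  assumes "0 \<le> c" "T \<noteq> {}" "bdd_above (f ` T)"
  shows "(SUP p\<in>T. c * f p) = c * (SUP p\<in>T. f p)"
proof (cases "c = 0")
  case True
  then show ?thesis using assms(2) by simp
next
  case False
  then have c: "0 < c" using assms by simp
  have le: "c * f p \<le> c * (SUP p\<in>T. f p)" if "p \<in> T" for p
    using c assms that by (intro mult_left_mono cSUP_upper) auto
  show ?thesis
  proof (rule antisym)
    show "(SUP p\<in>T. c * f p) \<le> c * (SUP p\<in>T. f p)"
      using assms le by (intro cSUP_least) auto
    have "bdd_above ((\<lambda>p. c * f p) ` T)" using le by (auto intro!: bdd_aboveI)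
    then have "f p \<le> (SUP p\<in>T. c * f p) / c" if "p \<in> T" for p
      using c cSUP_upper[OF that, of "\<lambda>p. c * f p"] by (simp add: field_simps)
    then have "(SUP p\<in>T. f p) \<le> (SUP p\<in>T. c * f p) / c"
      using assms by (intro cSUP_least) auto
    then show "c * (SUP p\<in>T. f p) \<le> (SUP p\<in>T. c * f p)"
      using c by (simp add: field_simps)
  qed
qed

lemma signs_uminus_bij: "bij_betw (\<lambda>\<epsilon>. \<lambda>i\<in>I. - \<epsilon> i) (signs I) (signs I)"
  by (rule bij_betwI[where g = "\<lambda>\<epsilon>. \<lambda>i\<in>I. - \<epsilon> i"])
     (auto simp: signs_def fun_eq_iff PiE_iff extensional_def)

lemma sum_signs_uminus: "(\<Sum>\<epsilon>\<in>signs I. f (\<lambda>i\<in>I. - \<epsilon> i)) = (\<Sum>\<epsilon>\<in>signs I. f \<epsilon>)"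
  using sum.reindex_bij_betw[OF signs_uminus_bij] .

text \<open>Maurey's inequality is applied to 2 \<theta> Z. The penalty is at most 8 (2 \<theta>)^2
  v = 32 \<theta>^2 v, which bounds the product of the exponential sums of 2 \<theta> Z and -2
  \<theta> Z; Cauchy-Schwarz takes the square root, and the reflection of all signs permutes the
  cube. Using a difference avoids any reference to the mean of Z over the cube.\<close>

lemma rademacher_sup_antisymmetrized_exp:
  fixes b :: "'p \<Rightarrow> 'i \<Rightarrow> real"
  assumes I: "finite I" and T: "T \<noteq> {}"
    and bd: "bounded (a ` T)" "\<And>i. i \<in> I \<Longrightarrow> bounded ((\<lambda>p. b p i) ` T)"
    and "0 \<le> \<theta>" and v: "\<And>p. p \<in> T \<Longrightarrow> (\<Sum>i\<in>I. (b p i)\<^sup>2) \<le> v"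
  defines "Z \<equiv> \<lambda>\<epsilon>. SUP p\<in>T. a p + (\<Sum>i\<in>I. \<epsilon> i * b p i)"
  shows "(\<Sum>\<epsilon>\<in>signs I. exp (\<theta> * (Z \<epsilon> - Z (\<lambda>i\<in>I. - \<epsilon> i)))) \<le> 2 ^ card I * exp (16 * \<theta>\<^sup>2 * v)"
proof -
  let ?a = "\<lambda>p. 2 * \<theta> * a p" and ?b = "\<lambda>p i. 2 * \<theta> * b p i"
  have bd': "bounded (?a ` T)" "bounded ((\<lambda>p. ?b p i) ` T)" if "i \<in> I" for i
    using bounded_scaling[OF bd(1), of "2 * \<theta>"] bounded_scaling[OF bd(2)[OF that], of "2 * \<theta>"]
    by (simp_all add: image_image)
  have bda: "bounded (?a ` T)"
    using bounded_scaling[OF bd(1), of "2 * \<theta>"] by (simp add: image_image)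
  have bZ: "bdd_above ((\<lambda>p. a p + (\<Sum>i\<in>I. \<epsilon> i * b p i)) ` T)" for \<epsilon>
    using I bd by (intro bounded_imp_bdd_above bounded_linear_form) auto
  have bZ': "bdd_above ((\<lambda>p. ?a p - 8 * (\<Sum>i\<in>I. (?b p i)\<^sup>2) + (\<Sum>i\<in>I. \<epsilon> i * ?b p i)) ` T)" for \<epsilon>
  proof -
    have "bdd_above ((\<lambda>p. ?a p + (\<Sum>i\<in>I. \<epsilon> i * ?b p i)) ` T)"
      using I bd' bda by (intro bounded_imp_bdd_above bounded_linear_form) auto
    then obtain B where B: "?a p + (\<Sum>i\<in>I. \<epsilon> i * ?b p i) \<le> B" if "p \<in> T" for p
      by (auto simp: bdd_above_def)
    have "?a p - 8 * (\<Sum>i\<in>I. (?b p i)\<^sup>2) + (\<Sum>i\<in>I. \<epsilon> i * ?b p i) \<le> B" if "p \<in> T" for p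
      using B[OF that] sum_nonneg[of I "\<lambda>i. (?b p i)\<^sup>2"] by simp
    then show ?thesis by (auto simp: bdd_above_def)
  qed
  have Z2: "(SUP p\<in>T. ?a p + (\<Sum>i\<in>I. \<epsilon> i * ?b p i)) = 2 * \<theta> * Z \<epsilon>" for \<epsilon>
  proof -
    have "?a p + (\<Sum>i\<in>I. \<epsilon> i * ?b p i) = 2 * \<theta> * (a p + (\<Sum>i\<in>I. \<epsilon> i * b p i))" for p
      by (simp add: distrib_left sum_distrib_left mult_ac)
    then show ?thesis using assms(5) cSUP_mult_left[OF _ T bZ, of "2 * \<theta>"] by (simp add: Z_def)
  qed
  let ?U = "\<Sum>\<epsilon>\<in>signs I. exp (2 * \<theta> * Z \<epsilon>)" and ?D = "\<Sum>\<epsilon>\<in>signs I. exp (- (2 * \<theta> * Z \<epsilon>))"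
  let ?C = "\<lambda>\<epsilon>. SUP p\<in>T. ?a p - 8 * (\<Sum>i\<in>I. (?b p i)\<^sup>2) + (\<Sum>i\<in>I. \<epsilon> i * ?b p i)"
  have "2 * \<theta> * Z \<epsilon> \<le> 32 * \<theta>\<^sup>2 * v + ?C \<epsilon>" for \<epsilon>
    unfolding Z2[symmetric]
  proof (rule cSUP_least[OF T])
    fix p assume p: "p \<in> T"
    have "8 * (\<Sum>i\<in>I. (?b p i)\<^sup>2) = 32 * \<theta>\<^sup>2 * (\<Sum>i\<in>I. (b p i)\<^sup>2)"
      by (simp add: sum_distrib_left power_mult_distrib mult_ac)
    also have "\<dots> \<le> 32 * \<theta>\<^sup>2 * v" using v[OF p] by (intro mult_left_mono) auto
    finally show "?a p + (\<Sum>i\<in>I. \<epsilon> i * ?b p i) \<le> 32 * \<theta>\<^sup>2 * v + ?C \<epsilon>"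
      using cSUP_upper[OF p bZ'[of \<epsilon>]] by linarith
  qed
  then have "?U \<le> (\<Sum>\<epsilon>\<in>signs I. exp (32 * \<theta>\<^sup>2 * v) * exp (?C \<epsilon>))"
    by (intro sum_mono) (simp add: exp_add[symmetric])
  then have "?U * ?D \<le> (exp (32 * \<theta>\<^sup>2 * v) * (\<Sum>\<epsilon>\<in>signs I. exp (?C \<epsilon>))) * ?D"
    by (intro mult_right_mono) (auto simp: sum_distrib_left intro: sum_nonneg)
  also have "\<dots> = exp (32 * \<theta>\<^sup>2 * v) * ((\<Sum>\<epsilon>\<in>signs I. exp (?C \<epsilon>)) * ?D)" by simp
  also have "\<dots> \<le> exp (32 * \<theta>\<^sup>2 * v) * (2 ^ card I)\<^sup>2"
  proof (rule mult_left_mono)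
    show "(\<Sum>\<epsilon>\<in>signs I. exp (?C \<epsilon>)) * ?D \<le> (2 ^ card I)\<^sup>2"
      using rademacher_sup_infconv[OF I T bda, of ?b] bd'(2) unfolding Z2 by blast
  qed simp
  also have "\<dots> = (2 ^ card I * exp (16 * \<theta>\<^sup>2 * v))\<^sup>2"
    by (simp add: power2_eq_square exp_add[symmetric])
  finally have UD: "?U * ?D \<le> (2 ^ card I * exp (16 * \<theta>\<^sup>2 * v))\<^sup>2" .
  let ?x = "\<lambda>\<epsilon>. exp (\<theta> * Z \<epsilon>)" and ?y = "\<lambda>\<epsilon>. exp (- (\<theta> * Z (\<lambda>i\<in>I. - \<epsilon> i)))"
  have "(\<Sum>\<epsilon>\<in>signs I. ?x \<epsilon> * ?y \<epsilon>)\<^sup>2 \<le> (\<Sum>\<epsilon>\<in>signs I. (?x \<epsilon>)\<^sup>2) * (\<Sum>\<epsilon>\<in>signs I. (?y \<epsilon>)\<^sup>2)"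
    by (rule Cauchy_Schwarz_ineq_sum)
  also have "(\<Sum>\<epsilon>\<in>signs I. (?x \<epsilon>)\<^sup>2) = ?U"
    by (simp add: exp_double[symmetric] mult_ac)
  also have "(\<Sum>\<epsilon>\<in>signs I. (?y \<epsilon>)\<^sup>2) = ?D"
    using sum_signs_uminus[of "\<lambda>\<epsilon>. exp (- (2 * \<theta> * Z \<epsilon>))" I]
    by (simp add: exp_double[symmetric] mult_ac)
  finally have "(\<Sum>\<epsilon>\<in>signs I. ?x \<epsilon> * ?y \<epsilon>)\<^sup>2 \<le> (2 ^ card I * exp (16 * \<theta>\<^sup>2 * v))\<^sup>2"
    using UD by linarith
  then have "(\<Sum>\<epsilon>\<in>signs I. ?x \<epsilon> * ?y \<epsilon>) \<le> 2 ^ card I * exp (16 * \<theta>\<^sup>2 * v)"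
    by (rule power2_le_imp_le) simp
  then show ?thesis by (simp add: exp_add[symmetric] right_diff_distrib)
qed

lemma swap_by_signs:
  assumes "\<epsilon> \<in> signs I" "\<epsilon>' \<in> signs I" shows "swap_by I \<tau> \<epsilon> \<epsilon>' \<in> signs I"
  using assms by (auto simp: signs_def swap_by_def PiE_iff)

lemma swap_by_involution:
  assumes "X \<in> extensional I" "Y \<in> extensional I"
  shows "swap_by I \<tau> (swap_by I \<tau> X Y) (swap_by I \<tau> Y X) = X"
  using assms by (auto simp: swap_by_def fun_eq_iff extensional_def)

text \<open>An exchange is an involution of pairs of sign vectors. Together with
  \<open>distr_pair_PiM_swap\<close> this allows signs and data to be exchanged
  simultaneously.\<close>

lemma sum_signs_swap:
  fixes I :: "'i set"
  shows "(\<Sum>\<epsilon>\<in>signs I. \<Sum>\<epsilon>'\<in>signs I. f (swap_by I \<tau> \<epsilon> \<epsilon>') (swap_by I \<tau> \<epsilon>' \<epsilon>)) = (\<Sum>\<epsilon>\<in>signs I. \<Sum>\<epsilon>'\<in>signs I. f \<epsilon> \<epsilon>')"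
proof -
  have ext: "\<epsilon> \<in> signs I \<Longrightarrow> \<epsilon> \<in> extensional I" for \<epsilon> :: "'i \<Rightarrow> real"
    by (simp add: signs_def PiE_iff)
  have "bij_betw (\<lambda>(\<epsilon>, \<epsilon>'). (swap_by I \<tau> \<epsilon> \<epsilon>', swap_by I \<tau> \<epsilon>' \<epsilon>)) (signs I \<times> signs I) (signs I \<times> signs I)"
    by (rule bij_betwI[where g = "\<lambda>(\<epsilon>, \<epsilon>'). (swap_by I \<tau> \<epsilon> \<epsilon>', swap_by I \<tau> \<epsilon>' \<epsilon>)"])
       (auto simp: swap_by_signs swap_by_involution ext)
  from sum.reindex_bij_betw[OF this, of "\<lambda>(x, y). f x y"] show ?thesis
    by (simp add: sum.cartesian_product case_prod_beta)
qed

locale bounded_process = prob_space M for M :: "'a measure" +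
  fixes N :: nat and H :: "('a \<Rightarrow> real) set" and t :: real
  assumes N: "0 < N"
    and H_meas: "\<And>h. h \<in> H \<Longrightarrow> h \<in> borel_measurable M"
    and H_bound: "\<And>h w. h \<in> H \<Longrightarrow> w \<in> space M \<Longrightarrow> \<bar>h w\<bar> \<le> 1"
    and H_zero: "(\<lambda>_. 0) \<in> H"
    and H_norm: "\<And>h. h \<in> H \<Longrightarrow> (\<integral>w. (h w)\<^sup>2 \<partial>M) \<le> t\<^sup>2"
    and sup_meas: "\<And>\<epsilon>. \<epsilon> \<in> signs {..<N} \<Longrightarrow>
      (\<lambda>D. SUP h\<in>H. (1 / real N) * (\<Sum>i<N. \<epsilon> i * h (D i))) \<in> borel_measurable (\<Pi>\<^sub>M i\<in>{..<N}. M)"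
begin

abbreviation "I \<equiv> {..<N}"
abbreviation "P \<equiv> \<Pi>\<^sub>M i\<in>{..<N}. M"
abbreviation "P2 \<equiv> P \<Otimes>\<^sub>M P"
abbreviation "sw \<equiv> swap_by I"

definition W :: "(nat \<Rightarrow> real) \<Rightarrow> (nat \<Rightarrow> 'a) \<Rightarrow> real" where
  "W \<epsilon> D = (SUP h\<in>H. (1 / real N) * (\<Sum>i<N. \<epsilon> i * h (D i)))"

definition R :: real where
  "R = (\<Sum>\<epsilon>\<in>signs I. \<integral>D. W \<epsilon> D \<partial>P) / 2 ^ N"

sublocale P: prob_space P
  by (intro prob_space_PiM prob_space_axioms)

sublocale PP: pair_prob_space P P ..

lemma H_ne: "H \<noteq> {}" using H_zero by auto

lemma PD: "D \<in> space P \<Longrightarrow> i < N \<Longrightarrow> D i \<in> space M"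
  by (auto simp: space_PiM)

lemma P_swap: "X \<in> space P \<Longrightarrow> Y \<in> space P \<Longrightarrow> sw \<tau> X Y \<in> space P"
  by (auto simp: space_PiM swap_by_def PiE_iff)

lemma W_measurable [measurable]: "\<epsilon> \<in> signs I \<Longrightarrow> W \<epsilon> \<in> borel_measurable P"
  unfolding W_def by (rule sup_meas)

lemma average_bound:
  assumes "\<And>i. i < N \<Longrightarrow> \<bar>x i\<bar> \<le> 1" shows "\<bar>(1 / real N) * (\<Sum>i<N. x i)\<bar> \<le> 1"
proof -
  have "\<bar>\<Sum>i<N. x i\<bar> \<le> (\<Sum>i<N. \<bar>x i\<bar>)" by (rule sum_abs)
  also have "\<dots> \<le> (\<Sum>i<N. 1)" using assms by (intro sum_mono) auto
  finally show ?thesis using N by (simp add: abs_mult field_simps)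
qed

lemma average_split: "(1 / real N) * (\<Sum>i<N. c i + real N * d i) = (1 / real N) * (\<Sum>i<N. c i) + (\<Sum>i<N. d i)"
  using N by (simp add: sum.distrib distrib_left sum_distrib_left[symmetric])

lemma linear_bound:
  assumes "\<epsilon> \<in> signs I" "h \<in> H" "D \<in> space P"
  shows "\<bar>(1 / real N) * (\<Sum>i<N. \<epsilon> i * h (D i))\<bar> \<le> 1"
proof (rule average_bound)
  fix i assume "i < N"
  then show "\<bar>\<epsilon> i * h (D i)\<bar> \<le> 1"
    using H_bound[OF assms(2) PD[OF assms(3)], of i] signs_cases[OF assms(1), of i] by (auto simp: abs_mult)
qed

lemma W_bdd:
  assumes "\<epsilon> \<in> signs I" "D \<in> space P"
  shows "bdd_above ((\<lambda>h. (1 / real N) * (\<Sum>i<N. \<epsilon> i * h (D i))) ` H)"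
  using abs_le_D1[OF linear_bound[OF assms(1) _ assms(2)]] by (intro bdd_aboveI[of _ 1]) blast

lemma W_upper:
  assumes "\<epsilon> \<in> signs I" "D \<in> space P" "h \<in> H"
  shows "(1 / real N) * (\<Sum>i<N. \<epsilon> i * h (D i)) \<le> W \<epsilon> D"
  unfolding W_def using assms by (intro cSUP_upper W_bdd)

lemma W_nonneg: "\<epsilon> \<in> signs I \<Longrightarrow> D \<in> space P \<Longrightarrow> 0 \<le> W \<epsilon> D"
  using W_upper[OF _ _ H_zero] by simp

lemma W_le_1: "\<epsilon> \<in> signs I \<Longrightarrow> D \<in> space P \<Longrightarrow> W \<epsilon> D \<le> 1"
  unfolding W_def by (intro cSUP_least H_ne abs_le_D1[OF linear_bound])

lemma W_integrable: "\<epsilon> \<in> signs I \<Longrightarrow> integrable P (W \<epsilon>)"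
  using W_nonneg W_le_1 by (intro P.integrable_const_bound[of _ 1]) (auto intro!: AE_I2)

lemma integral_pair_swap:
  assumes [measurable]: "F \<in> borel_measurable P2"
  shows "(\<integral>(X, Y). F (sw \<tau> X Y, sw \<tau> Y X) \<partial>P2) = (\<integral>Z. F Z \<partial>P2 :: real)"
proof -
  let ?sw = "\<lambda>(X, Y). (sw \<tau> X Y, sw \<tau> Y X)"
  have swm: "?sw \<in> P2 \<rightarrow>\<^sub>M P2"
    unfolding case_prod_beta
    by (intro measurable_Pair swap_by_measurable[unfolded case_prod_beta] swap_by_measurable2[unfolded case_prod_beta])
  have "(\<integral>Z. F Z \<partial>P2) = (\<integral>Z. F Z \<partial>distr P2 P2 ?sw)"
    by (simp only: distr_pair_PiM_swap)
  also have "\<dots> = (\<integral>Z. F (?sw Z) \<partial>P2)"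
    by (rule integral_distr[OF swm]) simp
  also have "(\<lambda>Z. F (?sw Z)) = (\<lambda>(X, Y). F (sw \<tau> X Y, sw \<tau> Y X))"
    by (simp add: fun_eq_iff case_prod_beta)
  finally show ?thesis by simp
qed

text \<open>The product is an integral over two independent copies of signs and sample. Exchanging
  signs and data together preserves it, so it may be averaged over all exchanges \<tau>. For frozen
  data that average is an antisymmetrised affine supremum on the cube, and the terms
  \<open>- k * S\<close> of the two samples cancel its variance.\<close>

lemma mgf_product_le_1:
  assumes [measurable]: "S \<in> borel_measurable P"
    and S_bd: "\<And>X. X \<in> space P \<Longrightarrow> \<bar>S X\<bar> \<le> B"
    and S: "\<And>X h. X \<in> space P \<Longrightarrow> h \<in> H \<Longrightarrow> (1 / real N) * (\<Sum>i<N. (h (X i))\<^sup>2) \<le> S X"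
    and \<theta>: "0 \<le> \<theta>"
  defines "k \<equiv> 8 * \<theta>\<^sup>2 / real N"
  shows "(\<Sum>\<epsilon>\<in>signs I. \<integral>X. exp (\<theta> * W \<epsilon> X - k * S X) \<partial>P)
       * (\<Sum>\<epsilon>\<in>signs I. \<integral>X. exp (- (\<theta> * W \<epsilon> X) - k * S X) \<partial>P) \<le> (2 ^ N)\<^sup>2"
proof -
  define F where "F \<epsilon> \<epsilon>' = (\<lambda>(X, Y). exp (\<theta> * W \<epsilon> X - k * S X) * exp (- (\<theta> * W \<epsilon>' Y) - k * S Y))" for \<epsilon> \<epsilon>'
  let ?F = "\<lambda>\<tau> \<epsilon> \<epsilon>' (X, Y). F (sw \<tau> \<epsilon> \<epsilon>') (sw \<tau> \<epsilon>' \<epsilon>) (sw \<tau> X Y, sw \<tau> Y X)"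
  have k: "0 \<le> k" by (simp add: k_def)
  have [measurable]: "F \<epsilon> \<epsilon>' \<in> borel_measurable P2" if [measurable]: "\<epsilon> \<in> signs I" "\<epsilon>' \<in> signs I" for \<epsilon> \<epsilon>'
    unfolding F_def by measurable
  have kS: "- (k * S X) \<le> k * B" if "X \<in> space P" for X
    using mult_left_mono[OF _ k, of "- S X" B] S_bd[OF that] by (simp add: abs_le_iff)
  have U: "exp (\<theta> * W \<epsilon> X - k * S X) \<le> exp (\<theta> + k * B)" "exp (- (\<theta> * W \<epsilon> X) - k * S X) \<le> exp (\<theta> + k * B)"
    if "\<epsilon> \<in> signs I" "X \<in> space P" for \<epsilon> X
  proof -
    have "\<theta> * W \<epsilon> X \<le> \<theta>" "0 \<le> \<theta> * W \<epsilon> X"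
      using W_le_1[OF that] W_nonneg[OF that] \<theta> by (auto intro: mult_left_le)
    then show "exp (\<theta> * W \<epsilon> X - k * S X) \<le> exp (\<theta> + k * B)" "exp (- (\<theta> * W \<epsilon> X) - k * S X) \<le> exp (\<theta> + k * B)"
      using kS[OF that(2)] \<theta> by auto
  qed
  have int1: "integrable P (\<lambda>X. exp (\<theta> * W \<epsilon> X - k * S X))" "integrable P (\<lambda>X. exp (- (\<theta> * W \<epsilon> X) - k * S X))"
    if [measurable]: "\<epsilon> \<in> signs I" for \<epsilon>
    using U[OF that] by (auto intro!: P.integrable_const_bound[of _ "exp (\<theta> + k * B)"] AE_I2)
  have F_bd: "\<bar>F \<epsilon> \<epsilon>' (X, Y)\<bar> \<le> exp (\<theta> + k * B) * exp (\<theta> + k * B)"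
    if "\<epsilon> \<in> signs I" "\<epsilon>' \<in> signs I" "X \<in> space P" "Y \<in> space P" for \<epsilon> \<epsilon>' X Y
    unfolding F_def using U[of \<epsilon> X] U[of \<epsilon>' Y] that by (auto simp: abs_mult intro!: mult_mono)
  have intF: "integrable P2 (F \<epsilon> \<epsilon>')" if "\<epsilon> \<in> signs I" "\<epsilon>' \<in> signs I" for \<epsilon> \<epsilon>'
    using that F_bd[OF that]
    by (intro PP.integrable_const_bound[of _ "exp (\<theta> + k * B) * exp (\<theta> + k * B)"] AE_I2)
       (auto simp: space_pair_measure)
  have Fm: "?F \<tau> \<epsilon> \<epsilon>' \<in> borel_measurable P2" if "\<epsilon> \<in> signs I" "\<epsilon>' \<in> signs I" for \<tau> \<epsilon> \<epsilon>'
  proof -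
    have [measurable]: "F (sw \<tau> \<epsilon> \<epsilon>') (sw \<tau> \<epsilon>' \<epsilon>) \<in> borel_measurable P2"
      using that by (simp add: swap_by_signs)
    show ?thesis
      unfolding case_prod_beta
      by (rule measurable_compose[of _ _ "P2"])
         (auto intro!: measurable_Pair swap_by_measurable[unfolded case_prod_beta] swap_by_measurable2[unfolded case_prod_beta])
  qed
  have intFt: "integrable P2 (?F \<tau> \<epsilon> \<epsilon>')" if "\<epsilon> \<in> signs I" "\<epsilon>' \<in> signs I" for \<tau> \<epsilon> \<epsilon>'
  proof (intro PP.integrable_const_bound[of _ "exp (\<theta> + k * B) * exp (\<theta> + k * B)"] AE_I2 Fm that)
    fix Z assume "Z \<in> space P2"
    then obtain X Y where "Z = (X, Y)" "X \<in> space P" "Y \<in> space P" by (auto simp: space_pair_measure)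
    then show "norm (?F \<tau> \<epsilon> \<epsilon>' Z) \<le> exp (\<theta> + k * B) * exp (\<theta> + k * B)"
      using F_bd[OF swap_by_signs[OF that] swap_by_signs[OF that(2,1)] P_swap P_swap] by simp
  qed
  have pointwise: "(\<Sum>\<tau>\<in>signs I. ?F \<tau> \<epsilon> \<epsilon>' (X, Y)) \<le> 2 ^ N"
    if e: "\<epsilon> \<in> signs I" "\<epsilon>' \<in> signs I" and XY: "X \<in> space P" "Y \<in> space P" for \<epsilon> \<epsilon>' X Y
  proof -
    \<comment> \<open>The numbers x = \<epsilon>_i h(X_i) and y = \<epsilon>'_i h(Y_i) are (x + y) /
      2 plus or minus (x - y) / 2, and the exchange decides the sign. So \<open>a\<close> collects
      what exchanges leave fixed, and \<open>b\<close> is the coefficient of \<tau>_i.\<close>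
    define a where "a h = (1 / real N) * (\<Sum>i<N. (\<epsilon> i * h (X i) + \<epsilon>' i * h (Y i)) / 2)" for h
    define b where "b h i = (\<epsilon> i * h (X i) - \<epsilon>' i * h (Y i)) / (2 * real N)" for h :: "'a \<Rightarrow> real" and i
    define Z where "Z \<tau> = (SUP h\<in>H. a h + (\<Sum>i\<in>I. \<tau> i * b h i))" for \<tau>
    define q where "q h = (1 / real N) * (\<Sum>i<N. (h (X i))\<^sup>2) + (1 / real N) * (\<Sum>i<N. (h (Y i))\<^sup>2)" for h :: "'a \<Rightarrow> real"
    have eh: "\<bar>\<epsilon> i * h (X i)\<bar> \<le> 1" "\<bar>\<epsilon>' i * h (Y i)\<bar> \<le> 1" if "h \<in> H" "i < N" for h i
      using H_bound[OF that(1)] PD[OF XY(1) that(2)] PD[OF XY(2) that(2)] that signs_cases[OF e(1), of i] signs_cases[OF e(2), of i]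
      by (auto simp: abs_mult)
    have ba: "bounded (a ` H)"
    proof -
      have "\<bar>a h\<bar> \<le> 1" if "h \<in> H" for h
        unfolding a_def by (rule average_bound) (use eh[OF that] in \<open>fastforce simp: abs_le_iff\<close>)
      then show ?thesis by (auto simp: bounded_iff)
    qed
    have bb: "bounded ((\<lambda>h. b h i) ` H)" if "i \<in> I" for i
    proof -
      have "\<bar>b h i\<bar> \<le> 1 / real N" if "h \<in> H" for h
        using eh[OF that, of i] \<open>i \<in> I\<close> N by (auto simp: b_def field_simps abs_le_iff)
      then show ?thesis by (auto simp: bounded_iff)
    qed
    have "q h \<le> 2" if "h \<in> H" for h
    proof -
      have "(h (X i))\<^sup>2 \<le> 1" "(h (Y i))\<^sup>2 \<le> 1" if "i < N" for i
        using H_bound[OF \<open>h \<in> H\<close>] PD[OF XY(1) that] PD[OF XY(2) that] by (auto simp: abs_square_le_1)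
      then have "\<bar>(1 / real N) * (\<Sum>i<N. (h (X i))\<^sup>2)\<bar> \<le> 1" "\<bar>(1 / real N) * (\<Sum>i<N. (h (Y i))\<^sup>2)\<bar> \<le> 1"
        by (intro average_bound; simp)+
      then show ?thesis unfolding q_def by linarith
    qed
    then have q_bdd: "bdd_above (q ` H)" by (auto simp: bdd_above_def)
    define \<sigma> where "\<sigma> = (SUP h\<in>H. q h)"
    have var: "(\<Sum>i\<in>I. (b h i)\<^sup>2) \<le> \<sigma> / (2 * real N)" if h: "h \<in> H" for h
    proof -
      have "(b h i)\<^sup>2 \<le> ((h (X i))\<^sup>2 + (h (Y i))\<^sup>2) / (2 * (real N)\<^sup>2)" if "i < N" for i
      proof -
        have "(\<epsilon> i * h (X i) - \<epsilon>' i * h (Y i))\<^sup>2 \<le> 2 * (\<epsilon> i * h (X i))\<^sup>2 + 2 * (\<epsilon>' i * h (Y i))\<^sup>2"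
          using zero_le_power2[of "\<epsilon> i * h (X i) + \<epsilon>' i * h (Y i)"] by (simp add: power2_eq_square algebra_simps)
        also have "\<dots> = 2 * ((h (X i))\<^sup>2 + (h (Y i))\<^sup>2)"
          using signs_cases[OF e(1), of i] signs_cases[OF e(2), of i] that by (auto simp: power_mult_distrib)
        finally show ?thesis using N
          by (simp add: b_def power_divide power_mult_distrib field_simps)
      qed
      then have "(\<Sum>i\<in>I. (b h i)\<^sup>2) \<le> (\<Sum>i<N. ((h (X i))\<^sup>2 + (h (Y i))\<^sup>2) / (2 * (real N)\<^sup>2))"
        by (intro sum_mono) auto
      also have "\<dots> = q h / (2 * real N)"
        by (simp add: q_def sum_divide_distrib[symmetric] sum.distrib power2_eq_square add_divide_distrib)
      also have "\<dots> \<le> \<sigma> / (2 * real N)"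
        using N unfolding \<sigma>_def by (intro divide_right_mono cSUP_upper h q_bdd) auto
      finally show ?thesis .
    qed
    have Z1: "W (sw \<tau> \<epsilon> \<epsilon>') (sw \<tau> X Y) = Z \<tau>"
         and Z2: "W (sw \<tau> \<epsilon>' \<epsilon>) (sw \<tau> Y X) = Z (\<lambda>i\<in>I. - \<tau> i)" if \<tau>: "\<tau> \<in> signs I" for \<tau>
    proof -
      have "(1 / real N) * (\<Sum>i<N. sw \<tau> \<epsilon> \<epsilon>' i * h (sw \<tau> X Y i)) = a h + (\<Sum>i\<in>I. \<tau> i * b h i)" for h
      proof -
        have "sw \<tau> \<epsilon> \<epsilon>' i * h (sw \<tau> X Y i)
            = (\<epsilon> i * h (X i) + \<epsilon>' i * h (Y i)) / 2 + real N * (\<tau> i * b h i)" if "i < N" for i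
          using signs_cases[OF \<tau>, of i] that N by (auto simp: b_def field_simps)
        then have "(\<Sum>i<N. sw \<tau> \<epsilon> \<epsilon>' i * h (sw \<tau> X Y i))
            = (\<Sum>i<N. (\<epsilon> i * h (X i) + \<epsilon>' i * h (Y i)) / 2 + real N * (\<tau> i * b h i))"
          by (intro sum.cong) auto
        then show ?thesis by (simp only: a_def average_split)
      qed
      then show "W (sw \<tau> \<epsilon> \<epsilon>') (sw \<tau> X Y) = Z \<tau>" by (simp add: W_def Z_def)
      have "(1 / real N) * (\<Sum>i<N. sw \<tau> \<epsilon>' \<epsilon> i * h (sw \<tau> Y X i))
          = a h + (\<Sum>i\<in>I. (\<lambda>i\<in>I. - \<tau> i) i * b h i)" for h
      proof -
        have "sw \<tau> \<epsilon>' \<epsilon> i * h (sw \<tau> Y X i)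
            = (\<epsilon> i * h (X i) + \<epsilon>' i * h (Y i)) / 2 + real N * (- \<tau> i * b h i)" if "i < N" for i
          using signs_cases[OF \<tau>, of i] that N by (auto simp: b_def field_simps)
        then have "(\<Sum>i<N. sw \<tau> \<epsilon>' \<epsilon> i * h (sw \<tau> Y X i))
            = (\<Sum>i<N. (\<epsilon> i * h (X i) + \<epsilon>' i * h (Y i)) / 2 + real N * ((\<lambda>i\<in>I. - \<tau> i) i * b h i))"
          by (intro sum.cong) auto
        then show ?thesis by (simp only: a_def average_split)
      qed
      then show "W (sw \<tau> \<epsilon>' \<epsilon>) (sw \<tau> Y X) = Z (\<lambda>i\<in>I. - \<tau> i)" unfolding W_def Z_def by presburger
    qed
    \<comment> \<open>\<open>q\<close> is symmetric under exchanges. So the same \<sigma> is below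
      the sum of the two values of \<open>S\<close> for every \<tau>, although these are taken at
      the exchanged samples.\<close>
    have S\<sigma>: "\<sigma> \<le> S (sw \<tau> X Y) + S (sw \<tau> Y X)" for \<tau>
      unfolding \<sigma>_def
    proof (rule cSUP_least[OF H_ne])
      fix h assume h: "h \<in> H"
      have "(\<Sum>i<N. (h (sw \<tau> X Y i))\<^sup>2) + (\<Sum>i<N. (h (sw \<tau> Y X i))\<^sup>2)
          = (\<Sum>i<N. (h (X i))\<^sup>2) + (\<Sum>i<N. (h (Y i))\<^sup>2)"
        unfolding sum.distrib[symmetric] by (intro sum.cong) auto
      then have "q h = (1 / real N) * (\<Sum>i<N. (h (sw \<tau> X Y i))\<^sup>2) + (1 / real N) * (\<Sum>i<N. (h (sw \<tau> Y X i))\<^sup>2)"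
        by (simp add: q_def distrib_left[symmetric] del: times_divide_eq_left)
      then show "q h \<le> S (sw \<tau> X Y) + S (sw \<tau> Y X)"
        using S[OF P_swap h] XY by (metis add_mono)
    qed
    have "(\<Sum>\<tau>\<in>signs I. ?F \<tau> \<epsilon> \<epsilon>' (X, Y)) \<le> (\<Sum>\<tau>\<in>signs I. exp (\<theta> * (Z \<tau> - Z (\<lambda>i\<in>I. - \<tau> i))) * exp (- k * \<sigma>))"
    proof (rule sum_mono)
      fix \<tau> :: "nat \<Rightarrow> real" assume \<tau>: "\<tau> \<in> signs I"
      have "k * \<sigma> \<le> k * (S (sw \<tau> X Y) + S (sw \<tau> Y X))"
        using S\<sigma> k by (intro mult_left_mono)
      then show "?F \<tau> \<epsilon> \<epsilon>' (X, Y) \<le> exp (\<theta> * (Z \<tau> - Z (\<lambda>i\<in>I. - \<tau> i))) * exp (- k * \<sigma>)"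
        using Z1[OF \<tau>] Z2[OF \<tau>]
        by (simp add: F_def exp_add[symmetric] algebra_simps)
    qed
    also have "\<dots> = (\<Sum>\<tau>\<in>signs I. exp (\<theta> * (Z \<tau> - Z (\<lambda>i\<in>I. - \<tau> i)))) * exp (- k * \<sigma>)"
      by (simp add: sum_distrib_right)
    also have "\<dots> \<le> (2 ^ card I * exp (16 * \<theta>\<^sup>2 * (\<sigma> / (2 * real N)))) * exp (- k * \<sigma>)"
      unfolding Z_def using ba bb var \<theta> H_ne
      by (intro mult_right_mono rademacher_sup_antisymmetrized_exp) auto
    \<comment> \<open>16 \<theta>^2 \<sigma> / (2 N) = k \<sigma>, which is the reason for the
      choice of \<open>k\<close>.\<close>
    also have "\<dots> = 2 ^ N" using N by (simp add: k_def exp_add[symmetric])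
    finally show ?thesis .
  qed
  have "2 ^ N * (\<Sum>\<epsilon>\<in>signs I. \<Sum>\<epsilon>'\<in>signs I. \<integral>Z. F \<epsilon> \<epsilon>' Z \<partial>P2)
      = (\<Sum>\<tau>\<in>signs I. \<Sum>\<epsilon>\<in>signs I. \<Sum>\<epsilon>'\<in>signs I. \<integral>Z. F \<epsilon> \<epsilon>' Z \<partial>P2)"
    by (simp add: card_signs)
  also have "\<dots> = (\<Sum>\<tau>\<in>signs I. \<Sum>\<epsilon>\<in>signs I. \<Sum>\<epsilon>'\<in>signs I.
      \<integral>Z. F (sw \<tau> \<epsilon> \<epsilon>') (sw \<tau> \<epsilon>' \<epsilon>) Z \<partial>P2)"
    by (intro sum.cong refl sum_signs_swap[symmetric, of "\<lambda>\<epsilon> \<epsilon>'. \<integral>Z. F \<epsilon> \<epsilon>' Z \<partial>P2"])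
  also have "\<dots> = (\<Sum>\<tau>\<in>signs I. \<Sum>\<epsilon>\<in>signs I. \<Sum>\<epsilon>'\<in>signs I. \<integral>Z. ?F \<tau> \<epsilon> \<epsilon>' Z \<partial>P2)"
    by (intro sum.cong refl integral_pair_swap[symmetric]) (simp_all add: swap_by_signs)
  also have "\<dots> = (\<Sum>\<epsilon>\<in>signs I. \<Sum>\<epsilon>'\<in>signs I. \<Sum>\<tau>\<in>signs I. \<integral>Z. ?F \<tau> \<epsilon> \<epsilon>' Z \<partial>P2)"
    by (subst sum.swap) (intro sum.cong refl sum.swap)
  also have "\<dots> = (\<Sum>\<epsilon>\<in>signs I. \<Sum>\<epsilon>'\<in>signs I. \<integral>Z. (\<Sum>\<tau>\<in>signs I. ?F \<tau> \<epsilon> \<epsilon>' Z) \<partial>P2)"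
    by (intro sum.cong refl Bochner_Integration.integral_sum[symmetric] intFt)
  also have "\<dots> \<le> (\<Sum>\<epsilon>\<in>signs I. \<Sum>\<epsilon>'\<in>signs I. 2 ^ N)"
  proof (intro sum_mono PP.integral_le_const AE_I2)
    fix \<epsilon> \<epsilon>' :: "nat \<Rightarrow> real" and Z assume e: "\<epsilon> \<in> signs I" "\<epsilon>' \<in> signs I"
    show "integrable P2 (\<lambda>Z. \<Sum>\<tau>\<in>signs I. ?F \<tau> \<epsilon> \<epsilon>' Z)"
      using e by (intro Bochner_Integration.integrable_sum intFt)
    assume "Z \<in> space P2"
    then show "(\<Sum>\<tau>\<in>signs I. ?F \<tau> \<epsilon> \<epsilon>' Z) \<le> 2 ^ N"
      using pointwise[OF e, of "fst Z" "snd Z"] by (auto simp: space_pair_measure)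
  qed
  also have "\<dots> = 2 ^ N * (2 ^ N)\<^sup>2"
    by (simp add: card_signs power2_eq_square)
  finally have "(\<Sum>\<epsilon>\<in>signs I. \<Sum>\<epsilon>'\<in>signs I. \<integral>Z. F \<epsilon> \<epsilon>' Z \<partial>P2) \<le> (2 ^ N)\<^sup>2"
    by simp
  moreover have "(\<integral>Z. F \<epsilon> \<epsilon>' Z \<partial>P2)
      = (\<integral>X. exp (\<theta> * W \<epsilon> X - k * S X) \<partial>P) * (\<integral>X. exp (- (\<theta> * W \<epsilon>' X) - k * S X) \<partial>P)"
    if "\<epsilon> \<in> signs I" "\<epsilon>' \<in> signs I" for \<epsilon> \<epsilon>'
    using PP.integral_fst'[OF intF[OF that], symmetric] by (simp add: F_def)
  ultimately show ?thesis by (simp add: sum_product)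
qed

text \<open>By Jensen the second factor in \<open>mgf_product_le_1\<close> is at least 2^N exp m,
  where m is the mean of the exponent over signs and sample. Dividing by it turns the two-sample
  estimate into one that is centred at \<open>R\<close>.\<close>

lemma mgf_W:
  assumes [measurable]: "S \<in> borel_measurable P"
    and S_bd: "\<And>X. X \<in> space P \<Longrightarrow> \<bar>S X\<bar> \<le> B"
    and S: "\<And>X h. X \<in> space P \<Longrightarrow> h \<in> H \<Longrightarrow> (1 / real N) * (\<Sum>i<N. (h (X i))\<^sup>2) \<le> S X"
    and \<theta>: "0 \<le> \<theta>"
  defines "k \<equiv> 8 * \<theta>\<^sup>2 / real N"
  shows "(\<Sum>\<epsilon>\<in>signs I. \<integral>X. exp (\<theta> * W \<epsilon> X - k * S X) \<partial>P)
       \<le> 2 ^ N * exp (\<theta> * R + k * (\<integral>X. S X \<partial>P))"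
proof -
  let ?A = "\<Sum>\<epsilon>\<in>signs I. \<integral>X. exp (\<theta> * W \<epsilon> X - k * S X) \<partial>P"
  let ?B = "\<Sum>\<epsilon>\<in>signs I. \<integral>X. exp (- (\<theta> * W \<epsilon> X) - k * S X) \<partial>P"
  define m where "m = - (\<theta> * R) - k * (\<integral>X. S X \<partial>P)"
  have k: "0 \<le> k" by (simp add: k_def)
  have [simp]: "integrable P S"
    using S_bd by (intro P.integrable_const_bound[of _ B]) (auto intro!: AE_I2)
  have [simp]: "integrable P (\<lambda>X. exp (- (\<theta> * W \<epsilon> X) - k * S X))" if [measurable]: "\<epsilon> \<in> signs I" for \<epsilon>
  proof (intro P.integrable_const_bound[of _ "exp (k * B)"] AE_I2)
    fix X assume X: "X \<in> space P"
    have "- (k * S X) \<le> k * B"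
      using mult_left_mono[OF _ k, of "- S X" B] S_bd[OF X] by (simp add: abs_le_iff)
    moreover have "0 \<le> \<theta> * W \<epsilon> X" using W_nonneg[OF that X] \<theta> by simp
    ultimately show "norm (exp (- (\<theta> * W \<epsilon> X) - k * S X)) \<le> exp (k * B)" by simp
  qed measurable
  \<comment> \<open>The tangent of exp is taken at one point m for all sign vectors. The linear term
    therefore vanishes only after summing over the signs, which is where \<open>R\<close> comes
    in.\<close>
  have "exp m * (1 + (- (\<theta> * (\<integral>X. W \<epsilon> X \<partial>P)) - k * (\<integral>X. S X \<partial>P) - m))
      \<le> (\<integral>X. exp (- (\<theta> * W \<epsilon> X) - k * S X) \<partial>P)" if e: "\<epsilon> \<in> signs I" for \<epsilon>
  proof -
    note [simp] = W_integrable[OF e]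
    have "exp m * (1 + (- (\<theta> * (\<integral>X. W \<epsilon> X \<partial>P)) - k * (\<integral>X. S X \<partial>P) - m))
      = (\<integral>X. exp m * (1 + (- (\<theta> * W \<epsilon> X) - k * S X - m)) \<partial>P)"
      by (simp add: P.prob_space)
    also have "\<dots> \<le> (\<integral>X. exp (- (\<theta> * W \<epsilon> X) - k * S X) \<partial>P)"
    proof (rule integral_mono)
      fix X
      have "exp m * (1 + (- (\<theta> * W \<epsilon> X) - k * S X - m)) \<le> exp m * exp (- (\<theta> * W \<epsilon> X) - k * S X - m)"
        by (intro mult_left_mono exp_ge_add_one_self) auto
      then show "exp m * (1 + (- (\<theta> * W \<epsilon> X) - k * S X - m)) \<le> exp (- (\<theta> * W \<epsilon> X) - k * S X)"
        by (simp add: exp_add[symmetric])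
    qed (use e in auto)
    finally show ?thesis .
  qed
  then have "(\<Sum>\<epsilon>\<in>signs I. exp m * (1 + (- (\<theta> * (\<integral>X. W \<epsilon> X \<partial>P)) - k * (\<integral>X. S X \<partial>P) - m))) \<le> ?B"
    by (rule sum_mono)
  also have "(\<Sum>\<epsilon>\<in>signs I. exp m * (1 + (- (\<theta> * (\<integral>X. W \<epsilon> X \<partial>P)) - k * (\<integral>X. S X \<partial>P) - m)))
     = exp m * (2 ^ N - \<theta> * (2 ^ N * R) + 2 ^ N * (- k * (\<integral>X. S X \<partial>P) - m))"
    by (simp add: sum_distrib_left[symmetric] sum.distrib sum_subtractf sum_negf card_signs R_def algebra_simps)
  also have "\<dots> = exp m * 2 ^ N" by (simp add: m_def algebra_simps)
  finally have "exp m * 2 ^ N \<le> ?B" .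
  moreover have "0 \<le> ?A" by (intro sum_nonneg integral_nonneg_AE) auto
  ultimately have "?A * (exp m * 2 ^ N) \<le> ?A * ?B" by (rule mult_left_mono)
  also have "\<dots> \<le> (2 ^ N)\<^sup>2"
    unfolding k_def by (rule mgf_product_le_1[OF assms(1-4)])
  finally have "?A * exp m \<le> 2 ^ N" by (simp add: power2_eq_square mult.assoc[symmetric])
  then have "?A \<le> 2 ^ N * exp (- m)" by (simp add: exp_minus field_simps)
  then show ?thesis by (simp add: m_def add.commute)
qed

end

section \<open>Suprema of squares, bounded over a discretised polytope\<close>

lemma swap_by_compose:
  assumes "\<tau> \<in> signs I" "\<tau>' \<in> signs I"
  shows "swap_by I \<tau>' (swap_by I \<tau> X Y) (swap_by I \<tau> Y X) = swap_by I (\<lambda>i\<in>I. \<tau>' i * \<tau> i) X Y"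
proof
  fix i show "swap_by I \<tau>' (swap_by I \<tau> X Y) (swap_by I \<tau> Y X) i = swap_by I (\<lambda>i\<in>I. \<tau>' i * \<tau> i) X Y i"
    using signs_cases[OF assms(1), of i] signs_cases[OF assms(2), of i] by (auto simp: swap_by_def)
qed

lemma signs_times:
  assumes "\<tau> \<in> signs I" "\<tau>' \<in> signs I" shows "(\<lambda>i\<in>I. \<tau>' i * \<tau> i) \<in> signs I"
  using assms by (auto simp: signs_def PiE_iff) (metis mult_minus1 mult_1 minus_minus)+

lemma swap_by_one: "X \<in> extensional I \<Longrightarrow> swap_by I (\<lambda>i\<in>I. 1) X Y = X"
  by (auto simp: swap_by_def fun_eq_iff extensional_def)

lemma swap_by_minus_one: "Y \<in> extensional I \<Longrightarrow> swap_by I (\<lambda>i\<in>I. -1) X Y = Y"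
  by (auto simp: swap_by_def fun_eq_iff extensional_def)

text \<open>Jensen's inequality for exp is obtained below by integrating this bound with m the mean
  of the exponent.\<close>

lemma exp_tangent: "exp m * (1 + (x - m)) \<le> exp (x :: real)"
proof -
  have "exp m * (1 + (x - m)) \<le> exp m * exp (x - m)"
    by (intro mult_left_mono exp_ge_add_one_self) auto
  then show ?thesis by (simp add: exp_add[symmetric])
qed

lemma exp_half_sum: "exp ((x + y) / 2) \<le> (exp x + exp y) / (2 :: real)"
proof -
  have "0 \<le> (exp (x / 2) - exp (y / 2))\<^sup>2" by simp
  then have "2 * (exp (x / 2) * exp (y / 2)) \<le> exp (x / 2) ^ 2 + exp (y / 2) ^ 2"
    by (simp add: power2_diff)
  then show ?thesis
    by (simp add: exp_add[symmetric] exp_double[symmetric] add_divide_distrib)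
qed

context bounded_process
begin

text \<open>
  The suprema of nonlinear functionals of the class need not be measurable.  They are replaced by
  suprema over the set \<open>feasible X Y\<close> of all (discretised) pairs of vectors that satisfy the linear
  inequalities which the measurable suprema \<open>W\<close> impose on \<open>(h(X\<^sub>i))\<^sub>i, (h(Y\<^sub>i))\<^sub>i\<close> for \<open>h \<in> H\<close>.
\<close>

definition grid :: "(nat \<Rightarrow> real) set" where
  "grid = (\<Pi>\<^sub>E i\<in>I. (\<lambda>j. real_of_int j / real N) ` {- int N..int N})"

definition feasible :: "(nat \<Rightarrow> 'a) \<Rightarrow> (nat \<Rightarrow> 'a) \<Rightarrow> (nat \<Rightarrow> real) \<times> (nat \<Rightarrow> real) \<Rightarrow> bool" where
  "feasible X Y = (\<lambda>(u, v). \<forall>\<tau>\<in>signs I. \<forall>\<epsilon>\<in>signs I.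
     (1 / real N) * (\<Sum>i<N. \<epsilon> i * sw \<tau> u v i) \<le> W \<epsilon> (sw \<tau> X Y) + 1 / real N)"

definition gap :: "(nat \<Rightarrow> real) \<times> (nat \<Rightarrow> real) \<Rightarrow> real" where
  "gap = (\<lambda>(u, v). \<bar>(1 / real N) * (\<Sum>i<N. (v i)\<^sup>2 - (u i)\<^sup>2)\<bar>)"

text \<open>Infeasible pairs contribute 0 instead of being left out, so that the maximum runs over a
  fixed finite set and is measurable as soon as feasibility is. Since \<open>gap\<close> is
  nonnegative, they do not spoil the maximum.\<close>

definition \<Psi> :: "(nat \<Rightarrow> 'a) \<times> (nat \<Rightarrow> 'a) \<Rightarrow> real" where
  "\<Psi> = (\<lambda>(X, Y). Max ((\<lambda>p. if feasible X Y p then gap p else 0) ` (grid \<times> grid)))"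

lemma finite_grid [simp]: "finite grid"
  unfolding grid_def by (intro finite_PiE) auto

lemma grid_bound:
  assumes "u \<in> grid" "i < N" shows "\<bar>u i\<bar> \<le> 1"
proof -
  have "u i \<in> (\<lambda>j. real_of_int j / real N) ` {- int N..int N}"
    using assms by (auto simp: grid_def PiE_iff)
  then obtain j where "u i = real_of_int j / real N" "j \<in> {- int N..int N}" by blast
  moreover from this have "\<bar>real_of_int j\<bar> \<le> real N" by (simp add: abs_le_iff)
  ultimately show ?thesis using N by simp
qed

lemma grid_extensional: "u \<in> grid \<Longrightarrow> u \<in> extensional I"
  by (simp add: grid_def PiE_iff)

lemma grid_swap: "u \<in> grid \<Longrightarrow> v \<in> grid \<Longrightarrow> sw \<tau> u v \<in> grid"
  by (auto simp: grid_def swap_by_def PiE_iff)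

text \<open>The end points -1 and 1 are multiples of the mesh 1/N, so rounding down does not leave
  the interval; this mesh makes the total error of order 1/N.\<close>

definition rnd :: "('a \<Rightarrow> real) \<Rightarrow> (nat \<Rightarrow> 'a) \<Rightarrow> nat \<Rightarrow> real" where
  "rnd h X = (\<lambda>i\<in>I. real_of_int \<lfloor>real N * h (X i)\<rfloor> / real N)"

lemma rnd_grid:
  assumes "h \<in> H" "X \<in> space P" shows "rnd h X \<in> grid"
proof -
  have "\<lfloor>real N * h (X i)\<rfloor> \<in> {- int N..int N}" if "i < N" for i
  proof -
    have "\<bar>h (X i)\<bar> \<le> 1" using H_bound[OF assms(1) PD[OF assms(2) that]] .
    then have "real N * h (X i) \<le> real N * 1" "real N * (- 1) \<le> real N * h (X i)"
      by (intro mult_left_mono; auto simp: abs_le_iff)+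
    then show ?thesis by (auto simp: le_floor_iff floor_le_iff)
  qed
  then show ?thesis by (auto simp: grid_def rnd_def)
qed

lemma rnd_bounds:
  assumes "i < N" shows "rnd h X i \<le> h (X i)" "h (X i) \<le> rnd h X i + 1 / real N"
  using assms N by (auto simp: rnd_def field_simps) linarith+

lemma rnd_square:
  assumes "i < N" "h \<in> H" "X \<in> space P" shows "\<bar>(rnd h X i)\<^sup>2 - (h (X i))\<^sup>2\<bar> \<le> 2 / real N"
proof -
  have 1: "\<bar>rnd h X i - h (X i)\<bar> \<le> 1 / real N" using rnd_bounds[OF assms(1), of h X] by auto
  have 2: "\<bar>rnd h X i + h (X i)\<bar> \<le> 2"
    using grid_bound[OF rnd_grid[OF assms(2,3)] assms(1)] H_bound[OF assms(2) PD[OF assms(3,1)]] by linarith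
  have "\<bar>(rnd h X i)\<^sup>2 - (h (X i))\<^sup>2\<bar> = \<bar>rnd h X i - h (X i)\<bar> * \<bar>rnd h X i + h (X i)\<bar>"
    by (simp add: abs_mult[symmetric] power2_eq_square algebra_simps)
  also have "\<dots> \<le> 1 / real N * 2" using 1 2 by (intro mult_mono) auto
  finally show ?thesis by simp
qed

lemma swap_rnd: "sw \<tau> (rnd h X) (rnd h Y) = rnd h (sw \<tau> X Y)"
  by (auto simp: swap_by_def rnd_def fun_eq_iff)

text \<open>Rounding moves each summand by at most 1/N; this is the slack built into
  \<open>feasible\<close>.\<close>

lemma rnd_le_W:
  assumes "h \<in> H" "X \<in> space P" "\<epsilon> \<in> signs I"
  shows "(1 / real N) * (\<Sum>i<N. \<epsilon> i * rnd h X i) \<le> W \<epsilon> X + 1 / real N"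
proof -
  have "\<epsilon> i * rnd h X i \<le> \<epsilon> i * h (X i) + 1 / real N" if "i < N" for i
    using rnd_bounds[OF that, of h X] signs_cases[OF assms(3), of i] that N
    by (auto intro: order_trans)
  then have "(\<Sum>i<N. \<epsilon> i * rnd h X i) \<le> (\<Sum>i<N. \<epsilon> i * h (X i) + 1 / real N)"
    by (intro sum_mono) auto
  then have "(1 / real N) * (\<Sum>i<N. \<epsilon> i * rnd h X i) \<le> (1 / real N) * (\<Sum>i<N. \<epsilon> i * h (X i) + 1 / real N)"
    by (intro mult_left_mono) auto
  also have "\<dots> = (1 / real N) * (\<Sum>i<N. \<epsilon> i * h (X i)) + 1 / real N"
    using N by (simp add: sum.distrib distrib_left)
  also have "\<dots> \<le> W \<epsilon> X + 1 / real N" using W_upper[OF assms(3,2,1)] by simp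
  finally show ?thesis .
qed

lemma rnd_feasible:
  assumes "h \<in> H" "X \<in> space P" "Y \<in> space P"
  shows "feasible X Y (rnd h X, rnd h Y)"
  unfolding feasible_def prod.case swap_rnd by (intro ballI rnd_le_W P_swap assms)

lemma \<Psi>_upper: "u \<in> grid \<Longrightarrow> v \<in> grid \<Longrightarrow> feasible X Y (u, v) \<Longrightarrow> gap (u, v) \<le> \<Psi> (X, Y)"
  unfolding \<Psi>_def using finite_grid by (auto intro!: Max_ge image_eqI[of _ _ "(u, v)"])

lemma gap_bound:
  assumes "u \<in> grid" "v \<in> grid" shows "gap (u, v) \<le> 1"
proof -
  have "\<bar>(v i)\<^sup>2 - (u i)\<^sup>2\<bar> \<le> 1" if "i < N" for i
  proof -
    have "(u i)\<^sup>2 \<le> 1" "(v i)\<^sup>2 \<le> 1"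
      using grid_bound[OF assms(1) that] grid_bound[OF assms(2) that] by (auto simp: abs_square_le_1)
    then show ?thesis using zero_le_power2[of "u i"] zero_le_power2[of "v i"] by linarith
  qed
  then show ?thesis unfolding gap_def prod.case by (rule average_bound)
qed

lemma grid_ne: "grid \<noteq> {}"
  by (auto simp: grid_def PiE_eq_empty_iff)

lemma gap_nonneg: "0 \<le> gap p" by (simp add: gap_def case_prod_beta)

lemma \<Psi>_cases:
  obtains "\<Psi> (X, Y) = 0" | u v where "u \<in> grid" "v \<in> grid" "feasible X Y (u, v)" "\<Psi> (X, Y) = gap (u, v)"
proof -
  have "\<Psi> (X, Y) \<in> (\<lambda>p. if feasible X Y p then gap p else 0) ` (grid \<times> grid)"
    unfolding \<Psi>_def prod.case using grid_ne by (intro Max_in) auto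
  then obtain p where p: "p \<in> grid \<times> grid" "\<Psi> (X, Y) = (if feasible X Y p then gap p else 0)" by auto
  then show ?thesis using that by (cases p; cases "feasible X Y p") auto
qed

lemma \<Psi>_nonneg: "0 \<le> \<Psi> p"
  using gap_nonneg by (cases p, cases rule: \<Psi>_cases[of "fst p" "snd p"]) auto

lemma \<Psi>_le_1: "\<Psi> p \<le> 1"
  using gap_bound by (cases p, cases rule: \<Psi>_cases[of "fst p" "snd p"]) auto

lemma \<Psi>_measurable [measurable]: "\<Psi> \<in> borel_measurable P2"
proof -
  have [measurable]: "(\<lambda>z. W \<epsilon> (sw \<tau> (fst z) (snd z))) \<in> borel_measurable P2" if "\<epsilon> \<in> signs I" for \<epsilon> \<tau>
    by (rule measurable_compose[OF swap_by_measurable[unfolded case_prod_beta] W_measurable[OF that]])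
  have [measurable]: "Measurable.pred P2 (\<lambda>z. feasible (fst z) (snd z) p)" for p
    unfolding feasible_def case_prod_beta
    by (intro pred_intros_finite finite_signs finite_lessThan) measurable
  show ?thesis
    unfolding \<Psi>_def case_prod_beta using grid_ne by (intro borel_measurable_Max) auto
qed

text \<open>The rounded pair is feasible, and rounding changes each of the two empirical second
  moments by at most 2/N.\<close>

lemma \<Psi>_dominates:
  assumes "h \<in> H" "X \<in> space P" "Y \<in> space P"
  shows "\<bar>(1 / real N) * (\<Sum>i<N. (h (Y i))\<^sup>2) - (1 / real N) * (\<Sum>i<N. (h (X i))\<^sup>2)\<bar> \<le> \<Psi> (X, Y) + 4 / real N"
proof -
  have close: "\<bar>(1 / real N) * (\<Sum>i<N. (rnd h Z i)\<^sup>2) - (1 / real N) * (\<Sum>i<N. (h (Z i))\<^sup>2)\<bar> \<le> 2 / real N"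
    if "Z \<in> space P" for Z
  proof -
    have "\<bar>(1 / real N) * (\<Sum>i<N. (real N / 2) * ((rnd h Z i)\<^sup>2 - (h (Z i))\<^sup>2))\<bar> \<le> 1"
    proof (rule average_bound)
      fix i assume "i < N"
      then have "(real N / 2) * \<bar>(rnd h Z i)\<^sup>2 - (h (Z i))\<^sup>2\<bar> \<le> (real N / 2) * (2 / real N)"
        by (intro mult_left_mono rnd_square assms(1) that) auto
      then show "\<bar>(real N / 2) * ((rnd h Z i)\<^sup>2 - (h (Z i))\<^sup>2)\<bar> \<le> 1"
        using N by (simp add: abs_mult)
    qed
    then have "\<bar>(1 / real N) * ((real N / 2) * ((\<Sum>i<N. (rnd h Z i)\<^sup>2) - (\<Sum>i<N. (h (Z i))\<^sup>2)))\<bar> \<le> 1"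
      by (simp only: sum_distrib_left[symmetric] sum_subtractf)
    then have "\<bar>(\<Sum>i<N. (rnd h Z i)\<^sup>2) - (\<Sum>i<N. (h (Z i))\<^sup>2)\<bar> \<le> 2"
      using N by simp
    moreover have "(1 / real N) * (\<Sum>i<N. (rnd h Z i)\<^sup>2) - (1 / real N) * (\<Sum>i<N. (h (Z i))\<^sup>2)
        = (1 / real N) * ((\<Sum>i<N. (rnd h Z i)\<^sup>2) - (\<Sum>i<N. (h (Z i))\<^sup>2))"
      by (simp add: diff_divide_distrib)
    ultimately show ?thesis using N by (simp add: abs_mult divide_right_mono)
  qed
  have "\<bar>(1 / real N) * (\<Sum>i<N. (rnd h Y i)\<^sup>2) - (1 / real N) * (\<Sum>i<N. (rnd h X i)\<^sup>2)\<bar> \<le> \<Psi> (X, Y)"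
    using \<Psi>_upper[OF rnd_grid[OF assms(1,2)] rnd_grid[OF assms(1,3)] rnd_feasible[OF assms]]
    by (simp add: gap_def sum_subtractf diff_divide_distrib)
  then show ?thesis using close[OF assms(2)] close[OF assms(3)] by linarith
qed

text \<open>Because feasibility quantifies over all exchanges, exchanging X and Y merely relabels
  the feasible pairs. The polytope remains that of (X, Y), and \<tau> reappears as signs inside the
  gap: for frozen samples this is a Rademacher process over a fixed finite set.\<close>

lemma \<Psi>_swap:
  assumes \<tau>: "\<tau> \<in> signs I"
  obtains "\<Psi> (sw \<tau> X Y, sw \<tau> Y X) = 0" | u v where "u \<in> grid" "v \<in> grid" "feasible X Y (u, v)"
    "\<Psi> (sw \<tau> X Y, sw \<tau> Y X) = \<bar>(1 / real N) * (\<Sum>i<N. \<tau> i * ((v i)\<^sup>2 - (u i)\<^sup>2))\<bar>"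
proof (cases rule: \<Psi>_cases[of "sw \<tau> X Y" "sw \<tau> Y X"])
  case 1
  then show ?thesis using that by auto
next
  case (2 u v)
  let ?u = "sw \<tau> u v" and ?v = "sw \<tau> v u"
  have "feasible X Y (?u, ?v)"
    unfolding feasible_def prod.case
  proof (intro ballI)
    fix \<tau>' \<epsilon> :: "nat \<Rightarrow> real" assume *: "\<tau>' \<in> signs I" "\<epsilon> \<in> signs I"
    \<comment> \<open>Exchanges compose by multiplication and \<tau> squares to 1. So the inequality
      for \<open>?t\<close> at the exchanged samples is the required one for \<open>\<tau>'\<close>
      at the original samples.\<close>
    let ?t = "\<lambda>i\<in>I. \<tau>' i * \<tau> i"
    have t: "?t \<in> signs I" using signs_times[OF \<tau> *(1)] .
    have "sw ?t (sw \<tau> X Y) (sw \<tau> Y X) = sw \<tau>' X Y"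
      unfolding swap_by_compose[OF \<tau> t]
    proof
      fix i show "sw (\<lambda>i\<in>I. ?t i * \<tau> i) X Y i = sw \<tau>' X Y i"
        using signs_cases[OF \<tau>, of i] by (auto simp: swap_by_def)
    qed
    moreover have "sw \<tau>' ?u ?v = sw ?t u v"
      by (rule swap_by_compose[OF \<tau> *(1)])
    moreover note 2(3)[unfolded feasible_def prod.case, rule_format, OF t *(2)]
    ultimately show "(1 / real N) * (\<Sum>i<N. \<epsilon> i * sw \<tau>' ?u ?v i) \<le> W \<epsilon> (sw \<tau>' X Y) + 1 / real N"
      by (simp only:)
  qed
  moreover have "gap (u, v) = \<bar>(1 / real N) * (\<Sum>i<N. \<tau> i * ((?v i)\<^sup>2 - (?u i)\<^sup>2))\<bar>"
  proof -
    have "\<tau> i * ((?v i)\<^sup>2 - (?u i)\<^sup>2) = (v i)\<^sup>2 - (u i)\<^sup>2" if "i < N" for i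
      using signs_cases[OF \<tau>, of i] that by auto
    then show ?thesis by (simp add: gap_def)
  qed
  ultimately show ?thesis using that(2)[of ?u ?v] grid_swap 2 by simp
qed

text \<open>Squaring is 2-Lipschitz on [-1, 1], so contraction replaces the signed sums of squares
  by linear ones, and feasibility bounds those by \<open>W\<close>. The factor 4 is 2 from the
  contraction times 2 from separating u and v with \<open>exp_half_sum\<close>; the latter 2 is the
  one in \<open>c\<close>.\<close>

lemma exp_\<Psi>_swap_sum:
  assumes XY: "X \<in> space P" "Y \<in> space P" and s: "0 \<le> s"
  shows "(\<Sum>\<tau>\<in>signs I. exp (s * \<Psi> (sw \<tau> X Y, sw \<tau> Y X)))
    \<le> (\<Sum>\<epsilon>\<in>signs I. exp (4 * s * (W \<epsilon> X + 1 / real N)) + exp (4 * s * (W \<epsilon> Y + 1 / real N)))"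
proof -
  define T where "T = {p \<in> grid \<times> grid. feasible X Y p}"
  have T: "finite T" unfolding T_def by (rule finite_subset[of _ "grid \<times> grid"]) auto
  have T_ne: "T \<noteq> {}"
    using rnd_feasible[OF H_zero XY] rnd_grid[OF H_zero] XY by (auto simp: T_def)
  define c where "c = 2 * s / real N"
  have c: "0 \<le> c" using s by (simp add: c_def)
  define E where "E f \<tau> = Max ((\<lambda>p. 0 + (\<Sum>i\<in>I. \<tau> i * (c * (f p i)\<^sup>2))) ` T)" for f :: "_ \<Rightarrow> nat \<Rightarrow> real" and \<tau> :: "nat \<Rightarrow> real"
  have E_ge: "c * (\<Sum>i<N. \<tau> i * (f p i)\<^sup>2) \<le> E f \<tau>" if "p \<in> T" for f p \<tau>
    unfolding E_def using T that by (intro Max_ge) (auto simp: sum_distrib_left mult_ac)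
  \<comment> \<open>The absolute value costs a second term with reflected signs; summed over all
    sign vectors, both terms give the same.\<close>
  have E_abs: "exp (c * \<bar>\<Sum>i<N. \<tau> i * (f p i)\<^sup>2\<bar>) \<le> exp (E f \<tau>) + exp (E f (\<lambda>i\<in>I. - \<tau> i))" if "p \<in> T" for f p \<tau>
  proof (cases "0 \<le> (\<Sum>i<N. \<tau> i * (f p i)\<^sup>2)")
    case True
    then show ?thesis using E_ge[OF that, of \<tau> f] by (simp add: add_increasing2)
  next
    case False
    then show ?thesis using E_ge[OF that, of "\<lambda>i\<in>I. - \<tau> i" f]
      by (simp add: add_increasing sum_negf)
  qed
  have contr: "(\<Sum>\<tau>\<in>signs I. exp (E f \<tau>)) \<le> (\<Sum>\<epsilon>\<in>signs I. exp (4 * s * (W \<epsilon> Z + 1 / real N)))"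
    if f: "\<And>p i. p \<in> T \<Longrightarrow> i < N \<Longrightarrow> \<bar>f p i\<bar> \<le> 1"
      and le: "\<And>p \<epsilon>. p \<in> T \<Longrightarrow> \<epsilon> \<in> signs I \<Longrightarrow> (1 / real N) * (\<Sum>i<N. \<epsilon> i * f p i) \<le> W \<epsilon> Z + 1 / real N"
    for f :: "_ \<Rightarrow> nat \<Rightarrow> real" and Z
  proof -
    have "(\<Sum>\<tau>\<in>signs I. exp (E f \<tau>)) \<le> (\<Sum>\<epsilon>\<in>signs I. exp (Max ((\<lambda>p. 0 + (\<Sum>i\<in>I. \<epsilon> i * (2 * c * f p i))) ` T)))"
      unfolding E_def
    proof (rule rademacher_contraction_exp)
      fix p q i assume *: "p \<in> T" "q \<in> T" "i \<in> I"
      have "\<bar>(f p i)\<^sup>2 - (f q i)\<^sup>2\<bar> = \<bar>f p i - f q i\<bar> * \<bar>f p i + f q i\<bar>"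
        by (simp add: abs_mult[symmetric] power2_eq_square algebra_simps)
      also have "\<dots> \<le> \<bar>f p i - f q i\<bar> * 2"
        using f[of p i] f[of q i] * by (intro mult_left_mono) auto
      finally have "c * \<bar>(f p i)\<^sup>2 - (f q i)\<^sup>2\<bar> \<le> c * (\<bar>f p i - f q i\<bar> * 2)"
        using c by (rule mult_left_mono)
      moreover have "\<bar>c * (f p i)\<^sup>2 - c * (f q i)\<^sup>2\<bar> = c * \<bar>(f p i)\<^sup>2 - (f q i)\<^sup>2\<bar>"
        by (metis abs_mult abs_of_nonneg c right_diff_distrib)
      moreover have "\<bar>2 * c * f p i - 2 * c * f q i\<bar> = 2 * c * \<bar>f p i - f q i\<bar>"
        using abs_mult[of "2 * c" "f p i - f q i"] c by (simp add: right_diff_distrib)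
      ultimately show "\<bar>c * (f p i)\<^sup>2 - c * (f q i)\<^sup>2\<bar> \<le> \<bar>2 * c * f p i - 2 * c * f q i\<bar>"
        by simp
    next
      fix p i assume *: "p \<in> T" "i \<in> I"
      have "\<bar>f p i\<bar> * \<bar>f p i\<bar> \<le> \<bar>f p i\<bar> * 2" using f[of p i] * by (intro mult_left_mono) auto
      then have "c * (\<bar>f p i\<bar> * \<bar>f p i\<bar>) \<le> c * (\<bar>f p i\<bar> * 2)" using c by (rule mult_left_mono)
      then show "\<bar>c * (f p i)\<^sup>2\<bar> \<le> \<bar>2 * c * f p i\<bar>"
        using c by (simp add: abs_mult power2_eq_square mult_ac)
    qed (use T T_ne in auto)
    also have "\<dots> \<le> (\<Sum>\<epsilon>\<in>signs I. exp (4 * s * (W \<epsilon> Z + 1 / real N)))"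
    proof (intro sum_mono, subst exp_le_cancel_iff, rule Max.boundedI)
      fix \<epsilon> :: "nat \<Rightarrow> real" and x assume e: "\<epsilon> \<in> signs I" and "x \<in> (\<lambda>p. 0 + (\<Sum>i\<in>I. \<epsilon> i * (2 * c * f p i))) ` T"
      then obtain p where p: "p \<in> T" "x = (\<Sum>i\<in>I. \<epsilon> i * (2 * c * f p i))" by auto
      have "x = 4 * s * ((1 / real N) * (\<Sum>i<N. \<epsilon> i * f p i))"
        unfolding p(2) c_def by (simp add: sum_distrib_left sum_divide_distrib mult_ac)
      also have "\<dots> \<le> 4 * s * (W \<epsilon> Z + 1 / real N)"
        using s by (intro mult_left_mono le p e) auto
      finally show "x \<le> 4 * s * (W \<epsilon> Z + 1 / real N)" .
    qed (use T T_ne in auto)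
    finally show ?thesis .
  qed
  have one: "(\<lambda>i\<in>I. 1) \<in> signs I" "(\<lambda>i\<in>I. -1) \<in> signs I" by (auto simp: signs_def)
  have ext: "X \<in> extensional I" "Y \<in> extensional I" using XY by (auto simp: space_PiM PiE_iff)
  have "(\<Sum>\<tau>\<in>signs I. exp (s * \<Psi> (sw \<tau> X Y, sw \<tau> Y X)))
    \<le> (\<Sum>\<tau>\<in>signs I. ((exp (E fst \<tau>) + exp (E fst (\<lambda>i\<in>I. - \<tau> i))) + (exp (E snd \<tau>) + exp (E snd (\<lambda>i\<in>I. - \<tau> i)))) / 2)"
  proof (rule sum_mono)
    fix \<tau> :: "nat \<Rightarrow> real" assume \<tau>: "\<tau> \<in> signs I"
    let ?R = "((exp (E fst \<tau>) + exp (E fst (\<lambda>i\<in>I. - \<tau> i))) + (exp (E snd \<tau>) + exp (E snd (\<lambda>i\<in>I. - \<tau> i)))) / 2"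
    have main: "exp (s * \<bar>(1 / real N) * (\<Sum>i<N. \<tau> i * ((snd p i)\<^sup>2 - (fst p i)\<^sup>2))\<bar>) \<le> ?R" if p: "p \<in> T" for p
    proof -
      let ?a = "\<bar>\<Sum>i<N. \<tau> i * (fst p i)\<^sup>2\<bar>" and ?b = "\<bar>\<Sum>i<N. \<tau> i * (snd p i)\<^sup>2\<bar>"
      have "\<bar>\<Sum>i<N. \<tau> i * ((snd p i)\<^sup>2 - (fst p i)\<^sup>2)\<bar> \<le> ?a + ?b"
        unfolding right_diff_distrib sum_subtractf by (rule abs_triangle_ineq4[THEN order_trans]) simp
      then have "s / real N * \<bar>\<Sum>i<N. \<tau> i * ((snd p i)\<^sup>2 - (fst p i)\<^sup>2)\<bar> \<le> s / real N * (?a + ?b)"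
        using s by (intro mult_left_mono) auto
      then have "s * \<bar>(1 / real N) * (\<Sum>i<N. \<tau> i * ((snd p i)\<^sup>2 - (fst p i)\<^sup>2))\<bar> \<le> (c * ?a + c * ?b) / 2"
      proof -
        have "(c * ?a + c * ?b) / 2 = s / real N * (?a + ?b)"
          by (simp add: c_def distrib_left add_divide_distrib)
        moreover have "s * \<bar>(1 / real N) * (\<Sum>i<N. \<tau> i * ((snd p i)\<^sup>2 - (fst p i)\<^sup>2))\<bar>
            = s / real N * \<bar>\<Sum>i<N. \<tau> i * ((snd p i)\<^sup>2 - (fst p i)\<^sup>2)\<bar>"
          by (simp add: abs_mult)
        ultimately show ?thesis using \<open>s / real N * _ \<le> _\<close> by simp
      qed
      then have "exp (s * \<bar>(1 / real N) * (\<Sum>i<N. \<tau> i * ((snd p i)\<^sup>2 - (fst p i)\<^sup>2))\<bar>) \<le> exp ((c * ?a + c * ?b) / 2)"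
        by simp
      also have "\<dots> \<le> (exp (c * ?a) + exp (c * ?b)) / 2" by (rule exp_half_sum)
      also have "\<dots> \<le> ?R" using E_abs[OF p, of \<tau> fst] E_abs[OF p, of \<tau> snd] by simp
      finally show ?thesis .
    qed
    show "exp (s * \<Psi> (sw \<tau> X Y, sw \<tau> Y X)) \<le> ?R"
    proof (cases rule: \<Psi>_swap[OF \<tau>, of X Y])
      case 1
      \<comment> \<open>If \<open>\<Psi>\<close> vanishes, any feasible pair will do, since the
        exponent in \<open>main\<close> is nonnegative.\<close>
      obtain p where p: "p \<in> T" using T_ne by auto
      have "1 \<le> exp (s * \<bar>(1 / real N) * (\<Sum>i<N. \<tau> i * ((snd p i)\<^sup>2 - (fst p i)\<^sup>2))\<bar>)" using s by simp
      from order_trans[OF this main[OF p]] show ?thesis by (simp only: 1 mult_zero_right exp_zero)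
    next
      case (2 u v)
      then show ?thesis using main[of "(u, v)"] by (simp add: T_def)
    qed
  qed
  also have "\<dots> = (\<Sum>\<tau>\<in>signs I. exp (E fst \<tau>)) + (\<Sum>\<tau>\<in>signs I. exp (E snd \<tau>))"
    using sum_signs_uminus[of "\<lambda>\<tau>. exp (E fst \<tau>)" I] sum_signs_uminus[of "\<lambda>\<tau>. exp (E snd \<tau>)" I]
    by (simp only: sum_divide_distrib[symmetric] sum.distrib) simp
  also have "\<dots> \<le> (\<Sum>\<epsilon>\<in>signs I. exp (4 * s * (W \<epsilon> X + 1 / real N))) + (\<Sum>\<epsilon>\<in>signs I. exp (4 * s * (W \<epsilon> Y + 1 / real N)))"
  proof (intro add_mono contr)
    fix p i assume "p \<in> T" "i < N"
    then show "\<bar>fst p i\<bar> \<le> 1" "\<bar>snd p i\<bar> \<le> 1" by (auto simp: T_def intro: grid_bound)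
  next
    fix p and \<epsilon> :: "nat \<Rightarrow> real" assume p: "p \<in> T" and e: "\<epsilon> \<in> signs I"
    obtain u v where uv: "p = (u, v)" by (cases p)
    have f: "(1 / real N) * (\<Sum>i<N. \<epsilon> i * sw \<tau> u v i) \<le> W \<epsilon> (sw \<tau> X Y) + 1 / real N"
      if "\<tau> \<in> signs I" for \<tau>
      using p e that by (auto simp: T_def feasible_def uv simp del: swap_by_simps)
    have g: "u \<in> extensional I" "v \<in> extensional I" using p by (auto simp: T_def uv grid_extensional)
    \<comment> \<open>The trivial exchange gives the constraints on u alone, and the exchange of all
      coordinates those on v alone.\<close>
    show "(1 / real N) * (\<Sum>i<N. \<epsilon> i * fst p i) \<le> W \<epsilon> X + 1 / real N"
      using f[OF one(1)] by (simp add: swap_by_one ext g uv del: swap_by_simps)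
    show "(1 / real N) * (\<Sum>i<N. \<epsilon> i * snd p i) \<le> W \<epsilon> Y + 1 / real N"
      using f[OF one(2)] by (simp add: swap_by_minus_one ext g uv del: swap_by_simps)
  qed
  finally show ?thesis by (simp add: sum.distrib)
qed


text \<open>\<open>mgf_W\<close> with the constant majorant 1 for the second moments: k occurs once
  on each side, hence 16 = 8 + 8. No variance is exploited here, which suffices for the slow rate of
  the squares.\<close>

lemma mgf_W_crude:
  assumes "0 \<le> \<theta>"
  shows "(\<Sum>\<epsilon>\<in>signs I. \<integral>X. exp (\<theta> * W \<epsilon> X) \<partial>P) \<le> 2 ^ N * exp (\<theta> * R + 16 * \<theta>\<^sup>2 / real N)"
proof -
  let ?k = "8 * \<theta>\<^sup>2 / real N"
  have "(\<Sum>\<epsilon>\<in>signs I. \<integral>X. exp (\<theta> * W \<epsilon> X - ?k * 1) \<partial>P) \<le> 2 ^ N * exp (\<theta> * R + ?k * (\<integral>X. 1 \<partial>P))"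
  proof (rule mgf_W[where B = 1])
    fix X h assume X: "X \<in> space P" and h: "h \<in> H"
    have "\<bar>(1 / real N) * (\<Sum>i<N. (h (X i))\<^sup>2)\<bar> \<le> 1"
      using H_bound[OF h PD[OF X]] by (intro average_bound) (auto simp: abs_square_le_1)
    then show "(1 / real N) * (\<Sum>i<N. (h (X i))\<^sup>2) \<le> 1" by linarith
  qed (use assms in auto)
  also have "(\<Sum>\<epsilon>\<in>signs I. \<integral>X. exp (\<theta> * W \<epsilon> X - ?k * 1) \<partial>P)
      = (\<Sum>\<epsilon>\<in>signs I. \<integral>X. exp (\<theta> * W \<epsilon> X) \<partial>P) * exp (- ?k)"
    by (simp add: exp_diff exp_minus divide_inverse sum_distrib_right)
  finally have "(\<Sum>\<epsilon>\<in>signs I. \<integral>X. exp (\<theta> * W \<epsilon> X) \<partial>P) \<le> (2 ^ N * exp (\<theta> * R + ?k)) * exp ?k"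
    by (simp add: exp_minus field_simps P.prob_space)
  also have "\<dots> = 2 ^ N * exp (\<theta> * R + 16 * \<theta>\<^sup>2 / real N)"
    by (simp add: exp_add[symmetric] add.assoc)
  finally show ?thesis .
qed

lemma exp_W_integrable:
  assumes "\<epsilon> \<in> signs I" "0 \<le> s" shows "integrable P (\<lambda>X. exp (s * W \<epsilon> X + c))"
proof (intro P.integrable_const_bound[of _ "exp (s + c)"] AE_I2)
  fix X assume "X \<in> space P"
  then have "s * W \<epsilon> X \<le> s * 1" using W_le_1[OF assms(1)] assms by (intro mult_left_mono) auto
  then show "norm (exp (s * W \<epsilon> X + c)) \<le> exp (s + c)" by simp
qed (use assms in measurable)

lemma exp_\<Psi>_integrable: "0 \<le> s \<Longrightarrow> integrable P2 (\<lambda>Z. exp (s * \<Psi> Z))"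
  using \<Psi>_le_1 by (intro PP.integrable_const_bound[of _ "exp s"] AE_I2) (auto intro: mult_left_le)

lemma integral_fst_P:
  fixes f :: "_ \<Rightarrow> real" assumes "integrable P f"
  shows "(\<integral>Z. f (fst Z) \<partial>P2) = (\<integral>X. f X \<partial>P)" "integrable P2 (\<lambda>Z. f (fst Z))"
    "(\<integral>Z. f (snd Z) \<partial>P2) = (\<integral>X. f X \<partial>P)" "integrable P2 (\<lambda>Z. f (snd Z))"
proof -
  have 1: "distr P2 P fst = P" using P.distr_pair_fst[of P] by simp
  have "distr P2 P snd = distr (distr P2 P2 (\<lambda>(x, y). (y, x))) P snd"
    using PP.distr_pair_swap by simp
  also have "\<dots> = distr P2 P fst"
    by (subst distr_distr) (auto simp: comp_def case_prod_beta)
  finally have 2: "distr P2 P snd = P" using 1 by simp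
  have [measurable]: "f \<in> borel_measurable P" using assms by auto
  show "(\<integral>Z. f (fst Z) \<partial>P2) = (\<integral>X. f X \<partial>P)"
    using integral_distr[of fst "P2" P f] by (simp add: 1)
  show "(\<integral>Z. f (snd Z) \<partial>P2) = (\<integral>X. f X \<partial>P)"
    using integral_distr[of snd "P2" P f] by (simp add: 2)
  show "integrable P2 (\<lambda>Z. f (fst Z))"
    using integrable_distr[of fst "P2" P f] assms by (simp add: 1)
  show "integrable P2 (\<lambda>Z. f (snd Z))"
    using integrable_distr[of snd "P2" P f] assms by (simp add: 2)
qed

text \<open>The law of the two samples is invariant under exchanges, so
  \<open>exp_\<Psi>_swap_sum\<close> applies after averaging over them. Then 256 = 16 * 4^2 comes
  from \<open>mgf_W_crude\<close> at 4 s, and the factor 2 counts the two samples.\<close>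

lemma mgf_\<Psi>:
  assumes s: "0 \<le> s"
  shows "(\<integral>Z. exp (s * \<Psi> Z) \<partial>P2) \<le> 2 * exp (4 * s * (R + 1 / real N) + 256 * s\<^sup>2 / real N)"
proof -
  let ?sw = "\<lambda>\<tau> (X, Y). (sw \<tau> X Y, sw \<tau> Y X)"
  let ?g = "\<lambda>\<epsilon> X. exp (4 * s * W \<epsilon> X + 4 * s / real N)"
  have swm [measurable]: "?sw \<tau> \<in> P2 \<rightarrow>\<^sub>M P2" for \<tau>
    unfolding case_prod_beta
    by (intro measurable_Pair swap_by_measurable[unfolded case_prod_beta] swap_by_measurable2[unfolded case_prod_beta])
  have ints: "integrable P2 (\<lambda>Z. exp (s * \<Psi> (?sw \<tau> Z)))" for \<tau>
    using \<Psi>_le_1 s by (intro PP.integrable_const_bound[of _ "exp s"] AE_I2) (auto intro: mult_left_le)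
  have intg: "integrable P (?g \<epsilon>)" if "\<epsilon> \<in> signs I" for \<epsilon>
    using s that by (intro exp_W_integrable) auto
  have "2 ^ N * (\<integral>Z. exp (s * \<Psi> Z) \<partial>P2) = (\<Sum>\<tau>\<in>signs I. \<integral>Z. exp (s * \<Psi> Z) \<partial>P2)"
    by (simp add: card_signs)
  also have "\<dots> = (\<Sum>\<tau>\<in>signs I. \<integral>Z. exp (s * \<Psi> (?sw \<tau> Z)) \<partial>P2)"
    using integral_pair_swap[of "\<lambda>Z. exp (s * \<Psi> Z)"]
    by (intro sum.cong refl) (simp add: case_prod_beta' split_beta')
  also have "\<dots> = (\<integral>Z. (\<Sum>\<tau>\<in>signs I. exp (s * \<Psi> (?sw \<tau> Z))) \<partial>P2)"
    by (intro Bochner_Integration.integral_sum[symmetric] ints)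
  also have "\<dots> \<le> (\<integral>Z. (\<Sum>\<epsilon>\<in>signs I. ?g \<epsilon> (fst Z) + ?g \<epsilon> (snd Z)) \<partial>P2)"
  proof (rule integral_mono)
    show "integrable P2 (\<lambda>Z. \<Sum>\<epsilon>\<in>signs I. ?g \<epsilon> (fst Z) + ?g \<epsilon> (snd Z))"
      by (intro Bochner_Integration.integrable_sum Bochner_Integration.integrable_add integral_fst_P intg)
    fix Z assume "Z \<in> space P2"
    then show "(\<Sum>\<tau>\<in>signs I. exp (s * \<Psi> (?sw \<tau> Z))) \<le> (\<Sum>\<epsilon>\<in>signs I. ?g \<epsilon> (fst Z) + ?g \<epsilon> (snd Z))"
      using exp_\<Psi>_swap_sum[OF _ _ s, of "fst Z" "snd Z"]
      by (auto simp: space_pair_measure distrib_left)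
  qed (intro Bochner_Integration.integrable_sum ints)
  also have "\<dots> = (\<Sum>\<epsilon>\<in>signs I. 2 * (\<integral>X. ?g \<epsilon> X \<partial>P))"
  proof -
    have "(\<integral>Z. (\<Sum>\<epsilon>\<in>signs I. ?g \<epsilon> (fst Z) + ?g \<epsilon> (snd Z)) \<partial>P2)
        = (\<Sum>\<epsilon>\<in>signs I. \<integral>Z. ?g \<epsilon> (fst Z) + ?g \<epsilon> (snd Z) \<partial>P2)"
      by (intro Bochner_Integration.integral_sum Bochner_Integration.integrable_add integral_fst_P intg)
    also have "\<dots> = (\<Sum>\<epsilon>\<in>signs I. (\<integral>Z. ?g \<epsilon> (fst Z) \<partial>P2) + (\<integral>Z. ?g \<epsilon> (snd Z) \<partial>P2))"
      by (intro sum.cong refl Bochner_Integration.integral_add integral_fst_P intg)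
    also have "\<dots> = (\<Sum>\<epsilon>\<in>signs I. 2 * (\<integral>X. ?g \<epsilon> X \<partial>P))"
      by (intro sum.cong refl) (simp only: integral_fst_P[OF intg] mult_2)
    finally show ?thesis .
  qed
  also have "\<dots> = 2 * exp (4 * s / real N) * (\<Sum>\<epsilon>\<in>signs I. \<integral>X. exp (4 * s * W \<epsilon> X) \<partial>P)"
    by (simp add: exp_add sum_distrib_left mult_ac)
  also have "\<dots> \<le> 2 * exp (4 * s / real N) * (2 ^ N * exp (4 * s * R + 16 * (4 * s)\<^sup>2 / real N))"
    using s by (intro mult_left_mono mgf_W_crude) auto
  also have "\<dots> = 2 ^ N * (2 * exp (4 * s * (R + 1 / real N) + 256 * s\<^sup>2 / real N))"
    by (simp add: exp_add distrib_left power_mult_distrib)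
  finally show ?thesis by simp
qed

section \<open>Averaging over the second sample\<close>

definition q :: "(nat \<Rightarrow> 'a) \<Rightarrow> real" where
  "q X = (\<integral>Y. \<Psi> (X, Y) \<partial>P)"

lemma q_measurable [measurable]: "q \<in> borel_measurable P"
  unfolding q_def by measurable

lemma \<Psi>_section_integrable: "X \<in> space P \<Longrightarrow> integrable P (\<lambda>Y. \<Psi> (X, Y))"
  using \<Psi>_le_1 \<Psi>_nonneg by (intro P.integrable_const_bound[of _ 1] AE_I2) auto

lemma q_nonneg: "0 \<le> q X"
  unfolding q_def using \<Psi>_nonneg by (intro integral_nonneg_AE AE_I2)

lemma q_le_1: "X \<in> space P \<Longrightarrow> q X \<le> 1"
  unfolding q_def using \<Psi>_le_1 by (intro P.integral_le_const \<Psi>_section_integrable) auto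

lemma q_integrable: "integrable P q"
  using q_nonneg q_le_1 by (intro P.integrable_const_bound[of _ 1] AE_I2) auto

lemma mgf_q:
  assumes s: "0 \<le> s"
  shows "(\<integral>X. exp (s * q X) \<partial>P) \<le> 2 * exp (4 * s * (R + 1 / real N) + 256 * s\<^sup>2 / real N)"
proof -
  have "(\<integral>X. exp (s * q X) \<partial>P) \<le> (\<integral>X. (\<integral>Y. exp (s * \<Psi> (X, Y)) \<partial>P) \<partial>P)"
  proof (rule integral_mono)
    show "integrable P (\<lambda>X. exp (s * q X))"
      using q_le_1 s by (intro P.integrable_const_bound[of _ "exp s"] AE_I2) (auto intro: mult_left_le)
    show "integrable P (\<lambda>X. \<integral>Y. exp (s * \<Psi> (X, Y)) \<partial>P)"
      by (rule PP.integrable_fst'[OF exp_\<Psi>_integrable[OF s]])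
    fix X assume X: "X \<in> space P"
    note [simp] = \<Psi>_section_integrable[OF X]
    have "exp (s * q X) = (\<integral>Y. exp (s * q X) * (1 + (s * \<Psi> (X, Y) - s * q X)) \<partial>P)"
      by (simp add: P.prob_space q_def)
    also have "\<dots> \<le> (\<integral>Y. exp (s * \<Psi> (X, Y)) \<partial>P)"
    proof (rule integral_mono)
      show "integrable P (\<lambda>Y. exp (s * \<Psi> (X, Y)))"
        using \<Psi>_le_1 s X by (intro P.integrable_const_bound[of _ "exp s"] AE_I2) (auto intro: mult_left_le)
    qed (auto intro: exp_tangent)
    finally show "exp (s * q X) \<le> (\<integral>Y. exp (s * \<Psi> (X, Y)) \<partial>P)" .
  qed
  also have "\<dots> = (\<integral>Z. exp (s * \<Psi> Z) \<partial>P2)"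
    by (rule PP.integral_fst'[OF exp_\<Psi>_integrable[OF s]])
  finally show ?thesis using mgf_\<Psi>[OF s] by linarith
qed

lemma component_integral:
  fixes f :: "'a \<Rightarrow> real"
  assumes [measurable]: "f \<in> borel_measurable M" and "i < N"
  shows "(\<integral>D. f (D i) \<partial>P) = (\<integral>w. f w \<partial>M)"
  using distr_PiM_component[of I "\<lambda>_. M" i] prob_space_axioms assms(2)
    integral_distr[of "\<lambda>D. D i" P M f] by simp

text \<open>Integrating the second sample out of \<open>\<Psi>_dominates\<close> turns its empirical
  second moment into the true one. Thus \<open>q\<close> is a measurable bound, uniform in h, for
  the fluctuations of the empirical second moments.\<close>

lemma q_dominates:
  assumes h: "h \<in> H" and X: "X \<in> space P"
  shows "\<bar>(1 / real N) * (\<Sum>i<N. (h (X i))\<^sup>2) - (\<integral>w. (h w)\<^sup>2 \<partial>M)\<bar> \<le> q X + 4 / real N"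
proof -
  note [measurable] = H_meas[OF h]
  let ?A = "\<lambda>D. (1 / real N) * (\<Sum>i<N. (h (D i))\<^sup>2)"
  have int1: "integrable P (\<lambda>Y. (h (Y i))\<^sup>2)" if "i < N" for i
    using H_bound[OF h PD] that
    by (intro P.integrable_const_bound[of _ 1] AE_I2) (auto simp: abs_square_le_1)
  have intA: "integrable P ?A"
    using int1 by (intro integrable_mult_right Bochner_Integration.integrable_sum) auto
  have "(\<integral>Y. ?A Y \<partial>P) = (1 / real N) * (\<Sum>i<N. \<integral>Y. (h (Y i))\<^sup>2 \<partial>P)"
    using int1 by simp
  also have "\<dots> = (\<integral>w. (h w)\<^sup>2 \<partial>M)"
    using N by (simp add: component_integral[of "\<lambda>w. (h w)\<^sup>2"])
  finally have EA: "(\<integral>Y. ?A Y \<partial>P) = (\<integral>w. (h w)\<^sup>2 \<partial>M)" .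
  have "\<bar>\<integral>Y. ?A Y - ?A X \<partial>P\<bar> \<le> (\<integral>Y. \<bar>?A Y - ?A X\<bar> \<partial>P)"
    by (rule integral_abs_bound)
  also have "\<dots> \<le> (\<integral>Y. \<Psi> (X, Y) + 4 / real N \<partial>P)"
    using intA \<Psi>_section_integrable[OF X] \<Psi>_dominates[OF h X] by (intro integral_mono) auto
  also have "\<dots> = q X + 4 / real N"
    using \<Psi>_section_integrable[OF X] by (simp add: q_def P.prob_space)
  also have "(\<integral>Y. ?A Y - ?A X \<partial>P) = (\<integral>w. (h w)\<^sup>2 \<partial>M) - ?A X"
    using intA EA by (simp add: P.prob_space)
  finally show ?thesis by linarith
qed

lemma q_expectation: "(\<integral>X. q X \<partial>P) \<le> 4 * (R + 1 / real N) + 32 / sqrt (real N)"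
proof -
  \<comment> \<open>Makes 256 s^2 / N equal to 1. Another 1 comes from bounding the prefactor 2 by
    exp 1; together they are the 2 in 2 / s.\<close>
  define s where "s = sqrt (real N) / 16"
  have s: "0 < s" using N by (simp add: s_def)
  let ?m = "s * (\<integral>X. q X \<partial>P)"
  note [simp] = q_integrable
  have "exp ?m = (\<integral>X. exp ?m * (1 + (s * q X - ?m)) \<partial>P)"
    by (simp add: P.prob_space)
  also have "\<dots> \<le> (\<integral>X. exp (s * q X) \<partial>P)"
  proof (rule integral_mono)
    show "integrable P (\<lambda>X. exp (s * q X))"
      using q_le_1 s by (intro P.integrable_const_bound[of _ "exp s"] AE_I2) (auto intro: mult_left_le)
  qed (auto intro: exp_tangent)
  also have "\<dots> \<le> 2 * exp (4 * s * (R + 1 / real N) + 256 * s\<^sup>2 / real N)"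
    using s by (intro mgf_q) auto
  also have "\<dots> \<le> exp 1 * exp (4 * s * (R + 1 / real N) + 256 * s\<^sup>2 / real N)"
    using exp_ge_add_one_self[of "1::real"] by (intro mult_right_mono) auto
  also have "256 * s\<^sup>2 / real N = 1" using N by (simp add: s_def power_divide)
  finally have "?m \<le> 2 + 4 * s * (R + 1 / real N)"
    by (simp add: exp_add[symmetric])
  then have "(\<integral>X. q X \<partial>P) \<le> (2 + 4 * s * (R + 1 / real N)) / s"
    using s by (simp add: field_simps)
  also have "\<dots> = 4 * (R + 1 / real N) + 2 / s"
    using s by (simp add: add_divide_distrib)
  also have "2 / s = 32 / sqrt (real N)" by (simp add: s_def)
  finally show ?thesis .
qed

lemma chernoff:
  assumes [measurable]: "f \<in> borel_measurable P"
    and int: "integrable P (\<lambda>X. exp (f X))"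
    and le: "(\<integral>X. exp (f X) \<partial>P) \<le> exp c"
  shows "P.prob {X \<in> space P. f X \<ge> c + L} \<le> exp (- L)"
proof -
  have "P.prob {X \<in> space P. exp (f X) \<ge> exp (c + L)} \<le> (\<integral>X. exp (f X) \<partial>P) / exp (c + L)"
    using int by (intro integral_Markov_inequality_measure[where A = "{}"]) auto
  also have "\<dots> \<le> exp c / exp (c + L)" using le by (intro divide_right_mono) auto
  also have "\<dots> = exp (- L)" by (simp add: exp_diff[symmetric])
  finally show ?thesis by simp
qed

lemma q_tail:
  assumes "0 \<le> L"
  shows "P.prob {X \<in> space P. q X \<ge> 4 * (R + 1 / real N) + 32 * sqrt (L / real N)} \<le> 2 * exp (- L)"
proof (cases "L = 0")
  case True
  then show ?thesis by (simp add: order_trans[OF P.prob_le_1])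
next
  case False
  \<comment> \<open>Makes 256 s^2 / N equal to L. The deviation 32 sqrt (L / N) times s is then 2 L:
    one L pays for this quadratic term and the other for the tail. For L = 0, where s would vanish,
    the claimed bound 2 is trivial.\<close>
  define s where "s = sqrt (L * real N) / 16"
  have L: "0 < L" using assms False by simp
  have s: "0 < s" using L N by (simp add: s_def)
  let ?c = "ln 2 + (4 * s * (R + 1 / real N) + 256 * s\<^sup>2 / real N)"
  have "P.prob {X \<in> space P. s * q X \<ge> ?c + (L - ln 2)} \<le> exp (- (L - ln 2))"
  proof (rule chernoff)
    show "integrable P (\<lambda>X. exp (s * q X))"
      using q_le_1 s by (intro P.integrable_const_bound[of _ "exp s"] AE_I2) (auto intro: mult_left_le)
    show "(\<integral>X. exp (s * q X) \<partial>P) \<le> exp ?c"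
      using mgf_q[of s] s by (simp add: exp_add)
  qed measurable
  also have "exp (- (L - ln 2)) = 2 * exp (- L)" by (simp add: exp_diff exp_minus divide_inverse)
  also have "{X \<in> space P. s * q X \<ge> ?c + (L - ln 2)}
      = {X \<in> space P. q X \<ge> 4 * (R + 1 / real N) + 32 * sqrt (L / real N)}"
  proof -
    have "s * (32 * sqrt (L / real N)) = 2 * (sqrt (L * real N) * sqrt (L / real N))" by (simp add: s_def)
    also have "sqrt (L * real N) * sqrt (L / real N) = L"
      using N L by (simp add: real_sqrt_mult real_sqrt_divide)
    finally have 1: "s * (32 * sqrt (L / real N)) = 2 * L" .
    have 2: "256 * s\<^sup>2 / real N = L" using N L by (simp add: s_def power_divide)
    have "?c + (L - ln 2) = s * (4 * (R + 1 / real N) + 32 * sqrt (L / real N))"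
      unfolding distrib_left[of s] 1 2 by simp
    then show ?thesis using s by simp
  qed
  finally show ?thesis .
qed

end

section \<open>Noise\<close>

lemma sum_signs_prod:
  assumes "finite I"
  shows "(\<Sum>\<epsilon>\<in>signs I. \<Prod>i\<in>I. f i (\<epsilon> i)) = (\<Prod>i\<in>I. f i 1 + f i (- 1) :: real)"
proof -
  have "(\<Prod>i\<in>I. \<Sum>y\<in>{-1, 1}. f i y) = (\<Sum>\<epsilon>\<in>signs I. \<Prod>i\<in>I. f i (\<epsilon> i))"
    unfolding signs_def by (rule prod_sum_PiE) (auto simp: assms)
  then show ?thesis by (simp add: add.commute)
qed

text \<open>Up to the factor 2^(card I), and for c in [-1, 1], the product is the probability of
  \<epsilon> under independent signs with means c_i. This computes the total mass, and
  \<open>sum_signs_tilt_component\<close> the mean of one sign.\<close>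

lemma sum_signs_tilt: "finite I \<Longrightarrow> (\<Sum>\<epsilon>\<in>signs I. \<Prod>i\<in>I. 1 + \<epsilon> i * c i) = (2 ^ card I :: real)"
  by (simp add: sum_signs_prod[where f = "\<lambda>i y. 1 + y * c i"])

lemma sum_signs_tilt_component:
  assumes "finite I" "j \<in> I"
  shows "(\<Sum>\<epsilon>\<in>signs I. (\<Prod>i\<in>I. 1 + \<epsilon> i * c i) * \<epsilon> j) = (2 ^ card I * c j :: real)"
proof -
  have "(\<Prod>i\<in>I. 1 + \<epsilon> i * c i) * \<epsilon> j = (\<Prod>i\<in>I. (1 + \<epsilon> i * c i) * (if i = j then \<epsilon> i else 1))" for \<epsilon> :: "_ \<Rightarrow> real"
    using assms by (simp add: prod.distrib prod.delta)
  then have "(\<Sum>\<epsilon>\<in>signs I. (\<Prod>i\<in>I. 1 + \<epsilon> i * c i) * \<epsilon> j)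
      = (\<Prod>i\<in>I. (1 + 1 * c i) * (if i = j then 1 else 1) + (1 + - 1 * c i) * (if i = j then - 1 else 1))"
    using sum_signs_prod[OF assms(1), of "\<lambda>i y. (1 + y * c i) * (if i = j then y else 1)"] by simp
  also have "\<dots> = (\<Prod>i\<in>I. 2 * (if i = j then c i else 1))"
    by (intro prod.cong) auto
  also have "\<dots> = 2 ^ card I * c j"
    using assms by (simp add: prod.distrib prod.delta)
  finally show ?thesis .
qed

text \<open>On [0, 1] one has exp f \<le> 1 + f + f^2 \<le> 1 + 2 f, so the exponential moment is
  governed by the mean. This doubles the mean but leaves a deviation of order L / N without a square
  root.\<close>

lemma (in bounded_process) mean_tail:
  fixes f :: "'a \<Rightarrow> real"
  assumes [measurable]: "f \<in> borel_measurable M" and f: "\<And>w. w \<in> space M \<Longrightarrow> f w \<in> {0..1}"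
  shows "P.prob {D \<in> space P. (1 / real N) * (\<Sum>i<N. f (D i)) \<ge> 2 * (\<integral>w. f w \<partial>M) + L / real N} \<le> exp (- L)"
proof -
  interpret product_sigma_finite "\<lambda>_. M" by unfold_locales
  have intf: "integrable M f" using f by (intro integrable_const_bound[of _ 1] AE_I2) auto
  have inte: "integrable M (\<lambda>w. exp (f w))" using f by (intro integrable_const_bound[of _ "exp 1"] AE_I2) auto
  have "(\<integral>w. exp (f w) \<partial>M) \<le> (\<integral>w. 1 + 2 * f w \<partial>M)"
  proof (rule integral_mono)
    fix w assume "w \<in> space M"
    then have w: "0 \<le> f w" "f w \<le> 1" using f by auto
    then have "exp (f w) \<le> 1 + f w + (f w)\<^sup>2" by (intro exp_bound) auto
    also have "(f w)\<^sup>2 \<le> f w" using w by (simp add: power2_eq_square mult_left_le)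
    finally show "exp (f w) \<le> 1 + 2 * f w" by simp
  qed (use intf inte in auto)
  also have "\<dots> = 1 + 2 * (\<integral>w. f w \<partial>M)" using intf by (simp add: prob_space)
  also have "\<dots> \<le> exp (2 * (\<integral>w. f w \<partial>M))" by (rule exp_ge_add_one_self)
  finally have e: "(\<integral>w. exp (f w) \<partial>M) \<le> exp (2 * (\<integral>w. f w \<partial>M))" .
  have "(\<integral>D. exp (\<Sum>i<N. f (D i)) \<partial>P) = (\<integral>w. exp (f w) \<partial>M) ^ N"
    using product_integral_prod[of I "\<lambda>_ w. exp (f w)"] inte by (simp add: exp_sum)
  also have "\<dots> \<le> exp (2 * (\<integral>w. f w \<partial>M)) ^ N"
    using e by (intro power_mono integral_nonneg_AE) auto
  also have "\<dots> = exp (real N * (2 * (\<integral>w. f w \<partial>M)))" by (simp add: exp_of_nat_mult)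
  finally have "P.prob {D \<in> space P. (\<Sum>i<N. f (D i)) \<ge> real N * (2 * (\<integral>w. f w \<partial>M)) + L} \<le> exp (- L)"
  proof (intro chernoff)
    show "integrable P (\<lambda>D. exp (\<Sum>i<N. f (D i)))"
      using product_integrable_prod[of I "\<lambda>_ w. exp (f w)"] inte by (simp add: exp_sum)
  qed measurable
  also have "{D \<in> space P. (\<Sum>i<N. f (D i)) \<ge> real N * (2 * (\<integral>w. f w \<partial>M)) + L}
      = {D \<in> space P. (1 / real N) * (\<Sum>i<N. f (D i)) \<ge> 2 * (\<integral>w. f w \<partial>M) + L / real N}"
  proof -
    have "2 * (\<integral>w. f w \<partial>M) + L / real N \<le> (1 / real N) * x \<longleftrightarrow> real N * (2 * (\<integral>w. f w \<partial>M)) + L \<le> x" for x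
      using N mult_le_cancel_left_pos[of "real N" "2 * (\<integral>w. f w \<partial>M) + L / real N" "(1 / real N) * x"]
      by (simp add: distrib_left)
    then show ?thesis by simp
  qed
  finally show ?thesis .
qed

text \<open>
  The weight \<open>c\<close> plays the role of the noise; \<open>forget\<close> erases it from an observation, so that the
  last assumption says that \<open>c\<close> is centred conditionally on everything else.
\<close>

locale weighted_process = bounded_process +
  fixes c :: "'a \<Rightarrow> real" and forget :: "'a \<Rightarrow> 'a"
  assumes c_meas [measurable]: "c \<in> borel_measurable M"
    and c_bound: "\<And>w. w \<in> space M \<Longrightarrow> \<bar>c w\<bar> \<le> 1"
    and forget_space: "\<And>w. w \<in> space M \<Longrightarrow> forget w \<in> space M"
    and forget_H: "\<And>h w. h \<in> H \<Longrightarrow> w \<in> space M \<Longrightarrow> h (forget w) = h w"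
    and centred: "\<And>g B. g \<in> borel_measurable M \<Longrightarrow> (\<And>w. w \<in> space M \<Longrightarrow> \<bar>g w\<bar> \<le> B) \<Longrightarrow>
      (\<And>w. w \<in> space M \<Longrightarrow> g (forget w) = g w) \<Longrightarrow> (\<integral>w. g w * c w \<partial>M) = 0"
begin

text \<open>Formulated for one coordinate at a time, since \<open>integral_tilt\<close> integrates
  the noise out coordinate by coordinate.\<close>

definition forgetful :: "((nat \<Rightarrow> 'a) \<Rightarrow> real) \<Rightarrow> bool" where
  "forgetful G \<longleftrightarrow> (\<forall>D\<in>space P. \<forall>i<N. G (D(i := forget (D i))) = G D)"

lemma c_component_measurable [measurable]: "i < N \<Longrightarrow> (\<lambda>D. c (D i)) \<in> borel_measurable P"
  by (rule measurable_compose[of "\<lambda>D. D i" P M c]) auto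

text \<open>Expand the factor of one coordinate j. With the other coordinates frozen, G is
  unaffected by \<open>forget\<close> at j and the other factors do not involve j, so the term
  containing c(D_j) integrates to 0 by \<open>centred\<close>.\<close>

lemma integral_tilt:
  assumes [measurable]: "G \<in> borel_measurable P" and G_bd: "\<And>D. D \<in> space P \<Longrightarrow> \<bar>G D\<bar> \<le> B"
    and G: "forgetful G" and s: "s \<in> signs I" and "J \<subseteq> I"
  shows "(\<integral>D. G D * (\<Prod>i\<in>J. 1 + s i * c (D i)) \<partial>P) = (\<integral>D. G D \<partial>P)"
proof -
  have "finite J" using \<open>J \<subseteq> I\<close> finite_subset by blast
  then show ?thesis using \<open>J \<subseteq> I\<close>
  proof (induction J rule: finite_induct)
    case (insert j J)
    interpret PS: product_sigma_finite "\<lambda>_. M" by unfold_locales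
    let ?K = "\<lambda>D. \<Prod>i\<in>J. 1 + s i * c (D i)"
    have j: "j < N" and J: "\<And>i. i \<in> J \<Longrightarrow> i < N" using insert by auto
    have B: "0 \<le> B" using G_bd P.not_empty by (meson abs_ge_zero all_not_in_conv order_trans)
    have Km [measurable]: "?K \<in> borel_measurable P"
      using J by (intro borel_measurable_prod borel_measurable_add borel_measurable_times
        c_component_measurable) auto
    have cm [measurable]: "(\<lambda>D. c (D j)) \<in> borel_measurable P"
      using j by (rule c_component_measurable)
    have K: "\<bar>?K D\<bar> \<le> 2 ^ card J" if "\<And>i. i \<in> J \<Longrightarrow> D i \<in> space M" for D
    proof -
      have "\<bar>1 + s i * c (D i)\<bar> \<le> 2" if "i \<in> J" for i
        using c_bound[OF \<open>\<And>i. i \<in> J \<Longrightarrow> D i \<in> space M\<close>[OF that]] signs_cases[OF s, of i] J[OF that] by auto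
      then have "(\<Prod>i\<in>J. \<bar>1 + s i * c (D i)\<bar>) \<le> (\<Prod>i\<in>J. 2)" by (intro prod_mono) auto
      then show ?thesis by (simp add: abs_prod)
    qed
    have KD: "\<bar>?K D\<bar> \<le> 2 ^ card J" if "D \<in> space P" for D
      using K PD[OF that] J by auto
    have cD: "\<bar>c (D j)\<bar> \<le> 1" if "D \<in> space P" for D
      using c_bound PD[OF that j] by auto
    have i1: "integrable P (\<lambda>D. G D * ?K D)"
    proof (intro P.integrable_const_bound[of _ "B * 2 ^ card J"] AE_I2)
      fix D assume "D \<in> space P"
      then show "norm (G D * ?K D) \<le> B * 2 ^ card J"
        unfolding real_norm_def abs_mult using G_bd KD B by (intro mult_mono) auto
    qed measurable
    have i2: "integrable P (\<lambda>D. G D * ?K D * c (D j))"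
    proof (intro P.integrable_const_bound[of _ "B * 2 ^ card J * 1"] AE_I2)
      fix D assume "D \<in> space P"
      then show "norm (G D * ?K D * c (D j)) \<le> B * 2 ^ card J * 1"
        unfolding real_norm_def abs_mult using G_bd KD B cD by (intro mult_mono) auto
    qed measurable
    let ?I = "I - {j}"
    have Ij: "insert j ?I = I" using j by auto
    have "(\<integral>D. G D * ?K D * c (D j) \<partial>P)
      = (\<integral>x. (\<integral>y. G (x(j := y)) * ?K (x(j := y)) * c ((x(j := y)) j) \<partial>M) \<partial>(\<Pi>\<^sub>M i\<in>?I. M))"
      using PS.product_integral_insert[of ?I j "\<lambda>D. G D * ?K D * c (D j)"] i2 by (simp only: Ij) simp
    also have "\<dots> = (\<integral>x. 0 \<partial>(\<Pi>\<^sub>M i\<in>?I. M))"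
    proof (rule Bochner_Integration.integral_cong[OF refl])
      fix x assume x: "x \<in> space (\<Pi>\<^sub>M i\<in>?I. M)"
      have K_eq: "?K (x(j := y)) = ?K x" for y
        using insert.hyps by (intro prod.cong) auto
      have xP: "x(j := y) \<in> space P" if "y \<in> space M" for y
        using x that j by (auto simp: space_PiM PiE_iff extensional_def)
      have Kx: "\<bar>?K x\<bar> \<le> 2 ^ card J"
        using x J insert.hyps by (intro K) (auto simp: space_PiM PiE_iff)
      have "(\<integral>y. (G (x(j := y)) * ?K x) * c y \<partial>M) = 0"
      proof (rule centred)
        have "(\<lambda>y. x(j := y)) \<in> M \<rightarrow>\<^sub>M P"
          using measurable_component_update[OF x, of j] by (simp only: Ij) simp
        then show "(\<lambda>y. G (x(j := y)) * ?K x) \<in> borel_measurable M"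
          by (intro borel_measurable_times measurable_compose[OF _ assms(1)]) auto
        fix y assume y: "y \<in> space M"
        show "\<bar>G (x(j := y)) * ?K x\<bar> \<le> B * 2 ^ card J"
          unfolding abs_mult using G_bd[OF xP[OF y]] Kx B by (intro mult_mono) auto
        have "G ((x(j := y))(j := forget ((x(j := y)) j))) = G (x(j := y))"
          using G xP[OF y] j unfolding forgetful_def by blast
        then show "G (x(j := forget y)) * ?K x = G (x(j := y)) * ?K x" by simp
      qed
      then show "(\<integral>y. G (x(j := y)) * ?K (x(j := y)) * c ((x(j := y)) j) \<partial>M) = 0"
        by (simp only: K_eq fun_upd_same)
    qed
    finally have zero: "(\<integral>D. G D * ?K D * c (D j) \<partial>P) = 0" by simp
    have "(\<integral>D. G D * (\<Prod>i\<in>insert j J. 1 + s i * c (D i)) \<partial>P)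
        = (\<integral>D. G D * ?K D + s j * (G D * ?K D * c (D j)) \<partial>P)"
      using insert.hyps by (intro Bochner_Integration.integral_cong) (auto simp: algebra_simps)
    also have "\<dots> = (\<integral>D. G D * ?K D \<partial>P) + s j * (\<integral>D. G D * ?K D * c (D j) \<partial>P)"
      using i1 i2 by simp
    also have "\<dots> = (\<integral>D. G D \<partial>P)" using zero insert by simp
    finally show ?case .
  qed simp
qed

definition weight :: "(nat \<Rightarrow> real) \<Rightarrow> (nat \<Rightarrow> 'a) \<Rightarrow> real" where
  "weight s D = (\<Prod>i<N. 1 + s i * c (D i)) / 2 ^ N"

text \<open>
  \<open>(c(D\<^sub>i))\<^sub>i\<close> is the mean of random signs drawn with probabilities \<open>weight _ D\<close>; the resulting average
  of the suprema \<open>W\<close> is a measurable upper bound for the weighted supremum.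
\<close>

definition V :: "(nat \<Rightarrow> 'a) \<Rightarrow> real" where
  "V D = (\<Sum>s\<in>signs I. weight s D * W s D)"

lemma weight_measurable [measurable]: "weight s \<in> borel_measurable P"
  unfolding weight_def
  by (intro borel_measurable_divide borel_measurable_prod borel_measurable_add borel_measurable_times
        c_component_measurable) auto

lemma weight_nonneg:
  assumes "s \<in> signs I" "D \<in> space P" shows "0 \<le> weight s D"
  unfolding weight_def
proof (intro divide_nonneg_nonneg prod_nonneg ballI)
  fix i assume "i \<in> I"
  then show "0 \<le> 1 + s i * c (D i)"
    using signs_cases[OF assms(1), of i] c_bound[OF PD[OF assms(2), of i]] by auto
qed auto

lemma weight_sum: "(\<Sum>s\<in>signs I. weight s D) = 1"
  using sum_signs_tilt[of I "\<lambda>i. c (D i)"] by (simp add: weight_def sum_divide_distrib[symmetric])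

lemma V_dominates:
  assumes D: "D \<in> space P" and h: "h \<in> H"
  shows "(1 / real N) * (\<Sum>i<N. c (D i) * h (D i)) \<le> V D"
proof -
  have "(\<Sum>s\<in>signs I. weight s D * s i) = c (D i)" if "i < N" for i
    using sum_signs_tilt_component[of I i "\<lambda>i. c (D i)"] that
    by (simp add: weight_def sum_divide_distrib[symmetric])
  then have "(1 / real N) * (\<Sum>i<N. c (D i) * h (D i))
      = (1 / real N) * (\<Sum>i<N. (\<Sum>s\<in>signs I. weight s D * s i) * h (D i))"
    by simp
  also have "\<dots> = (\<Sum>s\<in>signs I. weight s D * ((1 / real N) * (\<Sum>i<N. s i * h (D i))))"
    unfolding sum_distrib_left sum_distrib_right by (subst sum.swap) (simp add: mult_ac)
  also have "\<dots> \<le> V D"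
    unfolding V_def using D h by (intro sum_mono mult_left_mono W_upper weight_nonneg)
  finally show ?thesis .
qed

lemma V_measurable [measurable]: "V \<in> borel_measurable P"
  unfolding V_def by measurable

lemma forgetful_W: "forgetful (W s)"
  unfolding forgetful_def
proof (intro ballI allI impI)
  fix D i assume D: "D \<in> space P" and i: "i < N"
  have "h ((D(i := forget (D i))) j) = h (D j)" if "h \<in> H" "j < N" for h j
    using forget_H[OF that(1) PD[OF D i]] by auto
  then show "W s (D(i := forget (D i))) = W s D"
    unfolding W_def by (intro SUP_cong refl arg_cong2[of _ _ _ _ "(*)"] sum.cong) auto
qed

text \<open>\<open>\<Psi>\<close> depends on the first sample only through \<open>W\<close> at
  exchanged samples. There the altered coordinate is either kept, and \<open>W\<close> does not
  notice the change, or it has been exchanged away.\<close>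

lemma forgetful_q: "forgetful q"
  unfolding forgetful_def
proof (intro ballI allI impI)
  fix X i assume X: "X \<in> space P" and i: "i < N"
  have "W \<epsilon> (sw \<tau> (X(i := forget (X i))) Y) = W \<epsilon> (sw \<tau> X Y)" if Y: "Y \<in> space P" for \<epsilon> \<tau> Y
  proof (cases "\<tau> i = 1")
    case True
    then have "sw \<tau> (X(i := forget (X i))) Y
        = (sw \<tau> X Y)(i := forget (sw \<tau> X Y i))"
      using i by (auto simp: swap_by_def fun_eq_iff)
    then show ?thesis
      using forgetful_W P_swap[OF X Y] i unfolding forgetful_def by metis
  next
    case False
    then have "sw \<tau> (X(i := forget (X i))) Y = sw \<tau> X Y"
      by (auto simp: swap_by_def fun_eq_iff)
    then show ?thesis by simp
  qed
  then have "\<Psi> (X(i := forget (X i)), Y) = \<Psi> (X, Y)" if "Y \<in> space P" for Y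
    using that by (simp add: \<Psi>_def feasible_def)
  then show "q (X(i := forget (X i))) = q X"
    unfolding q_def by (intro Bochner_Integration.integral_cong) auto
qed

text \<open>A measurable majorant of all empirical second moments of the class, by
  \<open>H_norm\<close> and \<open>q_dominates\<close>. It serves as the variance proxy in
  \<open>mgf_W\<close>.\<close>

definition S :: "(nat \<Rightarrow> 'a) \<Rightarrow> real" where
  "S X = t\<^sup>2 + q X + 4 / real N"

text \<open>Jensen with respect to the weights moves exp inside the average over signs. For a fixed
  sign vector the remaining integrand is forgetful, so \<open>integral_tilt\<close> removes the
  weight, and the plain average over signs of \<open>mgf_W\<close> is left.\<close>

lemma mgf_V:
  assumes \<theta>: "0 \<le> \<theta>"
  defines "k \<equiv> 8 * \<theta>\<^sup>2 / real N"
  shows "(\<integral>D. exp (\<theta> * V D - k * S D) \<partial>P) \<le> exp (\<theta> * R + k * (\<integral>X. S X \<partial>P))"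
    "integrable P (\<lambda>D. exp (\<theta> * V D - k * S D))"
proof -
  have k: "0 \<le> k" by (simp add: k_def)
  have [measurable]: "S \<in> borel_measurable P" unfolding S_def by measurable
  have S0: "0 \<le> S X" for X using q_nonneg[of X] by (simp add: S_def)
  have SB: "\<bar>S X\<bar> \<le> t\<^sup>2 + 1 + 4" if "X \<in> space P" for X
  proof -
    have "4 / real N \<le> 4" using N by (simp add: field_simps)
    then show ?thesis using q_nonneg[of X] q_le_1[OF that] S0[of X] by (simp add: S_def)
  qed
  have signs_ne: "signs I \<noteq> {}" by (auto simp: signs_def PiE_eq_empty_iff)
  let ?G = "\<lambda>s D. exp (\<theta> * W s D - k * S D)"
  have G_le: "\<bar>?G s D\<bar> \<le> exp \<theta>" if "s \<in> signs I" "D \<in> space P" for s D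
  proof -
    have "\<theta> * W s D \<le> \<theta>" using W_le_1[OF that] \<theta> by (simp add: mult_left_le)
    moreover have "0 \<le> k * S D" using k S0 by simp
    ultimately show ?thesis by simp
  qed
  have V_le: "V D \<le> 1" if "D \<in> space P" for D
  proof -
    have "V D \<le> (\<Sum>s\<in>signs I. weight s D * 1)"
      unfolding V_def using that by (intro sum_mono mult_left_mono W_le_1 weight_nonneg)
    then show ?thesis by (simp add: weight_sum)
  qed
  show int: "integrable P (\<lambda>D. exp (\<theta> * V D - k * S D))"
  proof (intro P.integrable_const_bound[of _ "exp \<theta>"] AE_I2)
    fix D assume D: "D \<in> space P"
    have "\<theta> * V D \<le> \<theta>" using V_le[OF D] \<theta> by (simp add: mult_left_le)
    moreover have "0 \<le> k * S D" using k S0 by simp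
    ultimately show "norm (exp (\<theta> * V D - k * S D)) \<le> exp \<theta>" by simp
  qed measurable
  have intG: "integrable P (\<lambda>D. weight s D * ?G s D)" if s: "s \<in> signs I" for s
  proof (intro P.integrable_const_bound[of _ "1 * exp \<theta>"] AE_I2)
    fix D assume D: "D \<in> space P"
    have "weight s D \<le> (\<Sum>s\<in>signs I. weight s D)"
      using s D weight_nonneg by (intro member_le_sum) auto
    then show "norm (weight s D * ?G s D) \<le> 1 * exp \<theta>"
      unfolding real_norm_def abs_mult using G_le[OF s D] weight_nonneg[OF s D]
      by (intro mult_mono) (auto simp: weight_sum)
  qed (use s in measurable)
  have "(\<integral>D. exp (\<theta> * V D - k * S D) \<partial>P) \<le> (\<integral>D. (\<Sum>s\<in>signs I. weight s D * ?G s D) \<partial>P)"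
  proof (rule integral_mono[OF int])
    show "integrable P (\<lambda>D. \<Sum>s\<in>signs I. weight s D * ?G s D)"
      by (intro Bochner_Integration.integrable_sum intG)
    fix D assume D: "D \<in> space P"
    have "exp (\<Sum>s\<in>signs I. weight s D *\<^sub>R (\<theta> * W s D - k * S D)) \<le> (\<Sum>s\<in>signs I. weight s D * ?G s D)"
      using D weight_nonneg weight_sum signs_ne by (intro convex_on_sum[OF _ _ exp_convex]) auto
    moreover have "(\<Sum>s\<in>signs I. weight s D *\<^sub>R (\<theta> * W s D - k * S D)) = \<theta> * V D - k * S D"
    proof -
      have "(\<Sum>s\<in>signs I. weight s D *\<^sub>R (\<theta> * W s D - k * S D))
          = (\<Sum>s\<in>signs I. \<theta> * (weight s D * W s D) - weight s D * (k * S D))"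
        by (simp add: algebra_simps)
      also have "\<dots> = \<theta> * V D - (\<Sum>s\<in>signs I. weight s D) * (k * S D)"
        by (simp only: V_def sum_subtractf sum_distrib_left sum_distrib_right)
      finally show ?thesis by (simp add: weight_sum)
    qed
    ultimately show "exp (\<theta> * V D - k * S D) \<le> (\<Sum>s\<in>signs I. weight s D * ?G s D)" by simp
  qed
  also have "\<dots> = (\<Sum>s\<in>signs I. \<integral>D. weight s D * ?G s D \<partial>P)"
    by (intro Bochner_Integration.integral_sum intG)
  also have "\<dots> = (\<Sum>s\<in>signs I. (\<integral>D. ?G s D \<partial>P) / 2 ^ N)"
  proof (intro sum.cong refl)
    fix s :: "nat \<Rightarrow> real" assume s: "s \<in> signs I"
    have "(\<integral>D. ?G s D * (\<Prod>i\<in>I. 1 + s i * c (D i)) \<partial>P) = (\<integral>D. ?G s D \<partial>P)"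
    proof (rule integral_tilt[OF _ G_le[OF s] _ s])
      show "forgetful (?G s)"
        using forgetful_W[of s] forgetful_q unfolding forgetful_def S_def by simp
    qed (use s in auto)
    moreover have "weight s D * ?G s D = ?G s D * (\<Prod>i\<in>I. 1 + s i * c (D i)) / 2 ^ N" for D
      by (simp add: weight_def)
    ultimately show "(\<integral>D. weight s D * ?G s D \<partial>P) = (\<integral>D. ?G s D \<partial>P) / 2 ^ N" by simp
  qed
  also have "\<dots> = (\<Sum>s\<in>signs I. \<integral>D. ?G s D \<partial>P) / 2 ^ N" by (simp add: sum_divide_distrib)
  also have "\<dots> \<le> (2 ^ N * exp (\<theta> * R + k * (\<integral>X. S X \<partial>P))) / 2 ^ N"
  proof (intro divide_right_mono)
    show "(\<Sum>s\<in>signs I. \<integral>D. ?G s D \<partial>P) \<le> 2 ^ N * exp (\<theta> * R + k * (\<integral>X. S X \<partial>P))"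
      unfolding k_def
    proof (rule mgf_W[OF _ SB _ \<theta>])
      fix X h assume "X \<in> space P" "h \<in> H"
      then show "(1 / real N) * (\<Sum>i<N. (h (X i))\<^sup>2) \<le> S X"
        using q_dominates[of h X] H_norm[of h] unfolding S_def by linarith
    qed auto
  qed simp
  finally show "(\<integral>D. exp (\<theta> * V D - k * S D) \<partial>P) \<le> exp (\<theta> * R + k * (\<integral>X. S X \<partial>P))" by simp
qed

lemma V_tail:
  assumes \<theta>: "0 < \<theta>"
  shows "P.prob {D \<in> space P. V D \<ge> R + 8 * \<theta> / real N * (S D + (\<integral>X. S X \<partial>P)) + L / \<theta>} \<le> exp (- L)"
proof -
  let ?k = "8 * \<theta>\<^sup>2 / real N"
  have [measurable]: "S \<in> borel_measurable P" unfolding S_def by measurable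
  have "P.prob {D \<in> space P. \<theta> * V D - ?k * S D \<ge> (\<theta> * R + ?k * (\<integral>X. S X \<partial>P)) + L} \<le> exp (- L)"
    using mgf_V[of \<theta>] \<theta> by (intro chernoff) auto
  also have "{D \<in> space P. \<theta> * V D - ?k * S D \<ge> (\<theta> * R + ?k * (\<integral>X. S X \<partial>P)) + L}
     = {D \<in> space P. V D \<ge> R + 8 * \<theta> / real N * (S D + (\<integral>X. S X \<partial>P)) + L / \<theta>}"
  proof -
    have "\<theta> * (R + 8 * \<theta> / real N * (S D + (\<integral>X. S X \<partial>P)) + L / \<theta>)
        = \<theta> * R + ?k * (\<integral>X. S X \<partial>P) + L + ?k * S D" for D
      using \<theta> by (simp add: distrib_left power2_eq_square mult_ac)
    then have "V D \<ge> R + 8 * \<theta> / real N * (S D + (\<integral>X. S X \<partial>P)) + L / \<theta>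
        \<longleftrightarrow> \<theta> * V D - ?k * S D \<ge> (\<theta> * R + ?k * (\<integral>X. S X \<partial>P)) + L" for D
      using mult_le_cancel_left_pos[OF \<theta>] by (smt (verit))
    then show ?thesis by auto
  qed
  finally show ?thesis .
qed

end

section \<open>The law of a sample\<close>

definition base_space :: "setting \<Rightarrow> (ctx \<times> real \<times> bool) measure" where
  "base_space S = ctx_space S \<Otimes>\<^sub>M cov_space S \<Otimes>\<^sub>M count_space UNIV"

locale valid =
  fixes S :: setting
  assumes valid: "valid_setting S"
begin

abbreviation "M \<equiv> sample_law S"
abbreviation "fs \<equiv> true_reward S"
abbreviation "lam \<equiv> noise_bound S"

lemma valid_parts:
  shows contexts_sub: "contexts S \<subseteq> space (\<Pi>\<^sub>M i\<in>{..<dim S}. borel :: real measure)"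
    and finite_actions: "finite (actions S)"
    and law_space: "law S \<in> space (prob_algebra (base_space S))"
    and impute_meas [measurable]: "impute S \<in> ctx_space S \<rightarrow>\<^sub>M cov_space S"
    and policy_meas [measurable]: "policy S \<in> ctx_space S \<Otimes>\<^sub>M cov_space S \<rightarrow>\<^sub>M prob_algebra (act_space S)"
    and noise_meas [measurable]: "noise S \<in> ctx_space S \<Otimes>\<^sub>M cov_space S \<Otimes>\<^sub>M count_space UNIV \<Otimes>\<^sub>M act_space S \<rightarrow>\<^sub>M prob_algebra borel"
    and lam_pos: "0 < lam"
    and noise_bounded: "\<And>x z b a. x \<in> contexts S \<Longrightarrow> z \<in> covariates S \<Longrightarrow> a \<in> actions S \<Longrightarrow>
        AE \<xi> in noise S (x, z, b, a). \<xi> \<in> {- lam..lam}"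
    and noise_centred: "\<And>x z b a. x \<in> contexts S \<Longrightarrow> z \<in> covariates S \<Longrightarrow> a \<in> actions S \<Longrightarrow>
        (\<integral>\<xi>. \<xi> \<partial>noise S (x, z, b, a)) = 0"
    and reward_meas: "\<And>f. f \<in> reward_class S \<Longrightarrow> f \<in> borel_measurable (ctx_space S \<Otimes>\<^sub>M cov_space S \<Otimes>\<^sub>M act_space S)"
    and reward_range: "\<And>f x z a. f \<in> reward_class S \<Longrightarrow> x \<in> contexts S \<Longrightarrow> z \<in> covariates S \<Longrightarrow> a \<in> actions S \<Longrightarrow> f (x, z, a) \<in> {0..1}"
    and convex_class: "\<And>f g u. f \<in> reward_class S \<Longrightarrow> g \<in> reward_class S \<Longrightarrow> u \<in> {0..1} \<Longrightarrow> (\<lambda>p. (1 - u) * f p + u * g p) \<in> reward_class S"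
    and fs_class: "fs \<in> reward_class S"
    and mismatch_pos: "\<And>f a. f \<in> reward_class S \<Longrightarrow> a \<in> actions S \<Longrightarrow> 0 < mismatch S f a"
  using valid unfolding valid_setting_def base_space_def by blast+

lemma space_ctx: "space (ctx_space S) = contexts S"
  using contexts_sub by (auto simp: ctx_space_def space_restrict_space)

lemma space_cov: "space (cov_space S) = covariates S"
  by (auto simp: cov_space_def space_restrict_space)

lemma space_act: "space (act_space S) = actions S"
  by (simp add: act_space_def)

lemma space_base: "space (base_space S) = contexts S \<times> covariates S \<times> UNIV"
  by (simp add: base_space_def space_pair_measure space_ctx space_cov)

lemma space_sample: "space (sample_space S) = contexts S \<times> covariates S \<times> UNIV \<times> actions S \<times> UNIV"
  by (simp add: sample_space_def space_pair_measure space_ctx space_cov space_act)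

lemma imputed_meas: "(\<lambda>p. imputed S (fst p) (fst (snd p)) (snd (snd p))) \<in> base_space S \<rightarrow>\<^sub>M cov_space S"
  unfolding imputed_def base_space_def by measurable

lemma imputed_in: "x \<in> contexts S \<Longrightarrow> z \<in> covariates S \<Longrightarrow> imputed S x z b \<in> covariates S"
  using measurable_space[OF impute_meas] by (auto simp: imputed_def space_ctx space_cov)

lemma impute_in: "x \<in> contexts S \<Longrightarrow> impute S x \<in> covariates S"
  using measurable_space[OF impute_meas] by (auto simp: space_ctx space_cov)

lemma kernel_meas:
  "(\<lambda>p. noise S (fst p, fst (snd p), fst (snd (snd p)), snd (snd (snd p))) \<bind>
      (\<lambda>\<xi>. return (sample_space S) (fst p, fst (snd p), fst (snd (snd p)), snd (snd (snd p)), \<xi>)))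
    \<in> ctx_space S \<Otimes>\<^sub>M cov_space S \<Otimes>\<^sub>M count_space UNIV \<Otimes>\<^sub>M act_space S \<rightarrow>\<^sub>M prob_algebra (sample_space S)"
proof (rule measurable_bind_prob_space2)
  show "(\<lambda>p. noise S (fst p, fst (snd p), fst (snd (snd p)), snd (snd (snd p))))
     \<in> ctx_space S \<Otimes>\<^sub>M cov_space S \<Otimes>\<^sub>M count_space UNIV \<Otimes>\<^sub>M act_space S \<rightarrow>\<^sub>M prob_algebra borel"
    by measurable
  show "(\<lambda>(p, \<xi>). return (sample_space S) (fst p, fst (snd p), fst (snd (snd p)), snd (snd (snd p)), \<xi>))
    \<in> (ctx_space S \<Otimes>\<^sub>M cov_space S \<Otimes>\<^sub>M count_space UNIV \<Otimes>\<^sub>M act_space S) \<Otimes>\<^sub>M borel \<rightarrow>\<^sub>M prob_algebra (sample_space S)"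
    unfolding case_prod_beta
    by (rule measurable_compose[OF _ measurable_return_prob_space]) (unfold sample_space_def, measurable)
qed

definition step :: "ctx \<times> real \<times> bool \<Rightarrow> sample measure" where
  "step = (\<lambda>(x, z, b). policy S (x, imputed S x z b) \<bind> (\<lambda>a.
       noise S (x, z, b, a) \<bind> (\<lambda>\<xi>. return (sample_space S) (x, z, b, a, \<xi>))))"

lemma step_meas: "step \<in> base_space S \<rightarrow>\<^sub>M prob_algebra (sample_space S)"
  unfolding step_def case_prod_beta
proof (rule measurable_bind_prob_space2)
  show "(\<lambda>p. policy S (fst p, imputed S (fst p) (fst (snd p)) (snd (snd p)))) \<in> base_space S \<rightarrow>\<^sub>M prob_algebra (act_space S)"
    using imputed_meas
    by (intro measurable_compose[OF measurable_Pair policy_meas]) (auto simp: base_space_def)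
  have *: "(\<lambda>q. (fst (fst q), fst (snd (fst q)), snd (snd (fst q)), snd q))
     \<in> base_space S \<Otimes>\<^sub>M act_space S \<rightarrow>\<^sub>M ctx_space S \<Otimes>\<^sub>M cov_space S \<Otimes>\<^sub>M count_space UNIV \<Otimes>\<^sub>M act_space S"
    unfolding base_space_def by measurable
  show "(\<lambda>(p, a). noise S (fst p, fst (snd p), snd (snd p), a) \<bind>
      (\<lambda>\<xi>. return (sample_space S) (fst p, fst (snd p), snd (snd p), a, \<xi>)))
     \<in> base_space S \<Otimes>\<^sub>M act_space S \<rightarrow>\<^sub>M prob_algebra (sample_space S)"
    using measurable_compose[OF * kernel_meas] by (simp add: case_prod_beta)
qed

lemma sample_law_bind: "M = law S \<bind> step"
  by (simp add: sample_law_def step_def)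

lemma law_prob: "prob_space (law S)" and sets_law [measurable_cong]: "sets (law S) = sets (base_space S)"
  using law_space by (auto simp: space_prob_algebra)

lemma M_space: "M \<in> space (prob_algebra (sample_space S))"
proof -
  have "(\<lambda>_. law S \<bind> step) \<in> count_space UNIV \<rightarrow>\<^sub>M prob_algebra (sample_space S)"
    using law_space step_meas by (intro measurable_bind_prob_space[where M = "count_space UNIV"]) (auto intro: measurable_const)
  from measurable_space[OF this, of undefined] show ?thesis by (simp add: sample_law_bind)
qed

lemma M_prob: "prob_space M" and sets_M [measurable_cong]: "sets M = sets (sample_space S)"
  using M_space by (auto simp: space_prob_algebra)

lemma space_M: "space M = contexts S \<times> covariates S \<times> UNIV \<times> actions S \<times> UNIV"
  using sets_eq_imp_space_eq[OF sets_M] by (simp add: space_sample)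

abbreviation "pol x z b \<equiv> policy S (x, imputed S x z b)"
abbreviation "noi x z b a \<equiv> noise S (x, z, b, a)"

lemma policy_at:
  assumes "x \<in> contexts S" "z \<in> covariates S"
  shows "prob_space (policy S (x, z))" "sets (policy S (x, z)) = Pow (actions S)" "space (policy S (x, z)) = actions S"
proof -
  have "policy S (x, z) \<in> space (prob_algebra (act_space S))"
    using measurable_space[OF policy_meas, of "(x, z)"] assms by (simp add: space_pair_measure space_ctx space_cov)
  then show "prob_space (policy S (x, z))" and *: "sets (policy S (x, z)) = Pow (actions S)"
    by (auto simp: space_prob_algebra act_space_def)
  show "space (policy S (x, z)) = actions S"
    using sets_eq_imp_space_eq[of "policy S (x, z)" "count_space (actions S)"] * by simp
qed

lemma noise_at:
  assumes "x \<in> contexts S" "z \<in> covariates S" "a \<in> actions S"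
  shows "prob_space (noi x z b a)" "sets (noi x z b a) = sets borel"
  using measurable_space[OF noise_meas, of "(x, z, b, a)"] assms
  by (auto simp: space_pair_measure space_ctx space_cov space_act space_prob_algebra)

text \<open>Stated for nonnegative integrals, which pass through \<open>bind\<close> without
  integrability conditions. Signed integrands are reduced to this case by adding constants.\<close>

lemma nn_integral_sample:
  assumes [measurable]: "f \<in> borel_measurable (sample_space S)"
  shows "(\<integral>\<^sup>+w. f w \<partial>M) = (\<integral>\<^sup>+p. (case p of (x, z, b) \<Rightarrow>
    \<integral>\<^sup>+a. \<integral>\<^sup>+\<xi>. f (x, z, b, a, \<xi>) \<partial>noi x z b a \<partial>pol x z b) \<partial>law S)"
proof -
  have step': "step \<in> law S \<rightarrow>\<^sub>M subprob_algebra (sample_space S)"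
    using measurable_prob_algebraD[OF step_meas] by measurable
  have "(\<integral>\<^sup>+w. f w \<partial>M) = (\<integral>\<^sup>+p. \<integral>\<^sup>+w. f w \<partial>step p \<partial>law S)"
    unfolding sample_law_bind by (rule nn_integral_bind[OF assms step'])
  also have "\<dots> = (\<integral>\<^sup>+p. (case p of (x, z, b) \<Rightarrow>
    \<integral>\<^sup>+a. \<integral>\<^sup>+\<xi>. f (x, z, b, a, \<xi>) \<partial>noi x z b a \<partial>pol x z b) \<partial>law S)"
  proof (rule nn_integral_cong)
    fix p assume "p \<in> space (law S)"
    then obtain x z b where p: "p = (x, z, b)" and xz: "x \<in> contexts S" "z \<in> covariates S"
      using sets_eq_imp_space_eq[OF sets_law] by (auto simp: space_base)
    let ?\<pi> = "pol x z b"
    note po = policy_at[OF xz(1) imputed_in[OF xz, of b]]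
    have Psub: "(\<lambda>a. noi x z b a \<bind> (\<lambda>\<xi>. return (sample_space S) (x, z, b, a, \<xi>)))
        \<in> ?\<pi> \<rightarrow>\<^sub>M subprob_algebra (sample_space S)"
    proof -
      have "(\<lambda>a. (x, z, b, a)) \<in> act_space S \<rightarrow>\<^sub>M ctx_space S \<Otimes>\<^sub>M cov_space S \<Otimes>\<^sub>M count_space UNIV \<Otimes>\<^sub>M act_space S"
        using xz by (intro measurable_Pair measurable_const measurable_ident) (auto simp: space_ctx space_cov)
      from measurable_compose[OF this measurable_prob_algebraD[OF kernel_meas]]
      show ?thesis
        using po(2) by (subst measurable_cong_sets[of _ "act_space S"]) (auto simp: act_space_def)
    qed
    have "(\<integral>\<^sup>+w. f w \<partial>step p) = (\<integral>\<^sup>+a. \<integral>\<^sup>+w. f w \<partial>(noi x z b a \<bind> (\<lambda>\<xi>. return (sample_space S) (x, z, b, a, \<xi>))) \<partial>?\<pi>)"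
      unfolding step_def p prod.case by (rule nn_integral_bind[OF assms Psub])
    also have "\<dots> = (\<integral>\<^sup>+a. \<integral>\<^sup>+\<xi>. f (x, z, b, a, \<xi>) \<partial>noi x z b a \<partial>?\<pi>)"
    proof (rule nn_integral_cong)
      fix a assume "a \<in> space ?\<pi>"
      then have a: "a \<in> actions S" using po by simp
      let ?n = "noi x z b a"
      note no = noise_at[OF xz a, of b]
      have m: "(\<lambda>\<xi>. (x, z, b, a, \<xi>)) \<in> ?n \<rightarrow>\<^sub>M sample_space S"
      proof -
        have "(\<lambda>\<xi>. (x, z, b, a, \<xi>)) \<in> borel \<rightarrow>\<^sub>M sample_space S"
          unfolding sample_space_def using xz a
          by (intro measurable_Pair measurable_const measurable_ident) (auto simp: space_ctx space_cov space_act)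
        then show ?thesis using no(2) by (subst measurable_cong_sets[of _ borel]) auto
      qed
      have "(\<integral>\<^sup>+w. f w \<partial>(?n \<bind> (\<lambda>\<xi>. return (sample_space S) (x, z, b, a, \<xi>))))
        = (\<integral>\<^sup>+\<xi>. \<integral>\<^sup>+w. f w \<partial>return (sample_space S) (x, z, b, a, \<xi>) \<partial>?n)"
        by (rule nn_integral_bind[OF assms measurable_compose[OF m return_measurable]])
      also have "\<dots> = (\<integral>\<^sup>+\<xi>. f (x, z, b, a, \<xi>) \<partial>?n)"
        using measurable_space[OF m] by (intro nn_integral_cong nn_integral_return) auto
      finally show "(\<integral>\<^sup>+w. f w \<partial>(?n \<bind> (\<lambda>\<xi>. return (sample_space S) (x, z, b, a, \<xi>))))
        = (\<integral>\<^sup>+\<xi>. f (x, z, b, a, \<xi>) \<partial>?n)" .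
    qed
    finally show "(\<integral>\<^sup>+w. f w \<partial>step p) = (case p of (x, z, b) \<Rightarrow>
      \<integral>\<^sup>+a. \<integral>\<^sup>+\<xi>. f (x, z, b, a, \<xi>) \<partial>noi x z b a \<partial>pol x z b)" by (simp add: p)
  qed
  finally show ?thesis .
qed

section \<open>The noise as a bounded centred weight\<close>

definition noise_of :: "sample \<Rightarrow> real" where
  "noise_of = (\<lambda>(x, z, b, a, \<xi>). \<xi>)"

text \<open>The noise is bounded by \<lambda> only almost surely, whereas
  \<open>weighted_process\<close> asks for a bound at every point. Clipping alters the scaled noise
  on a null set only.\<close>

definition clipped :: "sample \<Rightarrow> real" where
  "clipped w = max (-1) (min 1 (noise_of w / lam))"

definition forget_noise :: "sample \<Rightarrow> sample" where
  "forget_noise = (\<lambda>(x, z, b, a, \<xi>). (x, z, b, a, 0))"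

lemma noise_of_meas [measurable]: "noise_of \<in> borel_measurable (sample_space S)"
  unfolding noise_of_def sample_space_def by measurable

lemma clipped_meas [measurable]: "clipped \<in> borel_measurable (sample_space S)"
  unfolding clipped_def by measurable

lemma clipped_bound: "\<bar>clipped w\<bar> \<le> 1"
  by (auto simp: clipped_def)

lemma clipped_eq: "\<bar>noise_of w\<bar> \<le> lam \<Longrightarrow> lam * clipped w = noise_of w"
proof -
  assume "\<bar>noise_of w\<bar> \<le> lam"
  then have "noise_of w / lam \<le> 1" "- 1 \<le> noise_of w / lam"
    using lam_pos by (auto simp: field_simps)
  then show ?thesis using lam_pos by (simp add: clipped_def)
qed

lemma AE_noise_bound: "AE w in M. \<bar>noise_of w\<bar> \<le> lam"
proof -
  have "(\<integral>\<^sup>+w. indicator {w. \<not> \<bar>noise_of w\<bar> \<le> lam} w \<partial>M) = (\<integral>\<^sup>+w. (if \<bar>noise_of w\<bar> \<le> lam then 0 else 1) \<partial>M)"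
    by (intro nn_integral_cong) (auto split: split_indicator)
  also have "\<dots> = (\<integral>\<^sup>+p. (case p of (x, z, b) \<Rightarrow>
    \<integral>\<^sup>+a. \<integral>\<^sup>+\<xi>. (if \<bar>\<xi>\<bar> \<le> lam then 0 else 1) \<partial>noi x z b a \<partial>pol x z b) \<partial>law S)"
    by (subst nn_integral_sample, measurable) (simp add: noise_of_def)
  also have "\<dots> = (\<integral>\<^sup>+p. 0 \<partial>law S)"
  proof (rule nn_integral_cong)
    fix p assume "p \<in> space (law S)"
    then obtain x z b where p: "p = (x, z, b)" and xz: "x \<in> contexts S" "z \<in> covariates S"
      using sets_eq_imp_space_eq[OF sets_law] by (auto simp: space_base)
    have "(\<integral>\<^sup>+a. \<integral>\<^sup>+\<xi>. (if \<bar>\<xi>\<bar> \<le> lam then 0 else 1) \<partial>noi x z b a \<partial>pol x z b)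
      = (\<integral>\<^sup>+a. 0 \<partial>pol x z b)"
    proof (rule nn_integral_cong)
      fix a assume "a \<in> space (pol x z b)"
      then have a: "a \<in> actions S" using policy_at[OF xz(1) imputed_in[OF xz]] by simp
      from noise_bounded[OF xz a, of b]
      have "(\<integral>\<^sup>+\<xi>. (if \<bar>\<xi>\<bar> \<le> lam then 0 else 1) \<partial>noi x z b a) = (\<integral>\<^sup>+\<xi>. 0 \<partial>noi x z b a)"
      proof (intro nn_integral_cong_AE, eventually_elim)
        case (elim \<xi>)
        then show ?case by (simp add: abs_le_iff)
      qed
      then show "(\<integral>\<^sup>+\<xi>. (if \<bar>\<xi>\<bar> \<le> lam then 0 else 1) \<partial>noi x z b a) = 0" by simp
    qed
    then show "(case p of (x, z, b) \<Rightarrow> \<integral>\<^sup>+a. \<integral>\<^sup>+\<xi>. (if \<bar>\<xi>\<bar> \<le> lam then 0 else 1) \<partial>noi x z b a \<partial>pol x z b) = 0"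
      by (simp add: p)
  qed
  finally have "(\<integral>\<^sup>+w. indicator {w. \<not> \<bar>noise_of w\<bar> \<le> lam} w \<partial>M) = 0" by simp
  then show ?thesis by (subst AE_iff_nn_integral) auto
qed

text \<open>Almost surely the clipped value is \<xi> / \<lambda>, so its conditional mean is 0.
  Adding 1 makes it nonnegative, as \<open>nn_integral_sample\<close> demands.\<close>

lemma clipped_integral:
  assumes "x \<in> contexts S" "z \<in> covariates S" "a \<in> actions S"
  shows "(\<integral>\<^sup>+\<xi>. ennreal (1 + clipped (x, z, b, a, \<xi>)) \<partial>noi x z b a) = 1"
proof -
  interpret n: prob_space "noi x z b a" by (rule noise_at[OF assms])
  note [measurable_cong] = noise_at(2)[OF assms, of b]
  have m: "(\<lambda>\<xi>. clipped (x, z, b, a, \<xi>)) \<in> borel_measurable (noi x z b a)"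
    unfolding clipped_def noise_of_def by simp
  have i: "integrable (noi x z b a) (\<lambda>\<xi>. clipped (x, z, b, a, \<xi>))"
    using clipped_bound m by (intro n.integrable_const_bound[of _ 1]) auto
  have "(\<integral>\<xi>. clipped (x, z, b, a, \<xi>) \<partial>noi x z b a) = (\<integral>\<xi>. \<xi> / lam \<partial>noi x z b a)"
  proof (rule integral_cong_AE[OF m])
    show "AE \<xi> in noi x z b a. clipped (x, z, b, a, \<xi>) = \<xi> / lam"
      using noise_bounded[OF assms, of b]
    proof eventually_elim
      case (elim \<xi>)
      then show ?case using clipped_eq[of "(x, z, b, a, \<xi>)"] lam_pos
        by (auto simp: noise_of_def field_simps abs_le_iff)
    qed
  qed simp
  also have "\<dots> = 0" using noise_centred[OF assms, of b] by simp
  finally have 0: "(\<integral>\<xi>. clipped (x, z, b, a, \<xi>) \<partial>noi x z b a) = 0" .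
  have "0 \<le> 1 + clipped w" for w using clipped_bound[of w] by linarith
  then have "(\<integral>\<^sup>+\<xi>. ennreal (1 + clipped (x, z, b, a, \<xi>)) \<partial>noi x z b a)
      = ennreal (\<integral>\<xi>. 1 + clipped (x, z, b, a, \<xi>) \<partial>noi x z b a)"
    using i by (intro nn_integral_eq_integral) auto
  also have "\<dots> = 1" using i 0 by (simp add: n.prob_space)
  finally show ?thesis .
qed

text \<open>If k ignores the noise and is nonnegative, the factor 1 + \<open>clipped\<close>
  integrates to 1 over the noise and disappears. Comparing k = g + B with k = 1 isolates the
  integral of g times the clipped noise.\<close>

lemma clipped_centred:
  fixes g :: "sample \<Rightarrow> real"
  assumes g [measurable]: "g \<in> borel_measurable M"
    and bd: "\<And>w. w \<in> space M \<Longrightarrow> \<bar>g w\<bar> \<le> B"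
    and inv: "\<And>w. w \<in> space M \<Longrightarrow> g (forget_noise w) = g w"
  shows "(\<integral>w. g w * clipped w \<partial>M) = 0"
proof -
  interpret prob_space M by (rule M_prob)
  have gm [measurable]: "g \<in> borel_measurable (sample_space S)"
    using g measurable_cong_sets[OF sets_M refl] by blast
  have cm [measurable]: "clipped \<in> borel_measurable M"
    using clipped_meas measurable_cong_sets[OF sets_M refl] by blast
  let ?h = "\<lambda>w. g w + B"
  have h0: "0 \<le> ?h w" if "w \<in> space M" for w using bd[OF that] by linarith
  have int: "integrable M g" "integrable M (\<lambda>w. g w * clipped w)" "integrable M clipped"
  proof -
    show "integrable M g" using bd by (intro integrable_const_bound[of _ B] AE_I2) auto
    show "integrable M clipped" using clipped_bound by (intro integrable_const_bound[of _ 1] AE_I2) auto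
    have "norm (g w * clipped w) \<le> B * 1" if "w \<in> space M" for w
      unfolding real_norm_def abs_mult using bd[OF that] clipped_bound[of w] by (intro mult_mono) auto
    then show "integrable M (\<lambda>w. g w * clipped w)" by (intro integrable_const_bound[of _ "B * 1"] AE_I2) auto
  qed
  have tilt: "(\<integral>w. k w * (1 + clipped w) \<partial>M) = (\<integral>w. k w \<partial>M)"
    if k: "k \<in> borel_measurable (sample_space S)" "\<And>w. w \<in> space M \<Longrightarrow> 0 \<le> k w"
      "\<And>w. w \<in> space M \<Longrightarrow> k (forget_noise w) = k w"
      "integrable M k" "integrable M (\<lambda>w. k w * (1 + clipped w))" for k
  proof -
    note [measurable] = k(1)
    have c0: "0 \<le> 1 + clipped w" for w using clipped_bound[of w] by linarith
    have "(\<integral>\<^sup>+w. ennreal (k w * (1 + clipped w)) \<partial>M) = (\<integral>\<^sup>+w. ennreal (k w) \<partial>M)"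
    proof (subst (1 2) nn_integral_sample, measurable, rule nn_integral_cong)
      fix p assume "p \<in> space (law S)"
      then obtain x z b where p: "p = (x, z, b)" and xz: "x \<in> contexts S" "z \<in> covariates S"
        using sets_eq_imp_space_eq[OF sets_law] by (auto simp: space_base)
      have "(\<integral>\<^sup>+a. \<integral>\<^sup>+\<xi>. ennreal (k (x, z, b, a, \<xi>) * (1 + clipped (x, z, b, a, \<xi>))) \<partial>noi x z b a \<partial>pol x z b)
        = (\<integral>\<^sup>+a. \<integral>\<^sup>+\<xi>. ennreal (k (x, z, b, a, \<xi>)) \<partial>noi x z b a \<partial>pol x z b)"
      proof (rule nn_integral_cong)
        fix a assume "a \<in> space (pol x z b)"
        then have a: "a \<in> actions S" using policy_at[OF xz(1) imputed_in[OF xz]] by simp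
        interpret n: prob_space "noi x z b a" by (rule noise_at[OF xz a])
        note [measurable_cong] = noise_at(2)[OF xz a, of b]
        define k0 where "k0 = k (x, z, b, a, 0)"
        have keq: "k (x, z, b, a, \<xi>) = k0" for \<xi>
          using k(3)[of "(x, z, b, a, \<xi>)"] xz a by (simp add: space_M forget_noise_def k0_def)
        have m: "(\<lambda>\<xi>. clipped (x, z, b, a, \<xi>)) \<in> borel_measurable (noi x z b a)"
          unfolding clipped_def noise_of_def by simp
        have "0 \<le> k0" using k(2) xz a by (simp add: space_M k0_def)
        then have "(\<integral>\<^sup>+\<xi>. ennreal (k (x, z, b, a, \<xi>) * (1 + clipped (x, z, b, a, \<xi>))) \<partial>noi x z b a)
          = ennreal k0 * (\<integral>\<^sup>+\<xi>. ennreal (1 + clipped (x, z, b, a, \<xi>)) \<partial>noi x z b a)"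
          unfolding keq using m c0 by (subst nn_integral_cmult[symmetric]) (auto simp: ennreal_mult)
        also have "\<dots> = (\<integral>\<^sup>+\<xi>. ennreal (k (x, z, b, a, \<xi>)) \<partial>noi x z b a)"
          unfolding keq clipped_integral[OF xz a] by (simp add: n.emeasure_space_1)
        finally show "(\<integral>\<^sup>+\<xi>. ennreal (k (x, z, b, a, \<xi>) * (1 + clipped (x, z, b, a, \<xi>))) \<partial>noi x z b a)
          = (\<integral>\<^sup>+\<xi>. ennreal (k (x, z, b, a, \<xi>)) \<partial>noi x z b a)" .
      qed
      then show "(case p of (x, z, b) \<Rightarrow> \<integral>\<^sup>+a. \<integral>\<^sup>+\<xi>. ennreal (k (x, z, b, a, \<xi>) * (1 + clipped (x, z, b, a, \<xi>))) \<partial>noi x z b a \<partial>pol x z b)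
        = (case p of (x, z, b) \<Rightarrow> \<integral>\<^sup>+a. \<integral>\<^sup>+\<xi>. ennreal (k (x, z, b, a, \<xi>)) \<partial>noi x z b a \<partial>pol x z b)"
        by (simp add: p)
    qed
    moreover have "(\<integral>\<^sup>+w. ennreal (k w * (1 + clipped w)) \<partial>M) = ennreal (\<integral>w. k w * (1 + clipped w) \<partial>M)"
      using k c0 by (intro nn_integral_eq_integral AE_I2) auto
    moreover have "(\<integral>\<^sup>+w. ennreal (k w) \<partial>M) = ennreal (\<integral>w. k w \<partial>M)"
      using k by (intro nn_integral_eq_integral AE_I2) auto
    moreover have "0 \<le> (\<integral>w. k w * (1 + clipped w) \<partial>M)" "0 \<le> (\<integral>w. k w \<partial>M)"
      using k c0 by (auto intro!: integral_nonneg_AE AE_I2)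
    ultimately show ?thesis by simp
  qed
  have eq: "?h w * (1 + clipped w) = g w + B + g w * clipped w + B * clipped w" for w
    by (simp add: algebra_simps)
  have "(\<integral>w. ?h w * (1 + clipped w) \<partial>M) = (\<integral>w. ?h w \<partial>M)"
    using int h0 inv by (intro tilt) (auto simp: eq)
  then have 1: "(\<integral>w. g w * clipped w \<partial>M) + B * (\<integral>w. clipped w \<partial>M) = 0"
    unfolding eq using int by (simp add: prob_space)
  have "(\<integral>w. 1 * (1 + clipped w) \<partial>M) = (\<integral>w. 1 \<partial>M)"
    using int by (intro tilt) auto
  then have "(\<integral>w. clipped w \<partial>M) = 0" using int by (simp add: prob_space)
  then show ?thesis using 1 by simp
qed

end

section \<open>Reward classes\<close>

lemma space_sign_law: "space (sign_law N) = signs {..<N}"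
  by (simp add: sign_law_def signs_def space_PiM space_uniform_count_measure)

lemma prob_space_sign_law: "prob_space (sign_law N)"
  unfolding sign_law_def by (intro prob_space_PiM prob_space_uniform_count_measure) auto

lemma integral_sign_law:
  fixes f :: "_ \<Rightarrow> real"
  shows "(\<integral>\<epsilon>. f \<epsilon> \<partial>sign_law N) = (\<Sum>\<epsilon>\<in>signs {..<N}. f \<epsilon>) / 2 ^ N"
proof -
  interpret prob_space "sign_law N" by (rule prob_space_sign_law)
  interpret pr: product_prob_space "\<lambda>_. uniform_count_measure {-1, 1 :: real}"
    by (intro product_prob_spaceI prob_space_uniform_count_measure) auto
  have single: "{\<epsilon>} = (\<Pi>\<^sub>E i\<in>{..<N}. {\<epsilon> i})" if "\<epsilon> \<in> signs {..<N}" for \<epsilon> :: "nat \<Rightarrow> real"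
    using PiE_singleton[of \<epsilon> "{..<N}"] that by (simp add: signs_def PiE_iff)
  have sets: "{\<epsilon>} \<in> sets (sign_law N)" if "\<epsilon> \<in> signs {..<N}" for \<epsilon>
    unfolding single[OF that] sign_law_def using that
    by (intro sets_PiM_I_finite) (auto simp: sets_uniform_count_measure signs_def PiE_iff)
  have "emeasure (sign_law N) {\<epsilon>} = ennreal (1 / 2 ^ N)" if e: "\<epsilon> \<in> signs {..<N}" for \<epsilon>
  proof -
    have "emeasure (uniform_count_measure {-1, 1 :: real}) {\<epsilon> i} = ennreal (1 / 2)" if "i < N" for i
      using signs_cases[OF e, of i] that by (auto simp: emeasure_uniform_count_measure numeral_2_eq_2)
    then have "emeasure (sign_law N) (\<Pi>\<^sub>E i\<in>{..<N}. {\<epsilon> i}) = (\<Prod>i<N. ennreal (1 / 2))"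
      unfolding sign_law_def using e
      by (subst pr.emeasure_PiM) (auto simp: sets_uniform_count_measure signs_def PiE_iff)
    also have "\<dots> = ennreal ((1 / 2) ^ N)" by (simp only: prod_constant card_lessThan ennreal_power)
    finally show ?thesis using single[OF e] by (simp only: power_one_over)
  qed
  then have m: "prob {\<epsilon>} = 1 / 2 ^ N" if "\<epsilon> \<in> signs {..<N}" for \<epsilon>
    using that by (simp add: measure_def)
  have "(\<integral>\<epsilon>. f \<epsilon> \<partial>sign_law N) = (\<integral>\<epsilon>. (\<Sum>\<eta>\<in>signs {..<N}. f \<eta> * indicator {\<eta>} \<epsilon>) \<partial>sign_law N)"
  proof (rule Bochner_Integration.integral_cong[OF refl])
    fix \<epsilon> assume "\<epsilon> \<in> space (sign_law N)"
    then have "\<epsilon> \<in> signs {..<N}" by (simp add: space_sign_law)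
    moreover have "f \<eta> * indicator {\<eta>} \<epsilon> = (if \<eta> = \<epsilon> then f \<eta> else 0)" for \<eta>
      by (simp add: indicator_def)
    ultimately show "f \<epsilon> = (\<Sum>\<eta>\<in>signs {..<N}. f \<eta> * indicator {\<eta>} \<epsilon>)"
      by (simp only: sum.delta finite_signs finite_lessThan if_True)
  qed
  also have "\<dots> = (\<Sum>\<eta>\<in>signs {..<N}. f \<eta> * prob {\<eta>})"
    using sets by (subst Bochner_Integration.integral_sum) (auto simp: less_top[symmetric] intro!: sum.cong)
  also have "\<dots> = (\<Sum>\<epsilon>\<in>signs {..<N}. f \<epsilon>) / 2 ^ N"
    by (simp add: m sum_divide_distrib)
  finally show ?thesis .
qed

context valid
begin

definition deviations :: "real \<Rightarrow> (sample \<Rightarrow> real) set" where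
  "deviations t = (\<lambda>f w. f (observed S w) - fs (observed S w)) ` {f \<in> reward_class S. l2dist S f fs \<le> t}"

definition err :: "sample \<Rightarrow> real" where
  "err w = (case w of (x, z, b, a, \<xi>) \<Rightarrow> fs (x, z, a)) - fs (observed S w)"

lemma observed_meas [measurable]:
  "observed S \<in> sample_space S \<rightarrow>\<^sub>M ctx_space S \<Otimes>\<^sub>M cov_space S \<Otimes>\<^sub>M act_space S"
  unfolding observed_def imputed_def sample_space_def case_prod_beta by measurable

lemma observed_space:
  "w \<in> space M \<Longrightarrow> observed S w \<in> contexts S \<times> covariates S \<times> actions S"
  using imputed_in by (auto simp: space_M observed_def)

lemma reward_observed:
  "f \<in> reward_class S \<Longrightarrow> w \<in> space M \<Longrightarrow> f (observed S w) \<in> {0..1}"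
  using observed_space[of w] reward_range[of f] by (cases "observed S w") auto

lemma reward_observed_meas: "f \<in> reward_class S \<Longrightarrow> (\<lambda>w. f (observed S w)) \<in> borel_measurable (sample_space S)"
  by (rule measurable_compose[OF observed_meas reward_meas])

lemma dev_bound:
  "f \<in> reward_class S \<Longrightarrow> g \<in> reward_class S \<Longrightarrow> w \<in> space M \<Longrightarrow> \<bar>f (observed S w) - g (observed S w)\<bar> \<le> 1"
  using reward_observed[of f w] reward_observed[of g w] by auto

lemma dev_meas:
  assumes "f \<in> reward_class S" "g \<in> reward_class S"
  shows "(\<lambda>w. f (observed S w) - g (observed S w)) \<in> borel_measurable M"
proof -
  have "(\<lambda>w. f (observed S w) - g (observed S w)) \<in> borel_measurable (sample_space S)"
    using assms by (intro borel_measurable_diff reward_observed_meas)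
  then show ?thesis using measurable_cong_sets[OF sets_M refl] by blast
qed

lemma l2dist_sq: "(l2dist S f g)\<^sup>2 = (\<integral>w. (f (observed S w) - g (observed S w))\<^sup>2 \<partial>M)"
  unfolding l2dist_def l2norm_def by (intro real_sqrt_pow2 integral_nonneg_AE) auto

lemma l2dist_nonneg: "0 \<le> l2dist S f g"
  unfolding l2dist_def l2norm_def by (intro real_sqrt_ge_zero integral_nonneg_AE) auto

lemma l2dist_le_1:
  assumes "f \<in> reward_class S" "g \<in> reward_class S"
  shows "l2dist S f g \<le> 1"
proof -
  interpret prob_space M by (rule M_prob)
  note [measurable] = dev_meas[OF assms]
  have b: "(f (observed S w) - g (observed S w))\<^sup>2 \<le> 1" if "w \<in> space M" for w
    using dev_bound[OF assms that] by (simp add: abs_square_le_1)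
  have "(\<integral>w. (f (observed S w) - g (observed S w))\<^sup>2 \<partial>M) \<le> 1"
    using b by (intro integral_le_const integrable_const_bound[of _ 1] AE_I2) auto
  then have "(l2dist S f g)\<^sup>2 \<le> 1\<^sup>2" by (simp add: l2dist_sq)
  then show ?thesis by (rule power2_le_imp_le) simp
qed

lemma l2dist_convex_comb:
  assumes "0 \<le> u"
  shows "l2dist S (\<lambda>p. (1 - u) * g p + u * f p) g = u * l2dist S f g"
proof -
  have "((1 - u) * g p + u * f p - g p)\<^sup>2 = u\<^sup>2 * (f p - g p)\<^sup>2" for p
    by (simp add: power_mult_distrib[symmetric] algebra_simps)
  then show ?thesis
    using assms by (simp add: l2dist_def l2norm_def real_sqrt_mult)
qed

lemma data_law_eq: "data_law S N = (\<Pi>\<^sub>M i\<in>{..<N}. M)"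
  by (simp add: data_law_def)

lemma SUP_deviations:
  "(SUP h\<in>deviations t. (1 / real N) * (\<Sum>i<N. \<epsilon> i * h (D i))) = local_sup S N t (\<epsilon>, D)"
  unfolding local_sup_def deviations_def by (simp add: image_image)

lemma process:
  assumes "1 \<le> N" "0 < t" "rademacher_defined S N"
  shows "weighted_process M N (deviations t) t clipped forget_noise"
proof -
  interpret prob_space M by (rule M_prob)
  show ?thesis
  proof (intro weighted_process.intro weighted_process_axioms.intro bounded_process.intro bounded_process_axioms.intro)
    show "prob_space M" by unfold_locales
    show "0 < N" using assms by simp
    show "h \<in> borel_measurable M" if "h \<in> deviations t" for h
      using that dev_meas fs_class by (auto simp: deviations_def)
    show "\<bar>h w\<bar> \<le> 1" if "h \<in> deviations t" "w \<in> space M" for h w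
      using that dev_bound[OF _ fs_class that(2)] unfolding deviations_def by blast
    have "l2dist S fs fs \<le> t" using assms by (simp add: l2dist_def l2norm_def)
    then show "(\<lambda>_. 0) \<in> deviations t"
      using fs_class by (auto simp: deviations_def intro!: image_eqI[of _ _ fs])
    show "(\<integral>w. (h w)\<^sup>2 \<partial>M) \<le> t\<^sup>2" if "h \<in> deviations t" for h
    proof -
      obtain f where f: "h = (\<lambda>w. f (observed S w) - fs (observed S w))" "l2dist S f fs \<le> t"
        using \<open>h \<in> deviations t\<close> by (auto simp: deviations_def)
      have "(l2dist S f fs)\<^sup>2 \<le> t\<^sup>2" using f(2) l2dist_nonneg by (rule power_mono)
      then show ?thesis by (simp only: l2dist_sq f(1))
    qed
    show "(\<lambda>D. SUP h\<in>deviations t. (1 / real N) * (\<Sum>i<N. \<epsilon> i * h (D i))) \<in> borel_measurable (\<Pi>\<^sub>M i\<in>{..<N}. M)"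
      if "\<epsilon> \<in> signs {..<N}" for \<epsilon>
    proof -
      \<comment> \<open>Joint measurability in signs and data is used through its sections at fixed
        sign vectors.\<close>
      have "local_sup S N t \<in> borel_measurable (sign_law N \<Otimes>\<^sub>M data_law S N)"
        using assms by (auto simp: rademacher_defined_def)
      then show ?thesis unfolding SUP_deviations
        using that by (intro measurable_Pair2[of "local_sup S N t" "sign_law N"]) (auto simp: data_law_eq space_sign_law)
    qed
    show "clipped \<in> borel_measurable M"
      using clipped_meas measurable_cong_sets[OF sets_M refl] by blast
    show "\<bar>clipped w\<bar> \<le> 1" for w by (rule clipped_bound)
    show "forget_noise w \<in> space M" if "w \<in> space M" for w
      using that by (auto simp: space_M forget_noise_def)
    show "h (forget_noise w) = h w" if "h \<in> deviations t" for h w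
      using that by (cases w) (auto simp: deviations_def forget_noise_def observed_def)
    show "(\<integral>w. g w * clipped w \<partial>M) = 0"
      if "g \<in> borel_measurable M" "\<And>w. w \<in> space M \<Longrightarrow> \<bar>g w\<bar> \<le> B"
        "\<And>w. w \<in> space M \<Longrightarrow> g (forget_noise w) = g w" for g B
      by (rule clipped_centred[OF that])
  qed
qed

lemma rademacher_eq:
  assumes "1 \<le> N" "0 < t" "rademacher_defined S N"
  shows "rademacher S N t = (\<Sum>\<epsilon>\<in>signs {..<N}. \<integral>D. local_sup S N t (\<epsilon>, D) \<partial>data_law S N) / 2 ^ N"
proof -
  interpret wp: weighted_process M N "deviations t" t clipped forget_noise by (rule process[OF assms])
  have W: "wp.W \<epsilon> D = local_sup S N t (\<epsilon>, D)" for \<epsilon> D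
    by (simp only: wp.W_def SUP_deviations)
  interpret sg: prob_space "sign_law N" by (rule prob_space_sign_law)
  interpret pp: pair_prob_space "sign_law N" "data_law S N"
    unfolding data_law_eq ..
  have [measurable]: "local_sup S N t \<in> borel_measurable (sign_law N \<Otimes>\<^sub>M data_law S N)"
    using assms by (auto simp: rademacher_defined_def)
  have "integrable (sign_law N \<Otimes>\<^sub>M data_law S N) (local_sup S N t)"
  proof (intro pp.integrable_const_bound[of _ 1] AE_I2)
    fix z assume "z \<in> space (sign_law N \<Otimes>\<^sub>M data_law S N)"
    then obtain \<epsilon> D where z: "z = (\<epsilon>, D)" "\<epsilon> \<in> signs {..<N}" "D \<in> space (\<Pi>\<^sub>M i\<in>{..<N}. M)"
      by (auto simp: space_pair_measure space_sign_law data_law_eq)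
    then show "norm (local_sup S N t z) \<le> 1"
      using wp.W_nonneg[of \<epsilon> D] wp.W_le_1[of \<epsilon> D] by (simp add: W)
  qed simp
  then have "rademacher S N t = (\<integral>\<epsilon>. \<integral>D. local_sup S N t (\<epsilon>, D) \<partial>data_law S N \<partial>sign_law N)"
    unfolding rademacher_def by (rule pp.integral_fst'[symmetric])
  then show ?thesis by (simp add: integral_sign_law)
qed

text \<open>By convexity the class is star-shaped around the true reward: shrinking towards it by r
  / t maps the ball of radius t into that of radius r and scales all linear sums by r / t. So the
  complexity divided by the radius does not increase, and the critical inequality at r controls
  larger radii.\<close>

lemma rademacher_scale:
  assumes "1 \<le> N" "0 < r" "r \<le> t" "rademacher_defined S N"
  shows "rademacher S N t \<le> t / r * rademacher S N r"
proof -
  have t: "0 < t" using assms by simp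
  interpret wt: weighted_process M N "deviations t" t clipped forget_noise by (rule process[OF assms(1) t assms(4)])
  interpret wr: weighted_process M N "deviations r" r clipped forget_noise by (rule process[OF assms(1,2,4)])
  have W: "wt.W \<epsilon> D = local_sup S N t (\<epsilon>, D)" "wr.W \<epsilon> D = local_sup S N r (\<epsilon>, D)" for \<epsilon> D
    by (simp_all only: wt.W_def wr.W_def SUP_deviations)
  have le: "wt.W \<epsilon> D \<le> t / r * wr.W \<epsilon> D" if e: "\<epsilon> \<in> signs {..<N}" and D: "D \<in> space (\<Pi>\<^sub>M i\<in>{..<N}. M)" for \<epsilon> D
    unfolding wt.W_def
  proof (rule cSUP_least[OF wt.H_ne])
    fix h assume "h \<in> deviations t"
    then obtain f where f: "f \<in> reward_class S" "l2dist S f fs \<le> t" and h: "h = (\<lambda>w. f (observed S w) - fs (observed S w))"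
      by (auto simp: deviations_def)
    let ?g = "\<lambda>p. (1 - r / t) * fs p + r / t * f p"
    have u: "0 \<le> r / t" "r / t \<le> 1" using assms t by auto
    have "?g \<in> reward_class S" using u by (intro convex_class fs_class f) auto
    moreover have "l2dist S ?g fs \<le> r"
      using mult_left_mono[OF f(2) u(1)] t unfolding l2dist_convex_comb[OF u(1)] by simp
    moreover have "(\<lambda>w. ?g (observed S w) - fs (observed S w)) = (\<lambda>w. r / t * h w)"
      by (simp add: h fun_eq_iff algebra_simps)
    ultimately have "(\<lambda>w. r / t * h w) \<in> deviations r"
      unfolding deviations_def by (intro image_eqI[of _ _ ?g]) auto
    from wr.W_upper[OF e D this]
    have "r / t * ((1 / real N) * (\<Sum>i<N. \<epsilon> i * h (D i))) \<le> wr.W \<epsilon> D"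
      by (simp add: sum_distrib_left mult_ac)
    then have "t / r * (r / t * ((1 / real N) * (\<Sum>i<N. \<epsilon> i * h (D i)))) \<le> t / r * wr.W \<epsilon> D"
      using t assms by (intro mult_left_mono) auto
    then show "(1 / real N) * (\<Sum>i<N. \<epsilon> i * h (D i)) \<le> t / r * wr.W \<epsilon> D"
      using t assms by simp
  qed
  have "(\<Sum>\<epsilon>\<in>signs {..<N}. \<integral>D. wt.W \<epsilon> D \<partial>wt.P) \<le> (\<Sum>\<epsilon>\<in>signs {..<N}. \<integral>D. t / r * wr.W \<epsilon> D \<partial>wt.P)"
    using le by (intro sum_mono integral_mono integrable_mult_right wt.W_integrable wr.W_integrable) auto
  also have "\<dots> = t / r * (\<Sum>\<epsilon>\<in>signs {..<N}. \<integral>D. wr.W \<epsilon> D \<partial>wt.P)"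
    by (simp add: sum_distrib_left)
  finally have "(\<Sum>\<epsilon>\<in>signs {..<N}. \<integral>D. wt.W \<epsilon> D \<partial>wt.P) / 2 ^ N \<le> t / r * (\<Sum>\<epsilon>\<in>signs {..<N}. \<integral>D. wr.W \<epsilon> D \<partial>wt.P) / 2 ^ N"
    by (rule divide_right_mono) simp
  then show ?thesis
    using assms t by (simp add: rademacher_eq W data_law_eq)
qed

section \<open>Elasticity and imputation error\<close>

lemma actions_ne: "actions S \<noteq> {}"
  using prob_space.not_empty[OF M_prob] by (auto simp: space_M)

lemma mismatch_meas:
  assumes f: "f \<in> reward_class S" and a: "a \<in> actions S"
  shows "(\<lambda>(x, z, b). (f (x, z, a) - f (x, impute S x, a))\<^sup>2) \<in> borel_measurable (law S)"
    and "\<And>x z b. (x, z, b) \<in> space (law S) \<Longrightarrow> (f (x, z, a) - f (x, impute S x, a))\<^sup>2 \<le> 1"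
proof -
  have 1: "(\<lambda>p. (fst p, fst (snd p), a)) \<in> base_space S \<rightarrow>\<^sub>M ctx_space S \<Otimes>\<^sub>M cov_space S \<Otimes>\<^sub>M act_space S"
    and 2: "(\<lambda>p. (fst p, impute S (fst p), a)) \<in> base_space S \<rightarrow>\<^sub>M ctx_space S \<Otimes>\<^sub>M cov_space S \<Otimes>\<^sub>M act_space S"
    unfolding base_space_def using a
    by (auto intro!: measurable_Pair simp: space_act)
  have "(\<lambda>(x, z, b). (f (x, z, a) - f (x, impute S x, a))\<^sup>2) \<in> borel_measurable (base_space S)"
    using measurable_compose[OF 1 reward_meas[OF f]] measurable_compose[OF 2 reward_meas[OF f]]
    unfolding case_prod_beta by simp
  then show "(\<lambda>(x, z, b). (f (x, z, a) - f (x, impute S x, a))\<^sup>2) \<in> borel_measurable (law S)"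
    using measurable_cong_sets[OF sets_law refl] by blast
  fix x z b assume "(x, z, b) \<in> space (law S)"
  then have xz: "x \<in> contexts S" "z \<in> covariates S"
    using sets_eq_imp_space_eq[OF sets_law] by (auto simp: space_base)
  have "\<bar>f (x, z, a) - f (x, impute S x, a)\<bar> \<le> 1"
    using reward_range[OF f xz a] reward_range[OF f xz(1) impute_in[OF xz(1)] a] by auto
  then show "(f (x, z, a) - f (x, impute S x, a))\<^sup>2 \<le> 1" by (simp add: abs_square_le_1)
qed

lemma mismatch_integrable:
  assumes "f \<in> reward_class S" "a \<in> actions S"
  shows "integrable (law S) (\<lambda>(x, z, b). (f (x, z, a) - f (x, impute S x, a))\<^sup>2)"
proof -
  interpret prob_space "law S" by (rule law_prob)
  show ?thesis
    using mismatch_meas[OF assms] by (intro integrable_const_bound[of _ 1] AE_I2) auto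
qed

lemma mismatch_le_1:
  assumes "f \<in> reward_class S" "a \<in> actions S"
  shows "mismatch S f a \<le> 1"
proof -
  interpret prob_space "law S" by (rule law_prob)
  show ?thesis
    unfolding mismatch_def
    using mismatch_meas[OF assms] by (intro integral_le_const mismatch_integrable assms AE_I2) auto
qed

lemma mismatch_le_elasticity:
  assumes "f \<in> reward_class S" "a \<in> actions S"
  shows "mismatch S f a \<le> elasticity S"
proof -
  have "bdd_above ((\<lambda>(f, a). mismatch S f a) ` (reward_class S \<times> actions S))"
    using mismatch_le_1 by (intro bdd_aboveI[of _ 1]) auto
  then show ?thesis
    unfolding elasticity_def using assms cSUP_upper[of "(f, a)" _ "\<lambda>(f, a). mismatch S f a"] by auto
qed

lemma upsilon_pos: "0 < upsilon S fs"
  unfolding upsilon_def using finite_actions actions_ne mismatch_pos[OF fs_class] by (subst Min_gr_iff) auto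

lemma upsilon_le_elasticity: "upsilon S fs \<le> elasticity S"
proof -
  obtain a where a: "a \<in> actions S" using actions_ne by auto
  have "upsilon S fs \<le> mismatch S fs a"
    unfolding upsilon_def using finite_actions a by (intro Min_le) auto
  then show ?thesis using mismatch_le_elasticity[OF fs_class a] by linarith
qed

lemma err_meas: "err \<in> borel_measurable (sample_space S)"
proof -
  have 1: "(\<lambda>w. (fst w, fst (snd w), fst (snd (snd (snd w))))) \<in> sample_space S \<rightarrow>\<^sub>M ctx_space S \<Otimes>\<^sub>M cov_space S \<Otimes>\<^sub>M act_space S"
    unfolding sample_space_def by measurable
  show ?thesis
    unfolding err_def case_prod_beta
    by (intro borel_measurable_diff measurable_compose[OF 1 reward_meas] reward_observed_meas fs_class)
qed

lemma err_sq: "w \<in> space M \<Longrightarrow> (err w)\<^sup>2 \<in> {0..1}"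
proof -
  assume w: "w \<in> space M"
  obtain x z b a \<xi> where *: "w = (x, z, b, a, \<xi>)" by (cases w)
  then have "x \<in> contexts S" "z \<in> covariates S" "a \<in> actions S" using w by (auto simp: space_M)
  from reward_range[OF fs_class this] reward_observed[OF fs_class w]
  have "\<bar>err w\<bar> \<le> 1" by (auto simp: err_def *)
  then show ?thesis by (simp add: abs_square_le_1)
qed

text \<open>The error vanishes if the covariate is observed. Otherwise the average over the policy
  is bounded by the sum over all actions, each of which is a mismatch of the true reward; this is
  the price for an action that depends on the context.\<close>

lemma err_mean: "(\<integral>w. (err w)\<^sup>2 \<partial>M) \<le> real (card (actions S)) * elasticity S"
proof -
  interpret prob_space M by (rule M_prob)
  interpret l: prob_space "law S" by (rule law_prob)
  note [measurable] = err_meas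
  let ?d = "\<lambda>a (x, z, b). (fs (x, z, a) - fs (x, impute S x, a))\<^sup>2"
  have E0: "0 \<le> elasticity S" using upsilon_pos upsilon_le_elasticity by linarith
  have "(\<integral>\<^sup>+w. ennreal ((err w)\<^sup>2) \<partial>M) \<le> (\<integral>\<^sup>+p. (\<Sum>a\<in>actions S. ennreal (?d a p)) \<partial>law S)"
  proof (subst nn_integral_sample, measurable, rule nn_integral_mono)
    fix p assume "p \<in> space (law S)"
    then obtain x z b where p: "p = (x, z, b)" and xz: "x \<in> contexts S" "z \<in> covariates S"
      using sets_eq_imp_space_eq[OF sets_law] by (auto simp: space_base)
    let ?m = "\<Sum>a\<in>actions S. ennreal (?d a (x, z, b))"
    interpret po: prob_space "pol x z b"
      by (rule policy_at[OF xz(1) imputed_in[OF xz]])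
    have "(\<integral>\<^sup>+a. \<integral>\<^sup>+\<xi>. ennreal ((err (x, z, b, a, \<xi>))\<^sup>2) \<partial>noi x z b a \<partial>pol x z b)
      \<le> (\<integral>\<^sup>+a. ?m \<partial>pol x z b)"
    proof (rule nn_integral_mono)
      fix a assume "a \<in> space (pol x z b)"
      then have a: "a \<in> actions S" using policy_at[OF xz(1) imputed_in[OF xz]] by simp
      interpret n: prob_space "noi x z b a" by (rule noise_at[OF xz a])
      have "(\<integral>\<^sup>+\<xi>. ennreal ((err (x, z, b, a, \<xi>))\<^sup>2) \<partial>noi x z b a) \<le> (\<integral>\<^sup>+\<xi>. ennreal (?d a (x, z, b)) \<partial>noi x z b a)"
        by (intro nn_integral_mono ennreal_leI) (auto simp: err_def observed_def imputed_def)
      also have "\<dots> = ennreal (?d a (x, z, b))" by (simp add: n.emeasure_space_1)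
      also have "\<dots> \<le> ?m" using finite_actions a by (intro member_le_sum) auto
      finally show "(\<integral>\<^sup>+\<xi>. ennreal ((err (x, z, b, a, \<xi>))\<^sup>2) \<partial>noi x z b a) \<le> ?m" .
    qed
    also have "\<dots> = ?m" by (simp add: po.emeasure_space_1)
    finally show "(case p of (x, z, b) \<Rightarrow> \<integral>\<^sup>+a. \<integral>\<^sup>+\<xi>. ennreal ((err (x, z, b, a, \<xi>))\<^sup>2) \<partial>noi x z b a \<partial>pol x z b)
      \<le> (\<Sum>a\<in>actions S. ennreal (?d a p))" by (simp add: p)
  qed
  also have "\<dots> = (\<Sum>a\<in>actions S. \<integral>\<^sup>+p. ennreal (?d a p) \<partial>law S)"
    using mismatch_meas(1)[OF fs_class] by (intro nn_integral_sum) (auto intro: measurable_compose[OF _ measurable_ennreal])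
  also have "\<dots> = (\<Sum>a\<in>actions S. ennreal (mismatch S fs a))"
    unfolding mismatch_def using mismatch_integrable[OF fs_class]
    by (intro sum.cong refl nn_integral_eq_integral AE_I2) auto
  also have "\<dots> \<le> (\<Sum>a\<in>actions S. ennreal (elasticity S))"
    by (intro sum_mono ennreal_leI mismatch_le_elasticity fs_class)
  also have "\<dots> = ennreal (real (card (actions S)) * elasticity S)"
    using E0 by (simp add: ennreal_mult ennreal_of_nat_eq_real_of_nat)
  finally have "(\<integral>\<^sup>+w. ennreal ((err w)\<^sup>2) \<partial>M) \<le> ennreal (real (card (actions S)) * elasticity S)" .
  moreover have "(\<integral>\<^sup>+w. ennreal ((err w)\<^sup>2) \<partial>M) = ennreal (\<integral>w. (err w)\<^sup>2 \<partial>M)"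
  proof (intro nn_integral_eq_integral)
    have "err \<in> borel_measurable M" using err_meas measurable_cong_sets[OF sets_M refl] by blast
    then show "integrable M (\<lambda>w. (err w)\<^sup>2)"
      using err_sq by (intro integrable_const_bound[of _ 1] AE_I2) auto
  qed simp
  ultimately show ?thesis using E0 by (simp add: ennreal_le_iff)
qed

text \<open>The losses of the minimiser and of the true reward are compared, the observed reward
  being the true reward function at the observed point plus \<open>err\<close> plus noise. Rescaling
  uses u^2 \<le> u; then 2 h err \<le> h^2 / 2 + 2 err^2 absorbs half of the left side, whence the
  factors 4. The noise is not split in this way, as its centring is still to be exploited.\<close>

lemma basic_inequality:
  assumes "fhat \<in> erm S N D" "0 < N" "0 \<le> u" "u \<le> 1"
  defines "h \<equiv> \<lambda>i. u * (fhat (observed S (D i)) - fs (observed S (D i)))"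
  shows "(1 / real N) * (\<Sum>i<N. (h i)\<^sup>2)
    \<le> 4 * ((1 / real N) * (\<Sum>i<N. (err (D i))\<^sup>2)) + 4 * ((1 / real N) * (\<Sum>i<N. noise_of (D i) * h i))"
proof -
  let ?d = "\<lambda>i. fhat (observed S (D i)) - fs (observed S (D i))"
  let ?y = "\<lambda>i. err (D i) + noise_of (D i)"
  have r: "reward_obs S w = fs (observed S w) + (err w + noise_of w)" for w
    by (simp add: reward_obs_def err_def noise_of_def case_prod_beta)
  have "empirical_loss S N D fhat \<le> empirical_loss S N D fs"
    using assms(1) fs_class by (auto simp: erm_def is_arg_min_def not_less)
  moreover have "empirical_loss S N D fhat = (1 / real N) * (\<Sum>i<N. (?d i - ?y i)\<^sup>2)"
    unfolding empirical_loss_def r by (intro arg_cong2[of _ _ _ _ "(*)"] sum.cong refl) (simp add: algebra_simps)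
  moreover have "empirical_loss S N D fs = (1 / real N) * (\<Sum>i<N. (?y i)\<^sup>2)"
    unfolding empirical_loss_def r
    by (intro arg_cong2[of _ _ _ _ "(*)"] sum.cong refl) (simp add: power2_eq_square algebra_simps)
  ultimately have "(\<Sum>i<N. (?d i - ?y i)\<^sup>2) \<le> (\<Sum>i<N. (?y i)\<^sup>2)"
    using \<open>0 < N\<close> by (simp add: divide_le_cancel)
  moreover have "(\<Sum>i<N. (?d i - ?y i)\<^sup>2) = (\<Sum>i<N. (?d i)\<^sup>2) - 2 * (\<Sum>i<N. ?d i * ?y i) + (\<Sum>i<N. (?y i)\<^sup>2)"
  proof -
    have "(?d i - ?y i)\<^sup>2 = (?d i)\<^sup>2 - 2 * (?d i * ?y i) + (?y i)\<^sup>2" for i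
      by (simp add: power2_eq_square algebra_simps)
    then show ?thesis by (simp only: sum.distrib sum_subtractf sum_distrib_left)
  qed
  ultimately have d: "(\<Sum>i<N. (?d i)\<^sup>2) \<le> 2 * (\<Sum>i<N. ?d i * ?y i)" by linarith
  have pos: "0 \<le> (\<Sum>i<N. (?d i)\<^sup>2)" by (intro sum_nonneg) auto
  have "(\<Sum>i<N. (h i)\<^sup>2) = u\<^sup>2 * (\<Sum>i<N. (?d i)\<^sup>2)"
    by (simp add: h_def power_mult_distrib sum_distrib_left)
  also have "\<dots> \<le> u * (\<Sum>i<N. (?d i)\<^sup>2)"
    using assms pos by (intro mult_right_mono) (auto simp: power2_eq_square mult_left_le)
  also have "\<dots> \<le> u * (2 * (\<Sum>i<N. ?d i * ?y i))" using d assms by (intro mult_left_mono) auto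
  also have "\<dots> = (\<Sum>i<N. 2 * (h i * err (D i))) + 2 * (\<Sum>i<N. noise_of (D i) * h i)"
    by (simp add: h_def sum_distrib_left sum.distrib[symmetric] algebra_simps)
  also have "(\<Sum>i<N. 2 * (h i * err (D i))) \<le> (\<Sum>i<N. (h i)\<^sup>2 / 2 + 2 * (err (D i))\<^sup>2)"
  proof (rule sum_mono)
    fix i
    have "0 \<le> (h i - 2 * err (D i))\<^sup>2" by simp
    also have "\<dots> = (h i)\<^sup>2 - 4 * (h i * err (D i)) + 4 * (err (D i))\<^sup>2"
      by (simp add: power2_eq_square algebra_simps)
    finally show "2 * (h i * err (D i)) \<le> (h i)\<^sup>2 / 2 + 2 * (err (D i))\<^sup>2" by linarith
  qed
  also have "\<dots> = (\<Sum>i<N. (h i)\<^sup>2) / 2 + 2 * (\<Sum>i<N. (err (D i))\<^sup>2)"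
    by (simp add: sum.distrib sum_divide_distrib sum_distrib_left)
  finally have "(\<Sum>i<N. (h i)\<^sup>2) \<le> 4 * (\<Sum>i<N. (err (D i))\<^sup>2) + 4 * (\<Sum>i<N. noise_of (D i) * h i)"
    by linarith
  then have "(1 / real N) * (\<Sum>i<N. (h i)\<^sup>2) \<le> (1 / real N) * (4 * (\<Sum>i<N. (err (D i))\<^sup>2) + 4 * (\<Sum>i<N. noise_of (D i) * h i))"
    by (rule mult_left_mono) simp
  then show ?thesis by (simp only: distrib_left mult.left_commute)
qed

end

section \<open>Rates\<close>

text \<open>Each contribution to the left side is at most a small multiple of t^2; the numerical
  constants are generous. The bound 1/2 \<le> L lets s absorb all terms of order 1/n and 1 / sqrt
  n.\<close>

lemma combine_bounds:
  fixes t lam r E s n L A q e V R S ES Eq K C :: real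
  assumes t: "0 < t" "t < 1" and C: "1000 * (K + 1) \<le> C" and K: "0 \<le> K" and n: "0 < n"
    and L: "L = n * s\<^sup>2" "1 / 2 \<le> L" and s: "0 < s" and lam: "0 < lam"
    and r: "5 * C * r \<le> t" "C * (lam * r) \<le> t" "0 < r"
    and E: "0 \<le> E" "C\<^sup>2 * E \<le> t\<^sup>2" and s2: "16 * C\<^sup>2 * s \<le> t\<^sup>2" and lams: "C * (lam * s) \<le> t"
    and R: "R \<le> t * r / 16"
    and q: "q \<le> 4 * (R + 1 / n) + 32 * s"
    and Eq: "Eq \<le> 4 * (R + 1 / n) + 32 / sqrt n"
    and S: "S = t\<^sup>2 + q + 4 / n" and ES: "ES = t\<^sup>2 + Eq + 4 / n"
    and V: "V \<le> R + 8 * (n * s / t) / n * (S + ES) + L / (n * s / t)"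
    and e: "e \<le> 2 * (K * E) + L / n"
    and A: "A \<le> 4 * e + 4 * (lam * V)"
  shows "A + q + 4 / n < t\<^sup>2"
proof -
  have C1: "1000 \<le> C" using C K by (simp add: distrib_left)
  have CC: "1000 * C \<le> C\<^sup>2" using C1 by (simp add: power2_eq_square)
  have t2: "0 < t\<^sup>2" "t\<^sup>2 \<le> t" using t by (auto simp: power2_eq_square mult_left_le)
  have sb: "16000000 * s \<le> t\<^sup>2"
  proof -
    have "1000 * 1000 \<le> C\<^sup>2" using CC C1 by linarith
    then have "16000000 * s \<le> 16 * C\<^sup>2 * s" using s by (intro mult_right_mono) auto
    then show ?thesis using s2 by linarith
  qed
  have s1: "s\<^sup>2 \<le> s"
  proof -
    have "s \<le> 1" using sb t2 t by linarith
    then show ?thesis using s by (simp add: power2_eq_square mult_left_le)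
  qed
  have sn: "1 / sqrt n \<le> 2 * s"
  proof -
    have "1 \<le> 4 * (n * s\<^sup>2)" using L by linarith
    then have "1 \<le> (2 * sqrt n * s)\<^sup>2" using n by (simp add: power_mult_distrib)
    then have "1 \<le> 2 * sqrt n * s" using n s by (metis abs_of_pos mult_pos_pos one_power2 power2_le_imp_le real_sqrt_gt_zero zero_less_numeral less_imp_le)
    then show ?thesis using n by (simp add: field_simps)
  qed
  have n1: "1 / n \<le> 2 * s"
  proof -
    have "1 / n \<le> 4 * s\<^sup>2" using L n by (simp add: field_simps)
    also have "\<dots> \<le> 4 * (s * (1/2))"
    proof -
      have "s \<le> 1 / 2" using sb t2 t by linarith
      then show ?thesis using s unfolding power2_eq_square by (intro mult_left_mono) auto
    qed
    finally show ?thesis by simp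
  qed
  have Rb: "R \<le> t\<^sup>2 / 80000"
  proof -
    have "5000 * r \<le> 5 * C * r" using C1 r by (intro mult_right_mono) auto
    then have "5000 * r \<le> t" using r by linarith
    then have "t * (5000 * r) \<le> t * t" using t by (intro mult_left_mono) auto
    then show ?thesis using R by (simp add: power2_eq_square)
  qed
  have lamR: "lam * R \<le> t\<^sup>2 / 16000"
  proof -
    have "1000 * (lam * r) \<le> C * (lam * r)" using C1 r lam by (intro mult_right_mono) auto
    then have "1000 * (lam * r) \<le> t" using r by linarith
    then have "t * (1000 * (lam * r)) \<le> t * t" using t by (intro mult_left_mono) auto
    moreover have "lam * R \<le> lam * (t * r / 16)" using R lam by (intro mult_left_mono) auto
    moreover have "t * (1000 * (lam * r)) = 16000 * (lam * (t * r / 16))" by simp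
    ultimately show ?thesis unfolding power2_eq_square by linarith
  qed
  have qb: "q \<le> t\<^sup>2 / 1000"
    using q[unfolded distrib_left] Rb n1 sb t2 by linarith
  have Eqb: "Eq \<le> t\<^sup>2 / 1000"
  proof -
    have "32 / sqrt n = 32 * (1 / sqrt n)" by simp
    then show ?thesis using Eq[unfolded distrib_left] Rb n1 sn sb t2 by linarith
  qed
  have Sb: "S + ES \<le> 3 * t\<^sup>2" using S ES qb Eqb n1 sb t2 by linarith
  have lamV: "lam * V \<le> t\<^sup>2 / 16000 + 25 * (lam * s) * t"
  proof -
    \<comment> \<open>With n s / t in the role of \<theta>, a variance of order t^2 leads to a
      deviation of order s t in both terms: 24 s t here and s t from L / \<theta>.\<close>
    have "8 * (n * s / t) / n * (S + ES) \<le> 8 * (n * s / t) / n * (3 * t\<^sup>2)"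
      using Sb n s t by (intro mult_left_mono) auto
    also have "\<dots> = 24 * s * t" using n t by (simp add: power2_eq_square)
    finally have 1: "8 * (n * s / t) / n * (S + ES) \<le> 24 * s * t" .
    have 2: "L / (n * s / t) = s * t" using n s t by (simp add: L power2_eq_square)
    have "V \<le> R + 25 * s * t" using V 1 2 by linarith
    then have "lam * V \<le> lam * (R + 25 * s * t)" using lam by (intro mult_left_mono) auto
    then show ?thesis using lamR by (simp add: distrib_left mult_ac)
  qed
  have lst: "1000 * ((lam * s) * t) \<le> t\<^sup>2"
  proof -
    have "1000 * (lam * s) \<le> C * (lam * s)" using C1 s lam by (intro mult_right_mono) auto
    then have "1000 * (lam * s) \<le> t" using lams by linarith
    then have "1000 * (lam * s) * t \<le> t * t" using t by (intro mult_right_mono) auto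
    then show ?thesis by (simp add: power2_eq_square)
  qed
  have KE: "1000 * (K * E) \<le> t\<^sup>2"
  proof -
    have "1000 * K \<le> C\<^sup>2" using C[unfolded distrib_left] CC C1 K by linarith
    then have "1000 * K * E \<le> C\<^sup>2 * E" using E by (intro mult_right_mono) auto
    then show ?thesis using E by linarith
  qed
  have "L / n = s\<^sup>2" using n by (simp add: L)
  then show ?thesis using A e KE lamV lst qb n1 s1 sb t2 by linarith
qed

context valid
begin

lemma with_prob_trivial:
  assumes "p \<le> 1" "\<And>D. Q D"
  shows "with_prob_at_least (data_law S N) p Q"
proof -
  interpret prob_space "data_law S N"
    unfolding data_law_eq by (intro prob_space_PiM M_prob)
  show ?thesis unfolding with_prob_at_least_def
    using assms by (intro bexI[of _ "space (data_law S N)"]) (auto simp: prob_space)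
qed

lemma concentration:
  assumes N: "1 \<le> N" and def: "rademacher_defined S N" and crit: "is_critical_radius S N r"
    and \<delta>: "0 < \<delta>" "\<delta> < 1" and t: "0 < t" "t < 1"
  defines "L \<equiv> ln (2 / \<delta>)" and "s \<equiv> sqrt (ln (2 / \<delta>) / real N)"
    and "C \<equiv> 1000 * (real (card (actions S)) + 1)"
  assumes r: "5 * C * r \<le> t" "C * (lam * r) \<le> t"
    and E: "C\<^sup>2 * elasticity S \<le> t\<^sup>2" and s2: "16 * C\<^sup>2 * s \<le> t\<^sup>2" and lams: "C * (lam * s) \<le> t"
  shows "with_prob_at_least (data_law S N) (1 - 4 * \<delta>) (\<lambda>D. \<forall>fhat\<in>erm S N D. l2dist S fhat fs \<le> t)"
proof -
  interpret wp: weighted_process M N "deviations t" t clipped forget_noise by (rule process[OF N t(1) def])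
  let ?n = "real N"
  have n: "0 < ?n" using N by simp
  have r0: "0 < r" using crit by (simp add: is_critical_radius_def)
  have "exp (1 / 2 :: real) \<le> 2"
    using exp_bound[of "1/2::real"] by (simp add: power2_eq_square)
  also have "2 \<le> 2 / \<delta>" using \<delta> by (simp add: field_simps)
  finally have L_half: "1 / 2 \<le> L" unfolding L_def using \<delta> by (subst ln_ge_iff) auto
  have expL: "exp (- L) = \<delta> / 2" using \<delta> by (simp add: L_def exp_minus)
  have s_pos: "0 < s" using L_half n by (simp add: s_def L_def)
  have Ls: "L = ?n * s\<^sup>2" using L_half n by (simp add: s_def L_def)
  \<comment> \<open>Balances the variance term \<theta> t^2 / N against L / \<theta>: both equal s
    t.\<close>
  define \<theta> where "\<theta> = ?n * s / t"
  have \<theta>: "0 < \<theta>" using n s_pos t by (simp add: \<theta>_def)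
  have errm [measurable]: "(\<lambda>w. (err w)\<^sup>2) \<in> borel_measurable M"
    using borel_measurable_power[OF err_meas, of 2] measurable_cong_sets[OF sets_M refl] by blast
  have noim [measurable]: "noise_of \<in> borel_measurable M"
    using noise_of_meas measurable_cong_sets[OF sets_M refl] by blast
  have [measurable]: "(\<lambda>D. (err (D i))\<^sup>2) \<in> borel_measurable wp.P" "(\<lambda>D. noise_of (D i)) \<in> borel_measurable wp.P" if "i < N" for i
    using that by (auto intro!: measurable_compose[OF _ errm] measurable_compose[OF _ noim] measurable_component_singleton)
  have [measurable]: "wp.S \<in> borel_measurable wp.P" unfolding wp.S_def by measurable
  let ?e = "\<lambda>D. (1 / ?n) * (\<Sum>i<N. (err (D i))\<^sup>2)"
  let ?B1 = "{X \<in> space wp.P. wp.q X \<ge> 4 * (wp.R + 1 / ?n) + 32 * sqrt (L / ?n)}"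
  let ?B2 = "{D \<in> space wp.P. wp.V D \<ge> wp.R + 8 * \<theta> / ?n * (wp.S D + (\<integral>X. wp.S X \<partial>wp.P)) + L / \<theta>}"
  let ?B3 = "{D \<in> space wp.P. ?e D \<ge> 2 * (\<integral>w. (err w)\<^sup>2 \<partial>M) + L / ?n}"
  let ?B4 = "{D \<in> space wp.P. \<not> (\<forall>i<N. \<bar>noise_of (D i)\<bar> \<le> lam)}"
  \<comment> \<open>The four failure probabilities add up to 2 \<delta>: \<delta> for
    \<open>q\<close>, whose tail carries a factor 2, \<delta> / 2 each for the weighted supremum and
    the imputation error, and 0 for noise outside its range.\<close>
  have B1: "wp.P.prob ?B1 \<le> \<delta>" using wp.q_tail[of L] L_half expL by simp
  have B2: "wp.P.prob ?B2 \<le> \<delta> / 2" using wp.V_tail[OF \<theta>, of L] expL by simp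
  have B3: "wp.P.prob ?B3 \<le> \<delta> / 2"
    using wp.mean_tail[of "\<lambda>w. (err w)\<^sup>2" L] err_sq expL by simp
  have B4: "wp.P.prob ?B4 = 0"
  proof -
    have "AE D in wp.P. \<forall>i<N. \<bar>noise_of (D i)\<bar> \<le> lam"
      unfolding AE_all_countable[symmetric]
      by (auto intro!: AE_PiM_component[where I = "{..<N}" and M = "\<lambda>_. M"] M_prob AE_noise_bound
          simp: AE_all_countable)
    then show ?thesis by (subst wp.P.prob_eq_0) (auto elim!: eventually_mono)
  qed
  define G where "G = space wp.P - (?B1 \<union> ?B2 \<union> ?B3 \<union> ?B4)"
  have Bsets: "?B1 \<in> sets wp.P" "?B2 \<in> sets wp.P" "?B3 \<in> sets wp.P" "?B4 \<in> sets wp.P"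
    by measurable
  have "wp.P.prob (?B1 \<union> ?B2) \<le> wp.P.prob ?B1 + wp.P.prob ?B2"
    by (rule measure_Un_le[OF Bsets(1,2)])
  moreover have "wp.P.prob (?B1 \<union> ?B2 \<union> ?B3) \<le> wp.P.prob (?B1 \<union> ?B2) + wp.P.prob ?B3"
    by (rule measure_Un_le[OF sets.Un[OF Bsets(1,2)] Bsets(3)])
  moreover have "wp.P.prob (?B1 \<union> ?B2 \<union> ?B3 \<union> ?B4) \<le> wp.P.prob (?B1 \<union> ?B2 \<union> ?B3) + wp.P.prob ?B4"
    by (rule measure_Un_le[OF sets.Un[OF sets.Un[OF Bsets(1,2)] Bsets(3)] Bsets(4)])
  ultimately have "wp.P.prob (?B1 \<union> ?B2 \<union> ?B3 \<union> ?B4) \<le> wp.P.prob ?B1 + wp.P.prob ?B2 + wp.P.prob ?B3 + wp.P.prob ?B4"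
    by linarith
  also have "\<dots> \<le> 4 * \<delta>" using B1 B2 B3 B4 \<delta> by linarith
  finally have prob: "1 - 4 * \<delta> \<le> wp.P.prob G"
    unfolding G_def using Bsets by (subst wp.P.prob_compl) auto
  have "l2dist S fhat fs \<le> t" if D: "D \<in> G" and fhat: "fhat \<in> erm S N D" for D fhat
  proof (rule ccontr)
    assume "\<not> l2dist S fhat fs \<le> t"
    then have far: "t < l2dist S fhat fs" by simp
    define u where "u = t / l2dist S fhat fs"
    have u: "0 \<le> u" "u \<le> 1" "u * l2dist S fhat fs = t" using far t by (auto simp: u_def)
    have fc: "fhat \<in> reward_class S" using fhat by (auto simp: erm_def is_arg_min_def)
    let ?f = "\<lambda>p. (1 - u) * fs p + u * fhat p"
    define h where "h w = u * (fhat (observed S w) - fs (observed S w))" for w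
    have h_eq: "h = (\<lambda>w. ?f (observed S w) - fs (observed S w))" by (simp add: h_def fun_eq_iff algebra_simps)
    have norm_f: "l2dist S ?f fs = t" using u by (simp add: l2dist_convex_comb)
    have fcl: "?f \<in> reward_class S" using u by (intro convex_class fs_class fc) auto
    have hH: "h \<in> deviations t"
      unfolding deviations_def h_eq using fcl norm_f by (intro image_eqI[of _ _ ?f]) auto
    have norm_h: "(\<integral>w. (h w)\<^sup>2 \<partial>M) = t\<^sup>2" using l2dist_sq[of ?f fs] norm_f by (simp add: h_eq)
    have DP: "D \<in> space wp.P" using D by (simp add: G_def)
    have nb: "\<bar>noise_of (D i)\<bar> \<le> lam" if "i < N" for i using D DP that by (auto simp: G_def)
    let ?A = "(1 / ?n) * (\<Sum>i<N. (h (D i))\<^sup>2)"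
    have "(1 / ?n) * (\<Sum>i<N. noise_of (D i) * h (D i)) = lam * ((1 / ?n) * (\<Sum>i<N. clipped (D i) * h (D i)))"
      using clipped_eq[OF nb] by (simp add: sum_distrib_left mult.assoc[symmetric])
    also have "\<dots> \<le> lam * wp.V D" using lam_pos by (intro mult_left_mono wp.V_dominates DP hH) auto
    finally have noise_le: "(1 / ?n) * (\<Sum>i<N. noise_of (D i) * h (D i)) \<le> lam * wp.V D" .
    \<comment> \<open>Since h has norm exactly t, its empirical second moment cannot be much below
      t^2, whereas the basic inequality forces it to be.\<close>
    have "t\<^sup>2 \<le> ?A + wp.q D + 4 / ?n"
      using wp.q_dominates[OF hH DP] norm_h by linarith
    moreover have "?A + wp.q D + 4 / ?n < t\<^sup>2"
    proof (rule combine_bounds[where K = "real (card (actions S))" and C = C and s = s and L = L and lam = lam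
          and r = r and E = "elasticity S" and R = wp.R and Eq = "\<integral>X. wp.q X \<partial>wp.P" and S = "wp.S D"
          and ES = "\<integral>X. wp.S X \<partial>wp.P" and V = "wp.V D" and e = "?e D"])
      show "0 \<le> elasticity S" using upsilon_pos upsilon_le_elasticity by linarith
      have "wp.R = rademacher S N t"
        by (simp add: wp.R_def wp.W_def SUP_deviations rademacher_eq[OF N t(1) def] data_law_eq del: times_divide_eq_left)
      moreover have "rademacher S N t \<le> t / r * rademacher S N r"
      proof (rule rademacher_scale[OF N r0 _ def])
        have "r \<le> 5 * C * r" using r0 by (simp add: C_def)
        then show "r \<le> t" using r by linarith
      qed
      moreover have "rademacher S N r \<le> r * r / 16"
        using crit r0 by (simp add: is_critical_radius_def field_simps)
      then have "t / r * rademacher S N r \<le> t / r * (r * r / 16)" using t r0 by (intro mult_left_mono) auto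
      moreover have "t / r * (r * r / 16) = t * r / 16" using r0 by simp
      ultimately show "wp.R \<le> t * r / 16" by linarith
      show "wp.q D \<le> 4 * (wp.R + 1 / ?n) + 32 * s" using D DP by (auto simp: G_def s_def L_def)
      show "(\<integral>X. wp.q X \<partial>wp.P) \<le> 4 * (wp.R + 1 / ?n) + 32 / sqrt ?n" by (rule wp.q_expectation)
      show "wp.S D = t\<^sup>2 + wp.q D + 4 / ?n" by (simp add: wp.S_def)
      show "(\<integral>X. wp.S X \<partial>wp.P) = t\<^sup>2 + (\<integral>X. wp.q X \<partial>wp.P) + 4 / ?n"
        using wp.q_integrable by (simp add: wp.S_def wp.P.prob_space)
      show "wp.V D \<le> wp.R + 8 * (?n * s / t) / ?n * (wp.S D + (\<integral>X. wp.S X \<partial>wp.P)) + L / (?n * s / t)"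
        using D DP by (auto simp: G_def \<theta>_def[symmetric])
      have "?e D \<le> 2 * (\<integral>w. (err w)\<^sup>2 \<partial>M) + L / ?n" using D DP by (auto simp: G_def)
      then show "?e D \<le> 2 * (real (card (actions S)) * elasticity S) + L / ?n"
        using err_mean by linarith
      show "?A \<le> 4 * ?e D + 4 * (lam * wp.V D)"
        using basic_inequality[OF fhat _ u(1,2)] n noise_le unfolding h_def by linarith
    qed (use t n Ls L_half s_pos lam_pos r r0 E s2 lams in \<open>auto simp: C_def\<close>)
    ultimately show False by simp
  qed
  then show ?thesis
    unfolding with_prob_at_least_def data_law_eq using prob Bsets
    by (intro bexI[of _ G]) (auto simp: G_def)
qed

lemma fast_rate:
  assumes N: "1 \<le> N" and def: "rademacher_defined S N" and crit: "is_critical_radius S N r"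
    and \<delta>: "0 < \<delta>" "\<delta> < 1" "\<delta> \<le> phi lam r"
  shows "with_prob_at_least (data_law S N) (1 - 4 * \<delta>) (\<lambda>D. \<forall>fhat\<in>erm S N D.
     l2dist S fhat fs \<le> (1000 * (real (card (actions S)) + 1)) * ((max 4 lam + 1) * r + sqrt (elasticity S)
                    + 4 * max 4 lam * sqrt (2 * ln (phi lam r / \<delta>) / real N)
                    + ln (phi lam r / \<delta>) / (r * real N)
                    + 4 / (upsilon S fs) powr (1 / 2) * sqrt (ln (2 / \<delta>) / real N)))"
proof -
  define C where "C = 1000 * (real (card (actions S)) + 1)"
  define s where "s = sqrt (ln (2 / \<delta>) / real N)"
  define a1 where "a1 = (max 4 lam + 1) * r"
  define a2 where "a2 = sqrt (elasticity S)"
  define a3 where "a3 = 4 * max 4 lam * sqrt (2 * ln (phi lam r / \<delta>) / real N)"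
  define a4 where "a4 = ln (phi lam r / \<delta>) / (r * real N)"
  define a5 where "a5 = 4 / (upsilon S fs) powr (1 / 2) * s"
  define t where "t = C * (a1 + a2 + a3 + a4 + a5)"
  have C: "1000 \<le> C" by (simp add: C_def)
  have r0: "0 < r" using crit by (simp add: is_critical_radius_def)
  have n: "0 < real N" using N by simp
  have lnphi: "0 \<le> ln (phi lam r / \<delta>)" using \<delta> by (intro ln_ge_zero) (simp add: field_simps)
  have s0: "0 \<le> s" using \<delta> n by (simp add: s_def)
  have E0: "0 < elasticity S" using upsilon_pos upsilon_le_elasticity by linarith
  have a: "0 < a1" "0 \<le> a2" "0 \<le> a3" "0 \<le> a4" "0 \<le> a5"
    using r0 lnphi n E0 s0 by (auto simp: a1_def a2_def a3_def a4_def a5_def intro!: mult_pos_pos)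
  have t0: "0 < t" using C a by (auto simp: t_def intro!: mult_pos_pos)
  have le_t: "C * x \<le> t" if "x \<le> a1 + a2 + a3 + a4 + a5" for x
    unfolding t_def using that C by (intro mult_left_mono) auto
  have "with_prob_at_least (data_law S N) (1 - 4 * \<delta>) (\<lambda>D. \<forall>fhat\<in>erm S N D. l2dist S fhat fs \<le> t)"
  proof (cases "t < 1")
    \<comment> \<open>Distances between members of the class never exceed 1, so for t \<ge> 1 the
      bound holds surely.\<close>
    case False
    then show ?thesis
      using \<delta> l2dist_le_1[OF _ fs_class]
      by (intro with_prob_trivial) (force simp: erm_def is_arg_min_def)+
  next
    case True
    \<comment> \<open>In the product a2 a5 the quotient sqrt (elasticity) / sqrt (upsilon) is at
      least 1 and leaves 4 s; then 4 a2 a5 \<le> (a2 + a5)^2.\<close>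
    have s2: "16 * C\<^sup>2 * s \<le> t\<^sup>2"
    proof -
      have u: "0 < upsilon S fs" by (rule upsilon_pos)
      have "1 \<le> sqrt (elasticity S) / sqrt (upsilon S fs)"
        using u upsilon_le_elasticity by (simp add: field_simps)
      then have "16 * s * 1 \<le> 16 * s * (sqrt (elasticity S) / sqrt (upsilon S fs))"
        using s0 by (intro mult_left_mono) auto
      also have "\<dots> = 4 * (a2 * a5)" using u by (simp add: a2_def a5_def powr_half_sqrt)
      also have "\<dots> \<le> (a2 + a5)\<^sup>2"
        using zero_le_power2[of "a2 - a5"] by (simp add: power2_eq_square algebra_simps)
      also have "\<dots> \<le> (a1 + a2 + a3 + a4 + a5)\<^sup>2" using a by (intro power_mono) auto
      finally have "C\<^sup>2 * (16 * s * 1) \<le> C\<^sup>2 * (a1 + a2 + a3 + a4 + a5)\<^sup>2" by (intro mult_left_mono) auto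
      then show ?thesis by (simp add: t_def power_mult_distrib mult_ac)
    qed
    have r1: "5 * C * r \<le> t"
    proof -
      have "5 * r \<le> a1" unfolding a1_def using r0 by (intro mult_right_mono) auto
      then show ?thesis using le_t[of "5 * r"] a by simp
    qed
    have r2: "C * (lam * r) \<le> t"
    proof -
      have "lam * r \<le> a1" unfolding a1_def using r0 by (intro mult_right_mono) auto
      then show ?thesis using le_t[of "lam * r"] a by simp
    qed
    have E: "C\<^sup>2 * elasticity S \<le> t\<^sup>2"
    proof -
      have "(C * a2)\<^sup>2 \<le> t\<^sup>2" using le_t[of a2] a C by (intro power_mono) auto
      then show ?thesis using E0 by (simp add: a2_def power_mult_distrib)
    qed
    \<comment> \<open>For \<lambda> \<le> 4 this follows from \<open>s2\<close> and t < 1. For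
      larger \<lambda> the term a3 is used, whose logarithm must be at least ln (2 / \<delta>): as r
      \<le> 1, the argument 4 \<lambda> / r of the binary logarithm is at least 4, so
      \<open>phi lam r\<close> is at least 2.\<close>
    have lams: "C * (lam * s) \<le> t"
    proof (cases "lam \<le> 4")
      case True
      have "C * (lam * s) \<le> C * (4 * s)" using True C s0 by (intro mult_left_mono mult_right_mono) auto
      also have "\<dots> \<le> C * (16 * C * s)" using C s0 by (intro mult_left_mono mult_right_mono) auto
      also have "\<dots> = 16 * C\<^sup>2 * s" by (simp add: power2_eq_square)
      also have "\<dots> \<le> t\<^sup>2" by (rule s2)
      also have "\<dots> \<le> t" using t0 \<open>t < 1\<close> by (simp add: power2_eq_square mult_left_le)
      finally show ?thesis .
    next
      case False
      have "5000 * r \<le> 5 * C * r" using C r0 by (intro mult_right_mono) auto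
      then have "r \<le> 1" using r1 \<open>t < 1\<close> r0 by linarith
      then have "4 \<le> 4 * lam / r" using False r0 by (simp add: field_simps)
      then have "log 2 (2 powr 2) \<le> phi lam r"
        unfolding phi_def using False r0 by (subst log_le_cancel_iff) auto
      moreover have "log 2 (2 powr 2) = (2 :: real)" by (rule log_powr_cancel) auto
      ultimately have "2 \<le> phi lam r" by (simp only:)
      then have "2 / \<delta> \<le> phi lam r / \<delta>" using \<delta> by (intro divide_right_mono) auto
      then have "ln (2 / \<delta>) \<le> ln (phi lam r / \<delta>)" using \<delta> by (subst ln_le_cancel_iff) (auto intro: less_le_trans)
      then have "s \<le> sqrt (2 * ln (phi lam r / \<delta>) / real N)"
        unfolding s_def using n lnphi by (intro real_sqrt_le_mono divide_right_mono) auto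
      then have "lam * s \<le> (4 * max 4 lam) * sqrt (2 * ln (phi lam r / \<delta>) / real N)"
        using False s0 by (intro mult_mono) auto
      then have "lam * s \<le> a3" by (simp add: a3_def)
      then show ?thesis using le_t[of "lam * s"] a by simp
    qed
    show ?thesis
      using concentration[OF N def crit \<delta>(1,2) t0 True] r1 r2 E s2 lams by (simp add: C_def s_def)
  qed
  then show ?thesis
    unfolding t_def C_def a1_def a2_def a3_def a4_def a5_def s_def .
qed

lemma slow_rate:
  assumes \<delta>: "0 < \<delta>" "\<delta> < 1" and r: "0 < r" and N: "1 \<le> N"
  shows "with_prob_at_least (data_law S N) (1 - \<delta>) (\<lambda>D. \<forall>fhat\<in>erm S N D.
     (l2dist S fhat fs)\<^sup>2 \<le> 1 / upsilon S fs * (r\<^sup>2 + elasticity S + 2 * ln (phi lam r / \<delta>) / real N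
                  + (ln (phi lam r / \<delta>))\<^sup>2 / (r * real N)\<^sup>2
                  + ln (2 / \<delta>) / real N))"
proof (intro with_prob_trivial ballI)
  fix D fhat assume "fhat \<in> erm S N D"
  then have fc: "fhat \<in> reward_class S" by (auto simp: erm_def is_arg_min_def)
  let ?L = "ln (phi lam r / \<delta>)"
  \<comment> \<open>Here the logarithm may be negative, as \<delta> is not compared with
    \<open>phi lam r\<close>. The three terms in question still have a nonnegative sum, since they
    form a perfect square.\<close>
  have "0 \<le> (r + ?L / (r * real N))\<^sup>2" by simp
  also have "\<dots> = r\<^sup>2 + 2 * ?L / real N + ?L\<^sup>2 / (r * real N)\<^sup>2"
    using r N by (simp add: power2_sum power_divide)
  finally have sq: "0 \<le> r\<^sup>2 + 2 * ?L / real N + ?L\<^sup>2 / (r * real N)\<^sup>2" .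
  have "0 \<le> ln (2 / \<delta>) / real N" using \<delta> by simp
  then have ge: "upsilon S fs \<le> r\<^sup>2 + elasticity S + 2 * ?L / real N + ?L\<^sup>2 / (r * real N)\<^sup>2 + ln (2 / \<delta>) / real N"
    using sq upsilon_le_elasticity by linarith
  have "(l2dist S fhat fs)\<^sup>2 \<le> 1"
    using l2dist_le_1[OF fc fs_class] l2dist_nonneg[of fhat fs] by (simp add: abs_square_le_1)
  also have "1 = 1 / upsilon S fs * upsilon S fs" using upsilon_pos by simp
  also have "\<dots> \<le> 1 / upsilon S fs * (r\<^sup>2 + elasticity S + 2 * ?L / real N + ?L\<^sup>2 / (r * real N)\<^sup>2 + ln (2 / \<delta>) / real N)"
    using ge upsilon_pos by (intro mult_left_mono) auto
  finally show "(l2dist S fhat fs)\<^sup>2 \<le> 1 / upsilon S fs * (r\<^sup>2 + elasticity S + 2 * ?L / real N + ?L\<^sup>2 / (r * real N)\<^sup>2 + ln (2 / \<delta>) / real N)" .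
qed (use \<delta> in simp)

end

theorem theorem1:
  shows
    "(\<forall>K. \<exists>c>0. \<forall>S N r. valid_setting S \<longrightarrow> card (actions S) = K \<longrightarrow> 1 \<le> N \<longrightarrow>
        rademacher_defined S N \<longrightarrow> is_critical_radius S N r \<longrightarrow>
        (let lam = noise_bound S; fs = true_reward S in
         \<forall>\<delta>\<in>{0<..<1}. \<delta> \<le> phi lam r \<longrightarrow>
           with_prob_at_least (data_law S N) (1 - 4 * \<delta>) (\<lambda>D. \<forall>fhat\<in>erm S N D.
             l2dist S fhat fs \<le>
               c * ((max 4 lam + 1) * r + sqrt (elasticity S)
                    + 4 * max 4 lam * sqrt (2 * ln (phi lam r / \<delta>) / real N)
                    + ln (phi lam r / \<delta>) / (r * real N)
                    + 4 / (upsilon S fs) powr (1 / 2) * sqrt (ln (2 / \<delta>) / real N)))))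
     \<and> (\<exists>C :: real \<Rightarrow> real \<Rightarrow> real. \<forall>S N r. valid_setting S \<longrightarrow> 1 \<le> N \<longrightarrow>
        rademacher_defined S N \<longrightarrow> is_critical_radius S N r \<longrightarrow>
        (let lam = noise_bound S; fs = true_reward S in
         \<forall>\<delta>\<in>{0<..<1}.
           with_prob_at_least (data_law S N) (1 - \<delta>) (\<lambda>D. \<forall>fhat\<in>erm S N D.
             (l2dist S fhat fs)\<^sup>2 \<le>
               C lam (upsilon S fs) *
                 (r\<^sup>2 + elasticity S + 2 * ln (phi lam r / \<delta>) / real N
                  + (ln (phi lam r / \<delta>))\<^sup>2 / (r * real N)\<^sup>2
                  + ln (2 / \<delta>) / real N))))"
proof (intro conjI allI, goal_cases)
  case (1 K)
  then show ?case
    using valid.fast_rate[OF valid.intro] unfolding Let_def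
    by (intro exI[of _ "1000 * (real K + 1)"] conjI allI impI ballI) auto
next
  case 2
  then show ?case
    using valid.slow_rate[OF valid.intro] unfolding Let_def
    by (intro exI[of _ "\<lambda>lam v. 1 / v"] allI impI ballI) (auto simp: is_critical_radius_def)
qed

end
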